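(* Let $(G,g)$ be a Lie group equipped with a left-invariant semi-Riemannian metric $g$. Let $K$ be a Lie subgroup of $G$, of codimension two, such that the restriction of $g$ to the Lie algebra $\mathfrak{k}$ of $K$ is non-degenerate, and suppose that $K$ generates a left-invariant conformal foliation $\mathcal{F}$ on $G$. If $K$ is semisimple, then the foliation $\mathcal{F}$ is minimal.
   Context: A Lie group is semisimple if its Lie algebra is semisimple. Let $\mathfrak{g}$ be the Lie algebra of $G$. The foliation $\mathcal{F}$ generated by $K$ is the foliation tangent to the left-invariant integrable distribution $\mathcal{V}$ on $G$ obtained by left-translating $\mathfrak{k}\subset\mathfrak{g}$. Let $\mathcal{H}$ be the orthogonal complementary distribution of $\mathcal{V}$ with respect to $g$ (it has rank two); the symbols $\mathcal{V},\mathcal{H}$ also denote the orthogonal projections of $TG$ onto these subbundles. Let $\nabla$ be the Levi-Civita connection of $g$. The second fundamental forms are $$B^{\mathcal{V}}(V,W)=\tfrac12\,\mathcal{H}(\nabla_V W+\nabla_W V)\ \ (V,W\in\mathcal{V}),\qquad B^{\mathcal{H}}(X,Y)=\tfrac12\,\mathcal{V}(\nabla_X Y+\nabla_Y X)\ \ (X,Y\in\mathcal{H}).$$ The foliation $\mathcal{F}$ is conformal if there is a vector field $V\in\mathcal{V}$ such that $B^{\mathcal{H}}(X,Y)=g(X,Y)\,V$ for all $X,Y\in\mathcal{H}$. It is minimal if $\operatorname{trace} B^{\mathcal{V}}=0$, where the trace is taken with respect to $g$, i.e. $\operatorname{trace}B^{\mathcal{V}}=\sum_i \varepsilon_i B^{\mathcal{V}}(V_i,V_i)$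 for a local orthonormal frame $\{V_i\}$ of $\mathcal{V}$ with $g(V_i,V_j)=\varepsilon_i\delta_{ij}$, $\varepsilon_i\in\{\pm1\}$. *)

theory Defs
  imports
    "HOL-Analysis.Analysis"
    "HOL-Algebra.Group"
    "HOL-Library.Function_Algebras"
begin

text \<open>
  Pointwise scalar multiplication. Tangent vectors and vector fields are functions below, so this
  makes \<^const>\<open>subspace\<close>, \<^const>\<open>span\<close> and \<^const>\<open>dim\<close> available for them.
\<close>

instantiation "fun" :: (type, scaleR) scaleR
begin
definition scaleR_fun_def: "c *\<^sub>R f = (\<lambda>x. c *\<^sub>R f x)"
instance ..
end

lemma scaleR_fun_apply [simp]: "(c *\<^sub>R f) x = c *\<^sub>R f x"
  by (simp add: scaleR_fun_def)

instance "fun" :: (type, real_vector) real_vector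
  by standard (simp_all add: fun_eq_iff scaleR_add_right scaleR_add_left)


section \<open>Smooth manifolds\<close>

text \<open>
  A manifold is modelled on a linear subspace \<open>E\<close> of a Euclidean space, which plays the role of
  \<open>\<real>\<^sup>n\<close> with \<open>n = dim E\<close>. Using a subspace rather than a whole type leaves \<open>n\<close> arbitrary,
  and in particular allows \<open>n = 0\<close>. In the two definitions below \<open>S\<close> is a relatively open subset
  of \<open>E\<close>; the derivative \<open>f' x\<close> is then determined on \<open>E\<close>, the only place where it is used.
\<close>

primrec Ck_on :: "nat \<Rightarrow> 'e set \<Rightarrow> 'e set \<Rightarrow> ('e::euclidean_space \<Rightarrow> 'f::real_normed_vector) \<Rightarrow> bool"
  where
    "Ck_on 0 E S f \<longleftrightarrow> continuous_on S f"
  | "Ck_on (Suc k) E S f \<longleftrightarrow>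
       (\<exists>f'. (\<forall>x\<in>S. (f has_derivative f' x) (at x within S)) \<and>
             (\<forall>v\<in>E. Ck_on k E S (\<lambda>x. f' x v)))"

definition smooth_on :: "'e set \<Rightarrow> 'e set \<Rightarrow> ('e::euclidean_space \<Rightarrow> 'f::real_normed_vector) \<Rightarrow> bool"
  where "smooth_on E S f \<longleftrightarrow> (\<forall>k. Ck_on k E S f)"

record ('a, 'e) manifold =
  mtop :: "'a topology"
  model :: "'e set"
  atlas :: "('a set \<times> ('a \<Rightarrow> 'e)) set"

definition chart :: "'a topology \<Rightarrow> 'e::euclidean_space set \<Rightarrow> 'a set \<times> ('a \<Rightarrow> 'e) \<Rightarrow> bool"
  where "chart T E = (\<lambda>(U, \<phi>). openin T U \<and> openin (top_of_set E) (\<phi> ` U) \<and>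
           homeomorphic_map (subtopology T U) (top_of_set (\<phi> ` U)) \<phi>)"

definition smooth_manifold :: "('a, 'e::euclidean_space) manifold \<Rightarrow> bool"
  where "smooth_manifold M \<longleftrightarrow>
    Hausdorff_space (mtop M) \<and> second_countable (mtop M) \<and> subspace (model M) \<and>
    (\<forall>c\<in>atlas M. chart (mtop M) (model M) c) \<and>
    topspace (mtop M) = (\<Union>(U, \<phi>)\<in>atlas M. U) \<and>
    (\<forall>(U, \<phi>)\<in>atlas M. \<forall>(V, \<psi>)\<in>atlas M.
       smooth_on (model M) (\<phi> ` (U \<inter> V)) (\<psi> \<circ> inv_into U \<phi>))"

definition smooth_map ::
    "('a, 'e::euclidean_space) manifold \<Rightarrow> ('b, 'f::euclidean_space) manifold \<Rightarrow> ('a \<Rightarrow> 'b) \<Rightarrow> bool"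
  where "smooth_map M N F \<longleftrightarrow> continuous_map (mtop M) (mtop N) F \<and>
    (\<forall>(U, \<phi>)\<in>atlas M. \<forall>(V, \<psi>)\<in>atlas N.
       smooth_on (model M) (\<phi> ` (U \<inter> F -` V)) (\<psi> \<circ> F \<circ> inv_into U \<phi>))"

definition prod_manifold ::
    "('a, 'e::euclidean_space) manifold \<Rightarrow> ('b, 'f::euclidean_space) manifold \<Rightarrow> ('a \<times> 'b, 'e \<times> 'f) manifold"
  where "prod_manifold M N =
    \<lparr>mtop = prod_topology (mtop M) (mtop N), model = model M \<times> model N,
     atlas = {(U \<times> V, map_prod \<phi> \<psi>) | U \<phi> V \<psi>. (U, \<phi>) \<in> atlas M \<and> (V, \<psi>) \<in> atlas N}\<rparr>"

definition smooth_fun :: "('a, 'e::euclidean_space) manifold \<Rightarrow> 'a set \<Rightarrow> ('a \<Rightarrow> real) \<Rightarrow> bool"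
  where "smooth_fun M W f \<longleftrightarrow>
    (\<forall>(U, \<phi>)\<in>atlas M. smooth_on (model M) (\<phi> ` (U \<inter> W)) (f \<circ> inv_into U \<phi>))"

definition smooth_at :: "('a, 'e::euclidean_space) manifold \<Rightarrow> 'a \<Rightarrow> ('a \<Rightarrow> real) \<Rightarrow> bool"
  where "smooth_at M p f \<longleftrightarrow> (\<exists>W. openin (mtop M) W \<and> p \<in> W \<and> smooth_fun M W f)"


section \<open>Tangent vectors and vector fields\<close>

text \<open>
  Tangent vectors at \<open>p\<close> are derivations on the functions smooth near \<open>p\<close>. By convention they
  vanish on all other functions, and vector fields vanish outside the manifold, so that equality
  of tangent vectors and of vector fields is equality in HOL.
\<close>

type_synonym 'a tvec = "('a \<Rightarrow> real) \<Rightarrow> real"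
type_synonym 'a vfield = "'a \<Rightarrow> 'a tvec"

definition tangent_space :: "('a, 'e::euclidean_space) manifold \<Rightarrow> 'a \<Rightarrow> 'a tvec set"
  where "tangent_space M p = {v.
    (\<forall>f h. smooth_at M p f \<longrightarrow> smooth_at M p h \<longrightarrow>
       v (f + h) = v f + v h \<and> v (f * h) = f p * v h + h p * v f) \<and>
    (\<forall>c f. smooth_at M p f \<longrightarrow> v (c *\<^sub>R f) = c * v f) \<and>
    (\<forall>f. \<not> smooth_at M p f \<longrightarrow> v f = 0)}"

definition differential ::
    "('a, 'e::euclidean_space) manifold \<Rightarrow> ('a \<Rightarrow> 'b) \<Rightarrow> 'b \<Rightarrow> ('b, 'f::euclidean_space) manifold \<Rightarrow>
      'a tvec \<Rightarrow> 'b tvec"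
  \<comment> \<open>\<open>differential M F q N\<close> maps the tangent space of \<open>M\<close> at any \<open>p\<close> with \<open>F p = q\<close>
      to the tangent space of \<open>N\<close> at \<open>q\<close>.\<close>
  where "differential M F q N v = (\<lambda>f. if smooth_at N q f then v (f \<circ> F) else 0)"

definition vector_fields :: "('a, 'e::euclidean_space) manifold \<Rightarrow> 'a vfield set"
  where "vector_fields M = {X.
    (\<forall>p\<in>topspace (mtop M). X p \<in> tangent_space M p) \<and>
    (\<forall>p. p \<notin> topspace (mtop M) \<longrightarrow> X p = 0) \<and>
    (\<forall>W f. openin (mtop M) W \<longrightarrow> smooth_fun M W f \<longrightarrow> smooth_fun M W (\<lambda>p. X p f))}"

definition lie_bracket :: "('a, 'e::euclidean_space) manifold \<Rightarrow> 'a vfield \<Rightarrow> 'a vfield \<Rightarrow> 'a vfield"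
  where "lie_bracket M X Y = (\<lambda>p f. if smooth_at M p f
    then X p (\<lambda>q. Y q f) - Y p (\<lambda>q. X q f) else 0)"

definition vf_mult :: "('a \<Rightarrow> real) \<Rightarrow> 'a vfield \<Rightarrow> 'a vfield"
  where "vf_mult f X = (\<lambda>p. f p *\<^sub>R X p)"


section \<open>Semi-Riemannian metrics and the Levi-Civita connection\<close>

type_synonym 'a metric_tensor = "'a \<Rightarrow> 'a tvec \<Rightarrow> 'a tvec \<Rightarrow> real"
type_synonym 'a connection = "'a vfield \<Rightarrow> 'a vfield \<Rightarrow> 'a vfield"

definition metric_on :: "'a metric_tensor \<Rightarrow> 'a vfield \<Rightarrow> 'a vfield \<Rightarrow> 'a \<Rightarrow> real"
  where "metric_on g X Y = (\<lambda>p. g p (X p) (Y p))"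

text \<open>
  Constancy of the index is not listed: it is automatic on connected manifolds and for
  left-invariant metrics on Lie groups.
\<close>

definition semi_riemannian_metric :: "('a, 'e::euclidean_space) manifold \<Rightarrow> 'a metric_tensor \<Rightarrow> bool"
  where "semi_riemannian_metric M g \<longleftrightarrow>
    (\<forall>p\<in>topspace (mtop M).
       (\<forall>u\<in>tangent_space M p. \<forall>v\<in>tangent_space M p. \<forall>w\<in>tangent_space M p. \<forall>a b.
          g p (a *\<^sub>R u + b *\<^sub>R v) w = a * g p u w + b * g p v w) \<and>
       (\<forall>v\<in>tangent_space M p. \<forall>w\<in>tangent_space M p. g p v w = g p w v) \<and>
       (\<forall>v\<in>tangent_space M p. (\<forall>w\<in>tangent_space M p. g p v w = 0) \<longrightarrow> v = 0)) \<and>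
    (\<forall>X\<in>vector_fields M. \<forall>Y\<in>vector_fields M. smooth_fun M (topspace (mtop M)) (metric_on g X Y))"

definition levi_civita ::
    "('a, 'e::euclidean_space) manifold \<Rightarrow> 'a metric_tensor \<Rightarrow> 'a connection \<Rightarrow> bool"
  where "levi_civita M g nabla \<longleftrightarrow>
    (\<forall>X\<in>vector_fields M. \<forall>Y\<in>vector_fields M. nabla X Y \<in> vector_fields M) \<and>
    (\<forall>X\<in>vector_fields M. \<forall>Y\<in>vector_fields M. \<forall>Z\<in>vector_fields M.
       nabla (X + Y) Z = nabla X Z + nabla Y Z \<and>
       nabla X (Y + Z) = nabla X Y + nabla X Z) \<and>
    (\<forall>X\<in>vector_fields M. \<forall>Y\<in>vector_fields M. \<forall>f. smooth_fun M (topspace (mtop M)) f \<longrightarrow>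
       nabla (vf_mult f X) Y = vf_mult f (nabla X Y) \<and>
       nabla X (vf_mult f Y) = vf_mult (\<lambda>p. X p f) Y + vf_mult f (nabla X Y)) \<and>
    (\<forall>X\<in>vector_fields M. \<forall>Y\<in>vector_fields M. nabla X Y - nabla Y X = lie_bracket M X Y) \<and>
    (\<forall>X\<in>vector_fields M. \<forall>Y\<in>vector_fields M. \<forall>Z\<in>vector_fields M. \<forall>p\<in>topspace (mtop M).
       X p (metric_on g Y Z) = metric_on g (nabla X Y) Z p + metric_on g Y (nabla X Z) p)"


section \<open>Distributions and foliations\<close>

text \<open>
  A foliation is represented by its tangent distribution \<open>D\<close>.
\<close>

definition sections :: "('a, 'e::euclidean_space) manifold \<Rightarrow> ('a \<Rightarrow> 'a tvec set) \<Rightarrow> 'a vfield set"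
  where "sections M D = {X\<in>vector_fields M. \<forall>p\<in>topspace (mtop M). X p \<in> D p}"

definition orth ::
    "('a, 'e::euclidean_space) manifold \<Rightarrow> 'a metric_tensor \<Rightarrow> ('a \<Rightarrow> 'a tvec set) \<Rightarrow> 'a \<Rightarrow> 'a tvec set"
  where "orth M g D p = {w\<in>tangent_space M p. \<forall>v\<in>D p. g p v w = 0}"

definition vert ::
    "('a, 'e::euclidean_space) manifold \<Rightarrow> 'a metric_tensor \<Rightarrow> ('a \<Rightarrow> 'a tvec set) \<Rightarrow> 'a vfield \<Rightarrow> 'a vfield"
  \<comment> \<open>Orthogonal projection onto \<open>D\<close>; well defined if \<open>g\<close> is non-degenerate on \<open>D\<close>.\<close>
  where "vert M g D X = (\<lambda>p. THE v. v \<in> D p \<and> X p - v \<in> orth M g D p)"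

definition hor ::
    "('a, 'e::euclidean_space) manifold \<Rightarrow> 'a metric_tensor \<Rightarrow> ('a \<Rightarrow> 'a tvec set) \<Rightarrow> 'a vfield \<Rightarrow> 'a vfield"
  where "hor M g D X = X - vert M g D X"

definition second_form_V ::
    "('a, 'e::euclidean_space) manifold \<Rightarrow> 'a metric_tensor \<Rightarrow> 'a connection \<Rightarrow> ('a \<Rightarrow> 'a tvec set) \<Rightarrow>
      'a vfield \<Rightarrow> 'a vfield \<Rightarrow> 'a vfield"
  where "second_form_V M g nabla D V W = (1/2) *\<^sub>R hor M g D (nabla V W + nabla W V)"

definition second_form_H ::
    "('a, 'e::euclidean_space) manifold \<Rightarrow> 'a metric_tensor \<Rightarrow> 'a connection \<Rightarrow> ('a \<Rightarrow> 'a tvec set) \<Rightarrow>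
      'a vfield \<Rightarrow> 'a vfield \<Rightarrow> 'a vfield"
  where "second_form_H M g nabla D X Y = (1/2) *\<^sub>R vert M g D (nabla X Y + nabla Y X)"

definition conformal_foliation ::
    "('a, 'e::euclidean_space) manifold \<Rightarrow> 'a metric_tensor \<Rightarrow> 'a connection \<Rightarrow> ('a \<Rightarrow> 'a tvec set) \<Rightarrow> bool"
  where "conformal_foliation M g nabla D \<longleftrightarrow>
    (\<exists>V\<in>sections M D. \<forall>X\<in>sections M (orth M g D). \<forall>Y\<in>sections M (orth M g D).
       \<forall>p\<in>topspace (mtop M). second_form_H M g nabla D X Y p = metric_on g X Y p *\<^sub>R V p)"

text \<open>
  Vector fields are global here, so a local frame is given by global sections of \<open>D\<close> that form a
  frame over the open set \<open>U\<close>. Every local frame agrees with such a one near any given point.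
\<close>

definition orthonormal_frame_on ::
    "('a, 'e::euclidean_space) manifold \<Rightarrow> 'a metric_tensor \<Rightarrow> ('a \<Rightarrow> 'a tvec set) \<Rightarrow> 'a set \<Rightarrow>
      nat \<Rightarrow> (nat \<Rightarrow> real) \<Rightarrow> (nat \<Rightarrow> 'a vfield) \<Rightarrow> bool"
  where "orthonormal_frame_on M g D U m \<epsilon> V \<longleftrightarrow> openin (mtop M) U \<and>
    (\<forall>i<m. \<epsilon> i \<in> {-1, 1}) \<and> (\<forall>i<m. V i \<in> sections M D) \<and>
    (\<forall>p\<in>U. span ((\<lambda>i. V i p) ` {..<m}) = D p \<and>
       (\<forall>i<m. \<forall>j<m. metric_on g (V i) (V j) p = (if i = j then \<epsilon> i else 0)))"

definition minimal_foliation ::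
    "('a, 'e::euclidean_space) manifold \<Rightarrow> 'a metric_tensor \<Rightarrow> 'a connection \<Rightarrow> ('a \<Rightarrow> 'a tvec set) \<Rightarrow> bool"
  where "minimal_foliation M g nabla D \<longleftrightarrow>
    (\<forall>U m \<epsilon> V. orthonormal_frame_on M g D U m \<epsilon> V \<longrightarrow>
       (\<forall>p\<in>U. (\<Sum>i<m. \<epsilon> i *\<^sub>R second_form_V M g nabla D (V i) (V i) p) = 0))"


section \<open>Semisimple Lie algebras\<close>

text \<open>
  A Lie algebra is given by its underlying subspace \<open>L\<close> and its bracket \<open>br\<close>. It is semisimple if
  it has no non-zero solvable ideal; the zero Lie algebra is included.
\<close>

definition lie_ideal :: "('v \<Rightarrow> 'v \<Rightarrow> 'v) \<Rightarrow> 'v::real_vector set \<Rightarrow> 'v set \<Rightarrow> bool"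
  where "lie_ideal br L I \<longleftrightarrow> subspace I \<and> I \<subseteq> L \<and> (\<forall>x\<in>L. \<forall>y\<in>I. br x y \<in> I)"

primrec derived_series :: "('v \<Rightarrow> 'v \<Rightarrow> 'v) \<Rightarrow> 'v::real_vector set \<Rightarrow> nat \<Rightarrow> 'v set"
  where
    "derived_series br I 0 = I"
  | "derived_series br I (Suc k) =
       span {br x y | x y. x \<in> derived_series br I k \<and> y \<in> derived_series br I k}"

definition solvable :: "('v \<Rightarrow> 'v \<Rightarrow> 'v) \<Rightarrow> 'v::real_vector set \<Rightarrow> bool"
  where "solvable br I \<longleftrightarrow> (\<exists>k. derived_series br I k = {0})"

definition semisimple :: "('v \<Rightarrow> 'v \<Rightarrow> 'v) \<Rightarrow> 'v::real_vector set \<Rightarrow> bool"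
  where "semisimple br L \<longleftrightarrow> (\<forall>I. lie_ideal br L I \<and> solvable br I \<longrightarrow> I = {0})"


section \<open>Lie groups\<close>

definition lie_group :: "('a, 'b) monoid_scheme \<Rightarrow> ('a, 'e::euclidean_space) manifold \<Rightarrow> bool"
  where "lie_group G M \<longleftrightarrow> group G \<and> smooth_manifold M \<and> topspace (mtop M) = carrier G \<and>
    smooth_map (prod_manifold M M) M (\<lambda>(x, y). x \<otimes>\<^bsub>G\<^esub> y) \<and>
    smooth_map M M (\<lambda>x. inv\<^bsub>G\<^esub> x)"

abbreviation left_translation ::
    "('a, 'b) monoid_scheme \<Rightarrow> ('a, 'e::euclidean_space) manifold \<Rightarrow> 'a \<Rightarrow> 'a \<Rightarrow> 'a tvec \<Rightarrow> 'a tvec"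
  \<comment> \<open>The differential at \<open>p\<close> of the left translation by \<open>a\<close>.\<close>
  where "left_translation G M a p \<equiv> differential M (\<lambda>x. a \<otimes>\<^bsub>G\<^esub> x) (a \<otimes>\<^bsub>G\<^esub> p) M"

definition lie_algebra :: "('a, 'b) monoid_scheme \<Rightarrow> ('a, 'e::euclidean_space) manifold \<Rightarrow> 'a vfield set"
  where "lie_algebra G M = {X\<in>vector_fields M.
    \<forall>a\<in>carrier G. \<forall>p\<in>carrier G. left_translation G M a p (X p) = X (a \<otimes>\<^bsub>G\<^esub> p)}"

definition semisimple_lie_group :: "('a, 'b) monoid_scheme \<Rightarrow> ('a, 'e::euclidean_space) manifold \<Rightarrow> bool"
  where "semisimple_lie_group G M \<longleftrightarrow> semisimple (lie_bracket M) (lie_algebra G M)"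

definition left_invariant_metric ::
    "('a, 'b) monoid_scheme \<Rightarrow> ('a, 'e::euclidean_space) manifold \<Rightarrow> 'a metric_tensor \<Rightarrow> bool"
  where "left_invariant_metric G M g \<longleftrightarrow> semi_riemannian_metric M g \<and>
    (\<forall>a\<in>carrier G. \<forall>p\<in>carrier G. \<forall>v\<in>tangent_space M p. \<forall>w\<in>tangent_space M p.
       g (a \<otimes>\<^bsub>G\<^esub> p) (left_translation G M a p v) (left_translation G M a p w) = g p v w)"

text \<open>
  A Lie subgroup is a subgroup \<open>K\<close> with a Lie group structure \<open>N\<close> of its own, such that the
  inclusion is an immersion. It need be neither closed nor carry the subspace topology.
\<close>

definition lie_subgroup ::
    "'a set \<Rightarrow> ('a, 'f::euclidean_space) manifold \<Rightarrow> ('a, 'b) monoid_scheme \<Rightarrow>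
      ('a, 'e::euclidean_space) manifold \<Rightarrow> bool"
  where "lie_subgroup K N G M \<longleftrightarrow> subgroup K G \<and> lie_group (G\<lparr>carrier := K\<rparr>) N \<and>
    smooth_map N M (\<lambda>x. x) \<and>
    (\<forall>p\<in>K. inj_on (differential N (\<lambda>x. x) p M) (tangent_space N p))"

text \<open>
  The Lie algebra of \<open>K\<close> regarded as a subalgebra of that of \<open>G\<close>, via the differential of the
  inclusion at the identity.
\<close>

definition lie_subalgebra ::
    "'a set \<Rightarrow> ('a, 'f::euclidean_space) manifold \<Rightarrow> ('a, 'b) monoid_scheme \<Rightarrow>
      ('a, 'e::euclidean_space) manifold \<Rightarrow> 'a vfield set"
  where "lie_subalgebra K N G M = {X\<in>lie_algebra G M. \<exists>Y\<in>lie_algebra (G\<lparr>carrier := K\<rparr>) N.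
    X \<one>\<^bsub>G\<^esub> = differential N (\<lambda>x. x) \<one>\<^bsub>G\<^esub> M (Y \<one>\<^bsub>G\<^esub>)}"

definition nondegenerate_on_subalgebra ::
    "('a, 'b) monoid_scheme \<Rightarrow> 'a metric_tensor \<Rightarrow> 'a vfield set \<Rightarrow> bool"
  where "nondegenerate_on_subalgebra G g L \<longleftrightarrow>
    (\<forall>X\<in>L. (\<forall>Y\<in>L. g \<one>\<^bsub>G\<^esub> (X \<one>\<^bsub>G\<^esub>) (Y \<one>\<^bsub>G\<^esub>) = 0) \<longrightarrow> X = 0)"

definition generated_foliation ::
    "'a set \<Rightarrow> ('a, 'f::euclidean_space) manifold \<Rightarrow> ('a, 'b) monoid_scheme \<Rightarrow>
      ('a, 'e::euclidean_space) manifold \<Rightarrow> 'a \<Rightarrow> 'a tvec set"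
  where "generated_foliation K N G M p =
    (\<lambda>X. left_translation G M p \<one>\<^bsub>G\<^esub> (X \<one>\<^bsub>G\<^esub>)) ` lie_subalgebra K N G M"

end

theory Submission
  imports Defs "Jordan_Normal_Form.Jordan_Normal_Form_Existence"
begin

text \<open>
  For \<open>Z\<close> in \<open>\<kk>\<close> let \<open>\<rho> Z\<close> be the horizontal part of \<open>ad Z\<close> on the orthogonal complement \<open>\<mm>\<close> of
  \<open>\<kk>\<close>. By the Koszul formula, conformality of the foliation says that \<open>\<rho> Z\<close> is skew up to a
  multiple of the identity, so \<open>\<rho>\<close> maps \<open>\<kk>\<close> into the conformal algebra of the plane \<open>\<mm>\<close>, which is
  abelian. As \<open>\<kk>\<close> is perfect, \<open>\<rho> = 0\<close>, that is, \<open>[\<kk>, \<mm>] \<subseteq> \<kk>\<close>. Hence \<open>ad X\<close> is a derivation of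
  \<open>\<kk>\<close> for every \<open>X\<close> in \<open>\<mm>\<close>; derivations of a semisimple Lie algebra are inner and have trace \<open>0\<close>,
  and by the Koszul formula again this trace is \<open>g (trace B\<^sup>\<V>) X\<close>.

  Both facts on semisimple Lie algebras rest on the non-degeneracy of the Killing form, that is, on
  the solvability of its radical (Cartan's criterion).
\<close>

section \<open>Derivations over the complex numbers\<close>

text \<open>Cartan's criterion is usually proved with rational-linear functionals on the eigenvalues
  and polynomials in \<open>ad x\<close>. Here complex conjugation takes over: replacing each
  eigenvalue of \<open>ad x\<close> by its conjugate gives an operator D that is again a derivation,
  and tr (ad x D) is the sum of the squared moduli. For x in the span of the brackets [a, b] with a
  in the Killing radical this trace reduces to values of the Killing form on the radical, so it is 0
  and x is ad-nilpotent; Engel's theorem then applies. Eigenvalues ask for complex scalars while the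
  Lie algebras are real spaces of vector fields, so complexification takes place in coordinates
  only, through structure constants. On the geometric side the codimension is a statement about
  model spaces, whereas tangent vectors are abstract derivations; Hadamard's lemma links the two.
  The frame in the definition of minimality is arbitrary, so at each point it is compared with
  left-invariant fields that have the same values there.\<close>

lemma jordan_matrix_offdiag:
  assumes "i < sum_list (map fst n_as)" "j < sum_list (map fst n_as)" "i \<noteq> j"
    and "jordan_matrix n_as $$ (i, j) \<noteq> (0::'a::{zero,one})"
  shows "j = Suc i \<and> jordan_matrix n_as $$ (i, i) = jordan_matrix n_as $$ (j, j)"
  using assms
proof (induction n_as arbitrary: i j)
  case (Cons na n_as)
  obtain m a where na: "na = (m, a)" by (cases na)
  have d: "dim_row (diag_block_mat (map (\<lambda>(n, a). jordan_block n a) n_as)) = sum_list (map fst n_as)"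
     "dim_col (diag_block_mat (map (\<lambda>(n, a). jordan_block n a) n_as)) = sum_list (map fst n_as)"
    using jordan_matrix_dim[of n_as] by (auto simp: jordan_matrix_def)
  show ?case
  \<comment> \<open>If an index lies in the first block, of size m, the entry belongs to that block
    or is 0; otherwise both indices shift down by m.\<close>
  proof (cases "i < m \<or> j < m")
    case True
    then show ?thesis using Cons.prems d
      by (auto simp: jordan_matrix_def na Let_def split: if_splits)
  next
    case False
    then have "j - m = Suc (i - m) \<and> jordan_matrix n_as $$ (i - m, i - m) = jordan_matrix n_as $$ (j - m, j - m)"
      using Cons.prems d by (intro Cons.IH) (auto simp: jordan_matrix_def na Let_def split: if_splits)
    then show ?thesis using Cons.prems d False
      by (auto simp: jordan_matrix_def na Let_def split: if_splits)
  qed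
qed simp

text \<open>Jordan normal form read as a pair of dual bases: the columns of P form Jordan chains of
  \<open>a\<close>, the rows of Q = P^-1 the dual chains. The superdiagonal entries are called
  \<open>s\<close> when indexed by column and \<open>t\<close> when indexed by row. Both are 0 where
  the neighbouring index is missing, so the equations hold for every index without case
  distinction.\<close>

lemma jordan_basis:
  fixes a :: "nat \<Rightarrow> nat \<Rightarrow> complex"
  obtains P Q :: "nat \<Rightarrow> nat \<Rightarrow> complex" and l s t :: "nat \<Rightarrow> complex"
  where "\<And>i j. i < n \<Longrightarrow> j < n \<Longrightarrow> (\<Sum>k<n. P i k * Q k j) = (if i = j then 1 else 0)"
    and "\<And>i j. i < n \<Longrightarrow> j < n \<Longrightarrow> (\<Sum>k<n. Q i k * P k j) = (if i = j then 1 else 0)"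
    and "\<And>j k. j < n \<Longrightarrow> k < n \<Longrightarrow> (\<Sum>m<n. a k m * P m j) = l j * P k j + s j * P k (j - 1)"
    and "\<And>j. j < n \<Longrightarrow> s j \<noteq> 0 \<Longrightarrow> 0 < j \<and> l (j - 1) = l j"
    and "\<And>r m. r < n \<Longrightarrow> m < n \<Longrightarrow> (\<Sum>k<n. Q r k * a k m) = l r * Q r m + t r * Q (Suc r) m"
    and "\<And>r. r < n \<Longrightarrow> t r \<noteq> 0 \<Longrightarrow> Suc r < n \<and> l (Suc r) = l r"
proof -
  define A where "A = mat n n (\<lambda>(i, j). a i j)"
  have A: "A \<in> carrier_mat n n" by (simp add: A_def)
  obtain as where "char_poly A = (\<Prod>a\<leftarrow>as. [:- a, 1:])"
    using char_poly_factorized[OF A] by auto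
  then obtain n_as where "jordan_nf A n_as" using jordan_nf_exists[OF A] by blast
  then obtain P' Q' where w: "similar_mat_wit A (jordan_matrix n_as) P' Q'"
    by (auto simp: jordan_nf_def similar_mat_def)
  define J where "J = jordan_matrix n_as"
  from w A have P: "P' \<in> carrier_mat n n" and Q: "Q' \<in> carrier_mat n n" and J: "J \<in> carrier_mat n n"
    and PQ: "P' * Q' = 1\<^sub>m n" and QP: "Q' * P' = 1\<^sub>m n" and APJQ: "A = P' * J * Q'"
    by (auto simp: similar_mat_wit_def Let_def J_def)
  have sz: "sum_list (map fst n_as) = n" using J jordan_matrix_dim[of n_as] by (auto simp: J_def)
  have off: "j = Suc i \<and> J $$ (i, i) = J $$ (j, j)" if "i < n" "j < n" "i \<noteq> j" "J $$ (i,j) \<noteq> 0" for i j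
    using jordan_matrix_offdiag[of i n_as j] that sz by (simp add: J_def)
  have AP: "A * P' = P' * J"
    using P Q J PQ QP by (simp add: APJQ) (metis assoc_mult_mat mult_carrier_mat right_mult_one_mat)
  have QA: "Q' * A = J * Q'"
    using P Q J PQ QP A by (simp add: APJQ) (metis assoc_mult_mat mult_carrier_mat left_mult_one_mat)
  define l where "l = (\<lambda>i. J $$ (i, i))"
  define s where "s = (\<lambda>j. if 0 < j then J $$ (j - 1, j) else 0)"
  define t where "t = (\<lambda>r. if Suc r < n then J $$ (r, Suc r) else 0)"
  have mm: "(X * Y) $$ (i, j) = (\<Sum>k<n. X $$ (i,k) * Y $$ (k,j))"
    if "X \<in> carrier_mat n n" "Y \<in> carrier_mat n n" "i < n" "j < n" for X Y :: "complex mat" and i j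
    using that by (auto simp: scalar_prod_def lessThan_atLeast0 intro!: sum.cong)
  have col: "(\<Sum>m<n. f m * J $$ (m, j)) = l j * f j + s j * f (j - 1)" if j: "j < n" for f j
  proof -
    have "(\<Sum>m<n. f m * J $$ (m, j)) = (\<Sum>m\<in>{j, j - 1}. f m * J $$ (m, j))"
      by (rule sum.mono_neutral_right) (use j off in force)+
    also have "\<dots> = l j * f j + s j * f (j - 1)"
      using j by (cases j) (auto simp: l_def s_def mult.commute)
    finally show ?thesis .
  qed
  have row: "(\<Sum>m<n. J $$ (r, m) * f m) = l r * f r + t r * f (Suc r)" if r: "r < n" for f r
  proof -
    have "(\<Sum>m<n. J $$ (r, m) * f m) = (\<Sum>m\<in>{r, Suc r} \<inter> {..<n}. J $$ (r, m) * f m)"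
      by (rule sum.mono_neutral_right) (use r off in force)+
    also have "\<dots> = l r * f r + t r * f (Suc r)"
      using r by (cases "Suc r < n") (auto simp: l_def t_def)
    finally show ?thesis .
  qed
  show ?thesis
  proof (rule that[of "\<lambda>i j. P' $$ (i,j)" "\<lambda>i j. Q' $$ (i,j)" l s t])
    fix i j :: nat assume ij: "i < n" "j < n"
    show "(\<Sum>k<n. P' $$ (i, k) * Q' $$ (k, j)) = (if i = j then 1 else 0)"
      using mm[OF P Q ij] ij PQ by auto
    show "(\<Sum>k<n. Q' $$ (i, k) * P' $$ (k, j)) = (if i = j then 1 else 0)"
      using mm[OF Q P ij] ij QP by auto
    show "(\<Sum>m<n. a j m * P' $$ (m, i)) = l i * P' $$ (j, i) + s i * P' $$ (j, i - 1)"
      using mm[OF A P ij(2,1)] mm[OF P J ij(2,1)] AP col[OF ij(1), of "\<lambda>m. P' $$ (j, m)"] ij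
      by (simp add: A_def)
    show "(\<Sum>k<n. Q' $$ (i, k) * a k j) = l i * Q' $$ (i, j) + t i * Q' $$ (Suc i, j)"
      using mm[OF Q A ij] mm[OF J Q ij] QA row[OF ij(1), of "\<lambda>m. Q' $$ (m, j)"] ij
      by (simp add: A_def)
  next
    fix j assume j: "j < n" "s j \<noteq> 0"
    then show "0 < j \<and> l (j - 1) = l j"
      using off[of "j - 1" j] by (auto simp: s_def l_def split: if_splits)
  next
    fix j assume j: "j < n" "t j \<noteq> 0"
    then show "Suc j < n \<and> l (Suc j) = l j"
      using off[of j "Suc j"] by (auto simp: t_def l_def split: if_splits)
  qed
qed

section \<open>Matrices and bilinear products in coordinates\<close>

definition mat_apply :: "nat \<Rightarrow> (nat \<Rightarrow> nat \<Rightarrow> complex) \<Rightarrow> (nat \<Rightarrow> complex) \<Rightarrow> nat \<Rightarrow> complex"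
  where "mat_apply n A u i = (\<Sum>j<n. A i j * u j)"

definition bilin :: "nat \<Rightarrow> (nat \<Rightarrow> nat \<Rightarrow> nat \<Rightarrow> complex) \<Rightarrow> (nat \<Rightarrow> complex) \<Rightarrow> (nat \<Rightarrow> complex) \<Rightarrow> nat \<Rightarrow> complex"
  where "bilin n c u w k = (\<Sum>i<n. \<Sum>j<n. u i * w j * c i j k)"

text \<open>The Leibniz rule A[u, w] = [A u, w] + [u, A w] on basis vectors, for the product in
  which \<open>c i j k\<close> is the k-th coordinate of the product of the i-th and j-th basis
  vectors.\<close>

definition derivation_mat :: "nat \<Rightarrow> (nat \<Rightarrow> nat \<Rightarrow> nat \<Rightarrow> complex) \<Rightarrow> (nat \<Rightarrow> nat \<Rightarrow> complex) \<Rightarrow> bool"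
  where "derivation_mat n c A \<longleftrightarrow> (\<forall>i<n. \<forall>j<n. \<forall>k<n.
    (\<Sum>r<n. A k r * c i j r) = (\<Sum>r<n. A r i * c r j k) + (\<Sum>r<n. A r j * c i r k))"

lemma mat_apply_cong: "(\<And>j. j < n \<Longrightarrow> u j = v j) \<Longrightarrow> mat_apply n A u i = mat_apply n A v i"
  by (simp add: mat_apply_def)

lemma bilin_cong:
  "(\<And>j. j < n \<Longrightarrow> u j = u' j) \<Longrightarrow> (\<And>j. j < n \<Longrightarrow> v j = v' j) \<Longrightarrow> bilin n c u v k = bilin n c u' v' k"
  by (simp add: bilin_def)

lemma mat_apply_lin: "mat_apply n A (\<lambda>i. x * u i + y * v i) k = x * mat_apply n A u k + y * mat_apply n A v k"
  by (simp add: mat_apply_def sum_distrib_left sum.distrib algebra_simps)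

lemma bilin_lin1: "bilin n c (\<lambda>i. x * u i + y * v i) w k = x * bilin n c u w k + y * bilin n c v w k"
  by (simp add: bilin_def sum_distrib_left sum.distrib algebra_simps)

lemma bilin_lin2: "bilin n c w (\<lambda>i. x * u i + y * v i) k = x * bilin n c w u k + y * bilin n c w v k"
  by (simp add: bilin_def sum_distrib_left sum.distrib algebra_simps)

lemma derivation_mat_bilin:
  assumes "derivation_mat n c A" "k < n"
  shows "mat_apply n A (bilin n c u w) k = bilin n c (mat_apply n A u) w k + bilin n c u (mat_apply n A w) k"
proof -
  have "mat_apply n A (bilin n c u w) k = (\<Sum>r<n. \<Sum>i<n. \<Sum>j<n. u i * w j * (A k r * c i j r))"
    by (simp add: mat_apply_def bilin_def sum_distrib_left algebra_simps)
  also have "\<dots> = (\<Sum>i<n. \<Sum>j<n. \<Sum>r<n. u i * w j * (A k r * c i j r))"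
    by (subst sum.swap, rule sum.cong[OF refl], rule sum.swap)
  also have "\<dots> = (\<Sum>i<n. \<Sum>j<n. u i * w j * ((\<Sum>r<n. A r i * c r j k) + (\<Sum>r<n. A r j * c i r k)))"
    using assms by (intro sum.cong refl) (simp add: derivation_mat_def flip: sum_distrib_left)
  also have "\<dots> = (\<Sum>i<n. \<Sum>j<n. \<Sum>r<n. u i * w j * (A r i * c r j k)) + (\<Sum>i<n. \<Sum>j<n. \<Sum>r<n. u i * w j * (A r j * c i r k))"
    by (simp add: sum_distrib_left algebra_simps sum.distrib)
  also have "(\<Sum>i<n. \<Sum>j<n. \<Sum>r<n. u i * w j * (A r i * c r j k)) = bilin n c (mat_apply n A u) w k"
  proof -
    have "(\<Sum>i<n. \<Sum>j<n. \<Sum>r<n. u i * w j * (A r i * c r j k)) = (\<Sum>i<n. \<Sum>r<n. \<Sum>j<n. u i * w j * (A r i * c r j k))"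
      by (rule sum.cong[OF refl], rule sum.swap)
    also have "\<dots> = (\<Sum>r<n. \<Sum>j<n. \<Sum>i<n. u i * w j * (A r i * c r j k))"
      by (subst sum.swap, rule sum.cong[OF refl], rule sum.swap)
    finally show ?thesis
      by (simp add: mat_apply_def bilin_def sum_distrib_left sum_distrib_right algebra_simps)
  qed
  also have "(\<Sum>i<n. \<Sum>j<n. \<Sum>r<n. u i * w j * (A r j * c i r k)) = bilin n c u (mat_apply n A w) k"
  proof -
    have "(\<Sum>i<n. \<Sum>j<n. \<Sum>r<n. u i * w j * (A r j * c i r k)) = (\<Sum>i<n. \<Sum>r<n. \<Sum>j<n. u i * w j * (A r j * c i r k))"
      by (rule sum.cong[OF refl], rule sum.swap)
    then show ?thesis
      by (simp add: mat_apply_def bilin_def sum_distrib_left sum_distrib_right algebra_simps)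
  qed
  finally show ?thesis .
qed

lemma mat_apply_delta: "i < n \<Longrightarrow> mat_apply n A (\<lambda>j. if j = i then 1 else 0) k = A k i"
  by (simp add: mat_apply_def if_distrib cong: if_cong)

lemma bilin_delta1:
  assumes "i < n"
  shows "bilin n c (\<lambda>r. if r = i then 1 else 0) w k = (\<Sum>r<n. w r * c i r k)"
proof -
  have "bilin n c (\<lambda>r. if r = i then 1 else 0) w k = (\<Sum>r<n. if r = i then \<Sum>j<n. w j * c i j k else 0)"
    unfolding bilin_def by (intro sum.cong refl) auto
  then show ?thesis using assms by simp
qed

lemma bilin_delta2:
  assumes "j < n"
  shows "bilin n c w (\<lambda>r. if r = j then 1 else 0) k = (\<Sum>r<n. w r * c r j k)"
proof -
  have "(\<Sum>m<n. w r * (if m = j then 1 else 0) * c r m k) = w r * c r j k" for r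
  proof -
    have "(\<Sum>m<n. w r * (if m = j then 1 else 0) * c r m k) = (\<Sum>m<n. if m = j then w r * c r j k else 0)"
      by (intro sum.cong refl) auto
    then show ?thesis using assms by simp
  qed
  then show ?thesis by (simp add: bilin_def)
qed

lemma derivation_matI:
  assumes "\<And>u w k. k < n \<Longrightarrow> mat_apply n A (bilin n c u w) k = bilin n c (mat_apply n A u) w k + bilin n c u (mat_apply n A w) k"
  shows "derivation_mat n c A"
  unfolding derivation_mat_def
proof safe
  fix i j k assume ijk: "i < n" "j < n" "k < n"
  let ?d = "\<lambda>i r. if r = i then (1::complex) else 0"
  have *: "mat_apply n A (bilin n c (?d i) (?d j)) k = bilin n c (mat_apply n A (?d i)) (?d j) k + bilin n c (?d i) (mat_apply n A (?d j)) k"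
    using assms ijk by blast
  have "bilin n c (?d i) (?d j) = c i j"
    using ijk by (auto simp: bilin_delta1 if_distrib if_distribR cong: if_cong)
  moreover have "mat_apply n A (?d i) = (\<lambda>k. A k i)" "mat_apply n A (?d j) = (\<lambda>k. A k j)"
    using ijk by (auto simp: mat_apply_delta)
  ultimately show "(\<Sum>r<n. A k r * c i j r) = (\<Sum>r<n. A r i * c r j k) + (\<Sum>r<n. A r j * c i r k)"
    using * ijk by (simp only: bilin_delta1 bilin_delta2 mat_apply_def[of n A "c i j"])
qed


lemma mat_apply_sum:
  "mat_apply n A (\<lambda>k. \<Sum>j\<in>S. x j * v j k) i = (\<Sum>j\<in>S. x j * mat_apply n A (v j) i)"
  unfolding mat_apply_def sum_distrib_left by (subst sum.swap) (simp add: algebra_simps)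

lemma mat_apply_comp:
  "mat_apply n A (mat_apply n B u) i = (\<Sum>j<n. (\<Sum>k<n. A i k * B k j) * u j)"
  unfolding mat_apply_def sum_distrib_left sum_distrib_right by (subst sum.swap) (simp add: algebra_simps)

lemma mat_apply_inverse:
  assumes "\<And>i j. i < n \<Longrightarrow> j < n \<Longrightarrow> (\<Sum>k<n. P i k * Q k j) = (if i = j then 1 else 0)" "i < n"
  shows "mat_apply n P (mat_apply n Q u) i = u i"
  using assms by (simp add: mat_apply_comp mult_delta_left)

lemma mat_apply_pow_cong:
  "(\<And>j. j < n \<Longrightarrow> u j = v j) \<Longrightarrow> i < n \<Longrightarrow> (mat_apply n A ^^ m) u i = (mat_apply n A ^^ m) v i"
  by (induction m arbitrary: i) (auto intro: mat_apply_cong)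

lemma mat_apply_pow_sum:
  "(mat_apply n A ^^ m) (\<lambda>k. \<Sum>j\<in>S. x j * v j k) = (\<lambda>i. \<Sum>j\<in>S. x j * (mat_apply n A ^^ m) (v j) i)"
  by (induction m) (auto simp: mat_apply_sum)

lemma bilin_sum1:
  "bilin n c (\<lambda>k. \<Sum>j\<in>S. x j * v j k) w i = (\<Sum>j\<in>S. x j * bilin n c (v j) w i)"
proof (induction S rule: infinite_finite_induct)
  case (insert j S)
  then show ?case using bilin_lin1[of n c "x j" "v j" 1 "\<lambda>k. \<Sum>j\<in>S. x j * v j k" w i] by simp
qed (simp_all add: bilin_def)

lemma bilin_sum2:
  "bilin n c w (\<lambda>k. \<Sum>j\<in>S. x j * v j k) i = (\<Sum>j\<in>S. x j * bilin n c w (v j) i)"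
proof (induction S rule: infinite_finite_induct)
  case (insert j S)
  then show ?case using bilin_lin2[of n c w "x j" "v j" 1 "\<lambda>k. \<Sum>j\<in>S. x j * v j k" i] by simp
qed (simp_all add: bilin_def)

text \<open>
  If a derivation \<open>A\<close> acts on its generalised eigenspaces with eigenvalues \<open>l r\<close>, these spaces grade
  the algebra by the additive group of \<open>\<complex>\<close>; since conjugation is additive, multiplication by
  \<open>cnj (l r)\<close> on each of them is again a derivation.
\<close>

lemma conjugate_derivation:
  assumes der: "derivation_mat n c A"
  obtains D and l :: "nat \<Rightarrow> complex" where "derivation_mat n c D"
    and "(\<Sum>k<n. \<Sum>m<n. A k m * D m k) = of_real (\<Sum>r<n. (cmod (l r))\<^sup>2)"
    and "(\<forall>r<n. l r = 0) \<Longrightarrow> (\<forall>u. \<forall>k<n. (mat_apply n A ^^ n) u k = 0)"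
proof -
  obtain P Q :: "nat \<Rightarrow> nat \<Rightarrow> complex" and l s t where
    PQ: "\<And>i j. i < n \<Longrightarrow> j < n \<Longrightarrow> (\<Sum>k<n. P i k * Q k j) = (if i = j then 1 else 0)"
    and QP: "\<And>i j. i < n \<Longrightarrow> j < n \<Longrightarrow> (\<Sum>k<n. Q i k * P k j) = (if i = j then 1 else 0)"
    and AP: "\<And>j k. j < n \<Longrightarrow> k < n \<Longrightarrow> (\<Sum>m<n. A k m * P m j) = l j * P k j + s j * P k (j - 1)"
    and s: "\<And>j. j < n \<Longrightarrow> s j \<noteq> 0 \<Longrightarrow> 0 < j \<and> l (j - 1) = l j"
    and QA: "\<And>r m. r < n \<Longrightarrow> m < n \<Longrightarrow> (\<Sum>k<n. Q r k * A k m) = l r * Q r m + t r * Q (Suc r) m"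
    and t: "\<And>r. r < n \<Longrightarrow> t r \<noteq> 0 \<Longrightarrow> Suc r < n \<and> l (Suc r) = l r"
    by (rule jordan_basis[of n A]) blast
  define p where "p = (\<lambda>j k. P k j)"
  \<comment> \<open>\<open>g i j r\<close> is the r-th coordinate, in the Jordan basis, of the
    product of \<open>p i\<close> and \<open>p j\<close>.\<close>
  define g where "g = (\<lambda>i j. mat_apply n Q (bilin n c (p i) (p j)))"
  have Ap: "mat_apply n A (p j) k = l j * p j k + s j * p (j - 1) k" if "j < n" "k < n" for j k
    using AP[OF that] by (simp add: mat_apply_def p_def)
  have QAv: "mat_apply n Q (mat_apply n A v) r = l r * mat_apply n Q v r + t r * mat_apply n Q v (Suc r)"
    if "r < n" for v r
  proof -
    have "mat_apply n Q (mat_apply n A v) r = (\<Sum>j<n. (l r * Q r j + t r * Q (Suc r) j) * v j)"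
      using QA that by (simp add: mat_apply_comp)
    then show ?thesis by (simp add: mat_apply_def sum_distrib_left sum.distrib algebra_simps)
  qed
  \<comment> \<open>Products respect generalised eigenspaces. By induction on i + j the terms with
    \<open>i - 1\<close> and \<open>j - 1\<close> have no component at an index r with
    \<open>l r\<close> different from \<mu>. There the equation reduces to
    \<open>t r * g i j (Suc r) = (\<mu> - l r) * g i j r\<close>, so a bad index r is followed by
    the bad index r + 1, which is impossible for the largest one.\<close>
  have graded: "\<forall>r<n. g i j r \<noteq> 0 \<longrightarrow> l r = l i + l j" if "i < n" "j < n" for i j
    using that
  proof (induction "i + j" arbitrary: i j rule: less_induct)
    case (less i j)
    define \<mu> where "\<mu> = l i + l j"
    have Aw: "mat_apply n A (bilin n c (p i) (p j)) k = \<mu> * bilin n c (p i) (p j) k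
       + 1 * (s i * bilin n c (p (i - 1)) (p j) k + s j * bilin n c (p i) (p (j - 1)) k)" if "k < n" for k
    proof -
      have "bilin n c (mat_apply n A (p i)) (p j) k = bilin n c (\<lambda>k. l i * p i k + s i * p (i - 1) k) (p j) k"
        using less.prems Ap by (intro bilin_cong) auto
      moreover have "bilin n c (p i) (mat_apply n A (p j)) k = bilin n c (p i) (\<lambda>k. l j * p j k + s j * p (j - 1) k) k"
        using less.prems Ap by (intro bilin_cong) auto
      ultimately show ?thesis
        using derivation_mat_bilin[OF der that] by (simp add: bilin_lin1 bilin_lin2 \<mu>_def algebra_simps)
    qed
    have eq: "l r * g i j r + t r * g i j (Suc r) = \<mu> * g i j r + (s i * g (i - 1) j r + s j * g i (j - 1) r)"
      if "r < n" for r
    proof -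
      have "mat_apply n Q (mat_apply n A (bilin n c (p i) (p j))) r
        = mat_apply n Q (\<lambda>k. \<mu> * bilin n c (p i) (p j) k
       + 1 * (s i * bilin n c (p (i - 1)) (p j) k + s j * bilin n c (p i) (p (j - 1)) k)) r"
        using Aw by (rule mat_apply_cong)
      then show ?thesis unfolding QAv[OF that] mat_apply_lin g_def by simp
    qed
    have z: "s i * g (i - 1) j r = 0" "s j * g i (j - 1) r = 0" if "r < n" "l r \<noteq> \<mu>" for r
    proof -
      show "s i * g (i - 1) j r = 0"
      proof (rule ccontr)
        assume a: "s i * g (i - 1) j r \<noteq> 0"
        then have "0 < i" "l (i - 1) = l i" using s less.prems by auto
        then show False using less.hyps[of "i - 1" j] less.prems a that by (auto simp: \<mu>_def)
      qed
      show "s j * g i (j - 1) r = 0"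
      proof (rule ccontr)
        assume a: "s j * g i (j - 1) r \<noteq> 0"
        then have "0 < j" "l (j - 1) = l j" using s less.prems by auto
        then show False using less.hyps[of i "j - 1"] less.prems a that by (auto simp: \<mu>_def)
      qed
    qed
    define B where "B = {r. r < n \<and> l r \<noteq> \<mu> \<and> g i j r \<noteq> 0}"
    have "B = {}"
    proof (rule ccontr)
      assume ne: "B \<noteq> {}"
      have fin: "finite B" by (simp add: B_def)
      define r where "r = Max B"
      have r: "r \<in> B" using ne fin by (simp add: r_def)
      have r': "r < n" "l r \<noteq> \<mu>" using r by (auto simp: B_def)
      have "t r * g i j (Suc r) = (\<mu> - l r) * g i j r"
        using eq[OF r'(1)] unfolding z(1)[OF r'] z(2)[OF r'] by (simp add: algebra_simps)
      then have "t r \<noteq> 0" "g i j (Suc r) \<noteq> 0" using r by (auto simp: B_def)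
      then have "Suc r \<in> B" using t[of r] r by (auto simp: B_def)
      then show False using Max_ge[OF fin, of "Suc r"] by (simp add: r_def)
    qed
    then show ?case by (auto simp: B_def \<mu>_def)
  qed
  \<comment> \<open>Diagonal in the Jordan basis, with eigenvalues \<open>cnj (l r)\<close>; the
    nilpotent part of A is dropped.\<close>
  define D where "D = (\<lambda>k m. \<Sum>r<n. P k r * cnj (l r) * Q r m)"
  have Dv: "mat_apply n D u k = mat_apply n P (\<lambda>r. cnj (l r) * mat_apply n Q u r) k" for u k
    unfolding mat_apply_def D_def sum_distrib_left sum_distrib_right
    by (subst sum.swap) (simp add: algebra_simps)
  have Pp: "mat_apply n P u = (\<lambda>k. \<Sum>j<n. u j * p j k)" for u
    by (simp add: mat_apply_def p_def fun_eq_iff mult.commute)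
  have G: "mat_apply n Q (bilin n c (mat_apply n P u) (mat_apply n P w)) r = bilin n g u w r" for u w r
  proof -
    have "bilin n c (mat_apply n P u) (mat_apply n P w)
      = (\<lambda>k. \<Sum>i<n. u i * (\<lambda>k. \<Sum>j<n. w j * bilin n c (p i) (p j) k) k)"
      by (simp add: fun_eq_iff Pp bilin_sum1 bilin_sum2)
    then show ?thesis
      by (simp only: mat_apply_sum bilin_def[of n g]) (simp add: g_def sum_distrib_left mult.assoc)
  qed
  have cong2: "bilin n c u w = bilin n c (mat_apply n P (mat_apply n Q u)) (mat_apply n P (mat_apply n Q w))" for u w
    using mat_apply_inverse[OF PQ] by (intro ext bilin_cong) auto
  have derD: "derivation_mat n c D"
  proof (rule derivation_matI)
    fix u w k assume k: "k < n"
    let ?\<Delta> = "\<lambda>u r. cnj (l r) * mat_apply n Q u r"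
    have 1: "?\<Delta> (bilin n c u w) r = 1 * mat_apply n Q (bilin n c (mat_apply n D u) w) r + 1 * mat_apply n Q (bilin n c u (mat_apply n D w)) r"
      if r: "r < n" for r
    proof -
      \<comment> \<open>Additivity of conjugation enters here: a nonzero \<open>g i j r\<close>
        forces \<open>l r = l i + l j\<close>, hence the same relation for the conjugates.\<close>
      have gz: "cnj (l r) * (x * y * g i j r) = cnj (l i) * x * y * g i j r + x * (cnj (l j) * y) * g i j r"
        if "i < n" "j < n" for x y i j
        using graded[OF that] r by (cases "g i j r = 0") (auto simp: algebra_simps)
      have "?\<Delta> (bilin n c u w) r = cnj (l r) * bilin n g (mat_apply n Q u) (mat_apply n Q w) r"
        by (subst cong2) (simp add: G)
      also have "\<dots> = bilin n g (?\<Delta> u) (mat_apply n Q w) r + bilin n g (mat_apply n Q u) (?\<Delta> w) r"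
        unfolding bilin_def sum_distrib_left sum.distrib[symmetric]
        by (intro sum.cong refl) (use gz in simp)
      also have "bilin n g (?\<Delta> u) (mat_apply n Q w) r = mat_apply n Q (bilin n c (mat_apply n D u) w) r"
        unfolding G[symmetric] using mat_apply_inverse[OF PQ]
        by (intro mat_apply_cong bilin_cong) (auto simp: Dv)
      also have "bilin n g (mat_apply n Q u) (?\<Delta> w) r = mat_apply n Q (bilin n c u (mat_apply n D w)) r"
        unfolding G[symmetric] using mat_apply_inverse[OF PQ]
        by (intro mat_apply_cong bilin_cong) (auto simp: Dv)
      finally show ?thesis by simp
    qed
    have "mat_apply n D (bilin n c u w) k = mat_apply n P (\<lambda>r. 1 * mat_apply n Q (bilin n c (mat_apply n D u) w) r + 1 * mat_apply n Q (bilin n c u (mat_apply n D w)) r) k"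
      unfolding Dv[of "bilin n c u w"] using 1 by (rule mat_apply_cong)
    also have "\<dots> = bilin n c (mat_apply n D u) w k + bilin n c u (mat_apply n D w) k"
      unfolding mat_apply_lin using mat_apply_inverse[OF PQ k] by simp
    finally show "mat_apply n D (bilin n c u w) k = bilin n c (mat_apply n D u) w k + bilin n c u (mat_apply n D w) k" .
  qed
  \<comment> \<open>tr (A D) is the trace of Q A P times the diagonal matrix of the conjugates, so
    only the diagonal \<open>l r\<close> of the triangular matrix Q A P contributes.\<close>
  have tr: "(\<Sum>k<n. \<Sum>m<n. A k m * D m k) = of_real (\<Sum>r<n. (cmod (l r))\<^sup>2)"
  proof -
    have "(\<Sum>k<n. \<Sum>m<n. A k m * D m k) = (\<Sum>k<n. \<Sum>m<n. \<Sum>r<n. cnj (l r) * (Q r k * (A k m * P m r)))"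
      by (simp add: D_def sum_distrib_left algebra_simps)
    also have "\<dots> = (\<Sum>k<n. \<Sum>r<n. \<Sum>m<n. cnj (l r) * (Q r k * (A k m * P m r)))"
      by (rule sum.cong[OF refl], rule sum.swap)
    also have "\<dots> = (\<Sum>r<n. \<Sum>k<n. \<Sum>m<n. cnj (l r) * (Q r k * (A k m * P m r)))"
      by (rule sum.swap)
    also have "\<dots> = (\<Sum>r<n. cnj (l r) * (\<Sum>k<n. Q r k * (\<Sum>m<n. A k m * P m r)))"
      by (simp add: sum_distrib_left)
    also have "\<dots> = (\<Sum>r<n. cnj (l r) * (\<Sum>k<n. Q r k * (l r * P k r + s r * P k (r - 1))))"
      using AP by simp
    also have "\<dots> = (\<Sum>r<n. of_real ((cmod (l r))\<^sup>2))"
    proof (rule sum.cong[OF refl])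
      fix r assume "r \<in> {..<n}"
      then have r: "r < n" by simp
      have "(\<Sum>k<n. Q r k * (l r * P k r + s r * P k (r - 1))) = l r * (\<Sum>k<n. Q r k * P k r) + s r * (\<Sum>k<n. Q r k * P k (r - 1))"
        by (simp add: sum_distrib_left sum.distrib algebra_simps)
      also have "\<dots> = l r" using QP[OF r r] QP[OF r, of "r - 1"] s[OF r] r by (cases "s r = 0") auto
      finally show "cnj (l r) * (\<Sum>k<n. Q r k * (l r * P k r + s r * P k (r - 1))) = of_real ((cmod (l r))\<^sup>2)"
        by (simp only: mult.commute[of "cnj (l r)"] complex_norm_square)
    qed
    finally show ?thesis by simp
  qed
  have nil: "\<forall>u. \<forall>k<n. (mat_apply n A ^^ n) u k = 0" if l0: "\<forall>r<n. l r = 0"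
  proof (intro allI impI)
    have zero: "(mat_apply n A ^^ m) (\<lambda>_. 0) = (\<lambda>_. 0)" for m
      by (induction m) (auto simp: mat_apply_def)
    \<comment> \<open>Each step down the Jordan chain replaces \<open>p j\<close> by a multiple of
      \<open>p (j - 1)\<close>, and \<open>s 0 = 0\<close> ends it after j + 1 steps.\<close>
    have chain: "(mat_apply n A ^^ Suc j) (p j) k = 0" if "j < n" "k < n" for j k
      using that
    proof (induction j arbitrary: k rule: less_induct)
      case (less j)
      have "(mat_apply n A ^^ Suc j) (p j) k = (mat_apply n A ^^ j) (mat_apply n A (p j)) k"
        by (simp add: funpow_swap1)
      also have "\<dots> = (mat_apply n A ^^ j) (\<lambda>k. \<Sum>i\<in>{j - 1}. s j * p i k) k"
        using Ap l0 less.prems by (intro mat_apply_pow_cong) auto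
      also have "\<dots> = s j * (mat_apply n A ^^ j) (p (j - 1)) k"
        unfolding mat_apply_pow_sum by simp
      also have "\<dots> = 0"
        using less.IH[of "j - 1" k] less.prems s[of j] by (cases "s j = 0"; cases j) auto
      finally show ?case .
    qed
    fix u k assume k: "k < n"
    have "(mat_apply n A ^^ n) u k = (mat_apply n A ^^ n) (\<lambda>k. \<Sum>j<n. mat_apply n Q u j * p j k) k"
      using mat_apply_inverse[OF PQ, of _ u] k by (intro mat_apply_pow_cong) (auto simp: Pp)
    also have "\<dots> = (\<Sum>j<n. mat_apply n Q u j * (mat_apply n A ^^ n) (p j) k)"
      unfolding mat_apply_pow_sum ..
    also have "\<dots> = 0"
    proof (rule sum.neutral, rule ballI)
      fix j assume "j \<in> {..<n}"
      then have j: "j < n" by simp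
      have "(mat_apply n A ^^ n) (p j) k = (mat_apply n A ^^ (n - Suc j)) ((mat_apply n A ^^ Suc j) (p j)) k"
        using j by (metis Suc_leI comp_apply funpow_add le_add_diff_inverse2)
      also have "\<dots> = (mat_apply n A ^^ (n - Suc j)) (\<lambda>_. 0) k"
        using chain j k by (intro mat_apply_pow_cong) auto
      finally show "mat_apply n Q u j * (mat_apply n A ^^ n) (p j) k = 0" by (simp add: zero)
    qed
    finally show "(mat_apply n A ^^ n) u k = 0" .
  qed
  show ?thesis using that derD tr nil by blast
qed

hide_const (open) VectorSpace.subspace Matrix.orthogonal
no_notation scalar_prod (infix "\<bullet>" 70)


section \<open>Linear maps on a subspace, and traces\<close>

text \<open>The brackets and metrics below obey the laws of linearity only on a subspace; elsewhere
  their arguments need not be vector fields or tangent vectors. Hence linearity relative to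
  \<open>L\<close>.\<close>

definition linear_on :: "'v::real_vector set \<Rightarrow> ('v \<Rightarrow> 'w::real_vector) \<Rightarrow> bool"
  where "linear_on L T \<longleftrightarrow> (\<forall>x\<in>L. \<forall>y\<in>L. T (x + y) = T x + T y) \<and> (\<forall>x\<in>L. \<forall>c. T (c *\<^sub>R x) = c *\<^sub>R T x)"

lemma linear_onI:
  "(\<And>x y. x \<in> L \<Longrightarrow> y \<in> L \<Longrightarrow> T (x + y) = T x + T y) \<Longrightarrow>
   (\<And>x c. x \<in> L \<Longrightarrow> T (c *\<^sub>R x) = c *\<^sub>R T x) \<Longrightarrow> linear_on L T"
  by (simp add: linear_on_def)

lemma linear_onD:
  assumes "linear_on L T"
  shows "x \<in> L \<Longrightarrow> y \<in> L \<Longrightarrow> T (x + y) = T x + T y" "x \<in> L \<Longrightarrow> T (c *\<^sub>R x) = c *\<^sub>R T x"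
  using assms by (auto simp: linear_on_def)

lemma linear_on_sum:
  assumes T: "linear_on L T" and L: "subspace L" and v: "\<And>i. i \<in> S \<Longrightarrow> v i \<in> L"
  shows "T (\<Sum>i\<in>S. c i *\<^sub>R v i) = (\<Sum>i\<in>S. c i *\<^sub>R T (v i))"
  using v
proof (induction S rule: infinite_finite_induct)
  case (insert i S)
  then show ?case
    using linear_onD[OF T] subspace_sum[OF L, of S "\<lambda>i. c i *\<^sub>R v i"] L
    by (simp add: subspace_scale)
next
  case empty
  have "T (0 *\<^sub>R 0) = 0 *\<^sub>R T 0" using linear_onD(2)[OF T subspace_0[OF L], of 0] .
  then show ?case by simp
next
  case infinite
  have "T (0 *\<^sub>R 0) = 0 *\<^sub>R T 0" using linear_onD(2)[OF T subspace_0[OF L], of 0] .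
  then show ?case using infinite by simp
qed

lemma linear_on_comp:
  "linear_on L S \<Longrightarrow> linear_on L T \<Longrightarrow> T ` L \<subseteq> L \<Longrightarrow> linear_on L (\<lambda>x. S (T x))"
  by (auto simp: linear_on_def image_subset_iff)

text \<open>The basis is enumerated by numbers so that coordinates and operators match the index
  conventions of the matrix part.\<close>

locale fin_space =
  fixes L :: "'v::real_vector set" and e :: "nat \<Rightarrow> 'v" and n :: nat
  assumes inj_e: "inj_on e {..<n}"
    and indep: "independent (e ` {..<n})"
    and span_e: "span (e ` {..<n}) = L"
begin

definition coef :: "'v \<Rightarrow> nat \<Rightarrow> real" where "coef v i = representation (e ` {..<n}) v (e i)"

lemma subspace_space: "subspace L" using subspace_span[of "e ` {..<n}"] span_e by simp

lemma e_mem: "i < n \<Longrightarrow> e i \<in> L" using span_base[of "e i" "e ` {..<n}"] span_e by simp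

lemma coef_linear: "linear_on L (\<lambda>v. coef v i)"
  by (rule linear_onI) (simp_all add: coef_def representation_add representation_scale indep span_e)

lemma coef_e: "i < n \<Longrightarrow> j < n \<Longrightarrow> coef (e j) i = (if i = j then 1 else 0)"
  using inj_onD[OF inj_e, of i j] by (auto simp: coef_def representation_basis[OF indep])

lemma expand: "v \<in> L \<Longrightarrow> (\<Sum>i<n. coef v i *\<^sub>R e i) = v"
  using sum_representation_eq[OF indep, of v "e ` {..<n}"] span_e
  by (simp add: sum.reindex[OF inj_e] coef_def)

lemma coef_sum: "i < n \<Longrightarrow> coef (\<Sum>j<n. a j *\<^sub>R e j) i = a i"
  using linear_on_sum[OF coef_linear subspace_space, of "{..<n}" e a i] e_mem
  by (simp add: coef_e mult_delta_right if_distrib cong: if_cong)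

lemma linear_on_expand: "linear_on L T \<Longrightarrow> v \<in> L \<Longrightarrow> T v = (\<Sum>i<n. coef v i *\<^sub>R T (e i))"
  using linear_on_sum[of L T "{..<n}" e "coef v"] expand subspace_space e_mem by simp

text \<open>The trace in the basis \<open>e\<close> fixed by the locale. In the application
  \<open>e\<close> is orthonormal, and the i-th summand is then a sign times an inner
  product.\<close>

definition trace_on :: "('v \<Rightarrow> 'v) \<Rightarrow> real" where "trace_on T = (\<Sum>i<n. coef (T (e i)) i)"

lemma trace_on_cong: "(\<And>v. v \<in> L \<Longrightarrow> S v = T v) \<Longrightarrow> trace_on S = trace_on T"
  by (simp add: trace_on_def e_mem)

lemma trace_on_add:
  "S ` L \<subseteq> L \<Longrightarrow> T ` L \<subseteq> L \<Longrightarrow> trace_on (\<lambda>v. S v + T v) = trace_on S + trace_on T"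
  unfolding trace_on_def sum.distrib[symmetric]
  by (intro sum.cong refl linear_onD(1)[OF coef_linear]) (auto intro: e_mem)

lemma trace_on_scale: "T ` L \<subseteq> L \<Longrightarrow> trace_on (\<lambda>v. c *\<^sub>R T v) = c * trace_on T"
  unfolding trace_on_def sum_distrib_left
  by (intro sum.cong refl) (auto simp: image_subset_iff e_mem linear_onD(2)[OF coef_linear])

lemma trace_on_comp:
  assumes "linear_on L S" "S ` L \<subseteq> L" "T ` L \<subseteq> L"
  shows "trace_on (\<lambda>v. S (T v)) = (\<Sum>i<n. \<Sum>j<n. coef (S (e j)) i * coef (T (e i)) j)"
  unfolding trace_on_def
proof (rule sum.cong[OF refl])
  fix i assume i: "i \<in> {..<n}"
  then have "T (e i) \<in> L" using assms e_mem by auto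
  then show "coef (S (T (e i))) i = (\<Sum>j<n. coef (S (e j)) i * coef (T (e i)) j)"
    using linear_on_expand[OF linear_on_comp[OF coef_linear assms(1,2)]]
    by (simp add: mult.commute)
qed

lemma trace_on_commute:
  assumes "linear_on L S" "S ` L \<subseteq> L" "linear_on L T" "T ` L \<subseteq> L"
  shows "trace_on (\<lambda>v. S (T v)) = trace_on (\<lambda>v. T (S v))"
  unfolding trace_on_comp[OF assms(1,2,4)] trace_on_comp[OF assms(3,4,2)]
  by (subst sum.swap) (simp add: mult.commute)

lemma independent_bound: "independent B \<Longrightarrow> B \<subseteq> L \<Longrightarrow> finite B \<and> card B \<le> n"
  using independent_span_bound[of "e ` {..<n}" B] span_e card_image[OF inj_e] by simp

lemma independent_card_span:
  assumes "independent B" "B \<subseteq> L" "card B = n"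
  shows "span B = L"
proof
  show "span B \<subseteq> L" using assms subspace_space by (simp add: span_minimal)
  show "L \<subseteq> span B"
  proof (rule ccontr)
    assume "\<not> L \<subseteq> span B"
    then obtain v where v: "v \<in> L" "v \<notin> span B" by blast
    then have "independent (insert v B)" using assms(1) by (simp add: independent_insert)
    moreover have "v \<notin> B" using v span_base by blast
    ultimately show False using independent_bound[of "insert v B"] v assms by force
  qed
qed

end


section \<open>The Killing form of a semisimple Lie algebra\<close>

text \<open>The bracket is total on the type but a Lie bracket only on \<open>L\<close>. The Jacobi
  identity has the form of the Leibniz rule for \<open>br x\<close>, which is how it is
  applied.\<close>

locale lie_alg =
  fixes L :: "'v::real_vector set" and br :: "'v \<Rightarrow> 'v \<Rightarrow> 'v"
  assumes subspace_L: "subspace L"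
    and closed: "x \<in> L \<Longrightarrow> y \<in> L \<Longrightarrow> br x y \<in> L"
    and add_left: "x \<in> L \<Longrightarrow> y \<in> L \<Longrightarrow> z \<in> L \<Longrightarrow> br (x + y) z = br x z + br y z"
    and scale_left: "x \<in> L \<Longrightarrow> z \<in> L \<Longrightarrow> br (c *\<^sub>R x) z = c *\<^sub>R br x z"
    and antisym: "x \<in> L \<Longrightarrow> y \<in> L \<Longrightarrow> br x y = - br y x"
    and jacobi: "x \<in> L \<Longrightarrow> y \<in> L \<Longrightarrow> z \<in> L \<Longrightarrow> br x (br y z) = br (br x y) z + br y (br x z)"
begin

lemma add_right: "x \<in> L \<Longrightarrow> y \<in> L \<Longrightarrow> z \<in> L \<Longrightarrow> br z (x + y) = br z x + br z y"
  using add_left[of x y z] antisym[of z "x + y"] antisym[of z x] antisym[of z y] subspace_add[OF subspace_L]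
  by simp

lemma scale_right: "x \<in> L \<Longrightarrow> z \<in> L \<Longrightarrow> br z (c *\<^sub>R x) = c *\<^sub>R br z x"
  using scale_left[of x z c] antisym[of z "c *\<^sub>R x"] antisym[of z x] subspace_scale[OF subspace_L]
  by simp

lemma linear_right: "z \<in> L \<Longrightarrow> linear_on L (br z)"
  by (intro linear_onI add_right scale_right)

lemma linear_left: "z \<in> L \<Longrightarrow> linear_on L (\<lambda>x. br x z)"
  by (intro linear_onI add_left scale_left)

lemma br_image: "z \<in> L \<Longrightarrow> br z ` L \<subseteq> L"
  using closed by auto

lemma zero_mem: "0 \<in> L" using subspace_0[OF subspace_L] .

lemma br_zero [simp]: "z \<in> L \<Longrightarrow> br z 0 = 0" "z \<in> L \<Longrightarrow> br 0 z = 0"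
  using scale_right[of 0 z 0] scale_left[of 0 z 0] zero_mem by auto

lemma br_span_right:
  assumes "u \<in> L" "S \<subseteq> L" "\<And>s. s \<in> S \<Longrightarrow> br u s \<in> T" "subspace T" "w \<in> span S"
  shows "br u w \<in> T"
proof -
  have "subspace {w\<in>L. br u w \<in> T}"
    by (intro subspaceI) (auto simp: add_right scale_right assms(1) subspace_0[OF assms(4)] zero_mem
      intro: subspace_add[OF assms(4)] subspace_scale[OF assms(4)] subspace_add[OF subspace_L] subspace_scale[OF subspace_L])
  then have "span S \<subseteq> {w\<in>L. br u w \<in> T}"
    using assms(2,3) by (intro span_minimal) auto
  then show ?thesis using assms(5) by blast
qed

section \<open>Engel's theorem\<close>

lemma power_mem: "x \<in> L \<Longrightarrow> v \<in> L \<Longrightarrow> (br x ^^ m) v \<in> L"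
  by (induction m) (auto simp: closed)

text \<open>The descending series of \<open>L\<close> as a module over \<open>U\<close>: for
  \<open>U\<close> inside \<open>L\<close> the k-th term is spanned by the iterated brackets [u_1,
  [u_2, ... [u_k, v]]]. It reaches {0} exactly when all products of some fixed length of operators
  ad u vanish on \<open>L\<close>.\<close>

primrec lower_series :: "'v set \<Rightarrow> nat \<Rightarrow> 'v set" where
  "lower_series U 0 = L"
| "lower_series U (Suc k) = span {br u w | u w. u \<in> U \<and> w \<in> lower_series U k}"

lemma lower_series_sub: "U \<subseteq> L \<Longrightarrow> lower_series U k \<subseteq> L"
proof (induction k)
  case (Suc k)
  then have "{br u w | u w. u \<in> U \<and> w \<in> lower_series U k} \<subseteq> L" using closed by blast
  then show ?case using span_minimal[OF _ subspace_L] by simp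
qed simp

lemma lower_series_subspace: "subspace (lower_series U k)"
  by (cases k) (auto simp: subspace_L)

lemma lower_series_Suc_mem: "u \<in> U \<Longrightarrow> w \<in> lower_series U k \<Longrightarrow> br u w \<in> lower_series U (Suc k)"
  unfolding lower_series.simps by (rule span_base) blast

lemma lower_series_decr: "U \<subseteq> L \<Longrightarrow> lower_series U (Suc k) \<subseteq> lower_series U k"
proof (induction k)
  case 0
  then show ?case using lower_series_sub[of U 1] by simp
next
  case (Suc k)
  have "{br u w | u w. u \<in> U \<and> w \<in> lower_series U (Suc k)} \<subseteq> {br u w | u w. u \<in> U \<and> w \<in> lower_series U k}"
    using Suc.IH[OF Suc.prems] by (auto simp del: lower_series.simps)
  then have "span {br u w | u w. u \<in> U \<and> w \<in> lower_series U (Suc k)} \<subseteq> span {br u w | u w. u \<in> U \<and> w \<in> lower_series U k}"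
    by (rule span_mono)
  then show ?case by (simp only: lower_series.simps(2))
qed

text \<open>If x normalises \<open>U\<close>, the Leibniz rule moves ad x past each u in
  \<open>U\<close> at the cost of [x, u], which is again in \<open>U\<close>.\<close>

lemma lower_series_normal:
  assumes "U \<subseteq> L" "x \<in> L" "\<And>u. u \<in> U \<Longrightarrow> br x u \<in> U"
  shows "w \<in> lower_series U k \<Longrightarrow> br x w \<in> lower_series U k"
proof (induction k arbitrary: w)
  case (Suc k)
  show ?case
  proof (rule br_span_right[OF assms(2) _ _ lower_series_subspace])
    show "w \<in> span {br u w | u w. u \<in> U \<and> w \<in> lower_series U k}" using Suc.prems by simp
    show "{br u w | u w. u \<in> U \<and> w \<in> lower_series U k} \<subseteq> L"
      using closed lower_series_sub[OF assms(1), of k] assms(1) by auto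
    fix s assume "s \<in> {br u w | u w. u \<in> U \<and> w \<in> lower_series U k}"
    then obtain u w where s: "s = br u w" "u \<in> U" "w \<in> lower_series U k" by blast
    then have mem: "u \<in> L" "w \<in> L" using assms(1) lower_series_sub by auto
    have "br x s = br (br x u) w + br u (br x w)"
      using jacobi[OF assms(2) mem] s by simp
    moreover have "br (br x u) w \<in> lower_series U (Suc k)"
      by (rule lower_series_Suc_mem) (use assms(3) s in auto)
    moreover have "br u (br x w) \<in> lower_series U (Suc k)"
      by (rule lower_series_Suc_mem) (use Suc.IH s in auto)
    ultimately show "br x s \<in> lower_series U (Suc k)"
      using subspace_add[OF lower_series_subspace] by metis
  qed
qed (use assms closed in auto)

text \<open>
  The lower series \<open>F\<close> of \<open>U\<close> is stable under \<open>x\<close>, and each step from \<open>F k\<close> to \<open>F (Suc k)\<close> is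
  refined by the images \<open>(ad x)\<^sup>j (F k)\<close>.
\<close>

lemma lower_series_extend:
  assumes U: "U \<subseteq> L" and N: "lower_series U N = {0}" and x: "x \<in> L"
    and norm: "\<And>u. u \<in> U \<Longrightarrow> br x u \<in> U"
    and nil: "\<And>v. v \<in> L \<Longrightarrow> (br x ^^ m) v = 0"
    and WE: "\<And>w. w \<in> W \<Longrightarrow> \<exists>u\<in>U. \<exists>c. w = u + c *\<^sub>R x" and U0: "subspace U"
  shows "\<exists>M. lower_series W M = {0}"
proof -
  have WL: "W \<subseteq> L"
  proof
    fix w assume "w \<in> W"
    then obtain u c where "u \<in> U" "w = u + c *\<^sub>R x" using WE by blast
    then show "w \<in> L" using U x subspace_add[OF subspace_L] subspace_scale[OF subspace_L] by auto
  qed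
  \<comment> \<open>Every term of the series of \<open>U\<close> eventually contains the series of
    \<open>W\<close>; the induction on k descends one term at a time.\<close>
  have "\<exists>M. lower_series W M \<subseteq> lower_series U k" for k
  proof (induction k)
    case 0
    show ?case by (rule exI[of _ 0]) simp
  next
    case (Suc k)
    then obtain M where M: "lower_series W M \<subseteq> lower_series U k" by blast
    define F where "F = lower_series U (Suc k)"
    define gen where "gen j = F \<union> (br x ^^ j) ` lower_series U k" for j
    have FL: "F \<subseteq> L" using lower_series_sub[OF U, of "Suc k"] by (simp add: F_def)
    have stab: "(br x ^^ j) w \<in> lower_series U k" if "w \<in> lower_series U k" for j w
      using that by (induction j) (auto intro: lower_series_normal[OF U x norm])
    have genL: "gen j \<subseteq> L" for j
      using FL power_mem[OF x] lower_series_sub[OF U, of k] by (auto simp: gen_def)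
    \<comment> \<open>Bracketing with u + c x sends \<open>gen j\<close> into the span of
      \<open>gen (Suc j)\<close>: u lowers a term of the series of \<open>U\<close> into
      \<open>F\<close>, while x preserves \<open>F\<close> and raises the power of ad x by
      one.\<close>
    have "lower_series W (M + j) \<subseteq> span (gen j)" for j
    proof (induction j)
      case 0
      then show ?case using M by (auto simp: gen_def intro: span_base)
    next
      case (Suc j)
      have "br u w \<in> span (gen (Suc j))" if u: "u \<in> W" and w: "w \<in> lower_series W (M + j)" for u w
      proof (rule br_span_right[OF _ genL _ subspace_span])
        show "u \<in> L" using u WL by blast
        show "w \<in> span (gen j)" using Suc.IH w by blast
        fix s assume s: "s \<in> gen j"
        then have sL: "s \<in> L" using genL by blast
        have sU: "s \<in> lower_series U k"
          using s stab lower_series_decr[OF U, of k] by (auto simp: gen_def F_def)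
        obtain v c where v: "u = v + c *\<^sub>R x" "v \<in> U" using WE[OF u] by auto
        have "br u s = br v s + c *\<^sub>R br x s"
          using v U x sL subspace_scale[OF subspace_L] by (auto simp: add_left scale_left)
        moreover have "br v s \<in> F" unfolding F_def using lower_series_Suc_mem[OF v(2) sU] .
        then have "br v s \<in> span (gen (Suc j))" by (auto simp: gen_def intro: span_base)
        moreover have "br x s \<in> gen (Suc j)"
        proof (cases "s \<in> F")
          case True
          then show ?thesis using lower_series_normal[OF U x norm, of s "Suc k"] by (simp add: gen_def F_def)
        next
          case False
          then obtain w where "w \<in> lower_series U k" "s = (br x ^^ j) w" using s by (auto simp: gen_def)
          then show ?thesis by (auto simp: gen_def)
        qed
        then have "br x s \<in> span (gen (Suc j))" by (rule span_base)
        ultimately show "br u s \<in> span (gen (Suc j))" by (simp add: span_add span_scale)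
      qed
      then have "{br u w | u w. u \<in> W \<and> w \<in> lower_series W (M + j)} \<subseteq> span (gen (Suc j))" by blast
      then show ?case using span_minimal[OF _ subspace_span] by simp
    qed
    then have "lower_series W (M + m) \<subseteq> span (gen m)" .
    \<comment> \<open>The m-th power of ad x is 0 on \<open>L\<close>, so the second half of
      \<open>gen m\<close> collapses.\<close>
    also have "gen m \<subseteq> F"
    proof
      fix y assume "y \<in> gen m"
      then consider "y \<in> F" | w where "w \<in> lower_series U k" "y = (br x ^^ m) w"
        by (auto simp: gen_def)
      then show "y \<in> F"
      proof cases
        case 2
        then have "y = 0" using nil[of w] lower_series_sub[OF U, of k] by auto
        then show ?thesis using subspace_0[OF lower_series_subspace] by (simp add: F_def del: lower_series.simps)
      qed
    qed
    then have "span (gen m) \<subseteq> F"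
      unfolding F_def by (rule span_minimal[OF _ lower_series_subspace])
    finally show ?case unfolding F_def ..
  qed
  from this[of N] obtain M where "lower_series W M \<subseteq> {0}" unfolding N ..
  then have "lower_series W M = {0}" using subspace_0[OF lower_series_subspace[of W M]] by auto
  then show ?thesis ..
qed

end

locale fin_lie_alg = lie_alg L br + fin_space L e n
  for L :: "'v::real_vector set" and br :: "'v \<Rightarrow> 'v \<Rightarrow> 'v" and e :: "nat \<Rightarrow> 'v" and n :: nat
begin

text \<open>A largest subalgebra of \<open>U\<close> acting nilpotently on \<open>L\<close> could be
  enlarged by a normalising element unless it is all of \<open>U\<close>. Such an element is found
  without passing to quotients: repeated brackets of some x0 outside the subalgebra with elements of
  the subalgebra end at 0, and the last stage not contained in it supplies the element.\<close>

lemma engel: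
  assumes U: "subspace U" "U \<subseteq> L" and closedU: "\<And>x y. x \<in> U \<Longrightarrow> y \<in> U \<Longrightarrow> br x y \<in> U"
    and nil: "\<And>x. x \<in> U \<Longrightarrow> \<exists>m. \<forall>v\<in>L. (br x ^^ m) v = 0"
  shows "\<exists>N. lower_series U N = {0}"
proof -
  \<comment> \<open>Subalgebras are represented by bases, so that the bound n on the size of
    independent sets yields a maximal one.\<close>
  define good where "good B \<longleftrightarrow> B \<subseteq> U \<and> independent B \<and>
    (\<forall>x\<in>span B. \<forall>y\<in>span B. br x y \<in> span B) \<and> (\<exists>N. lower_series (span B) N = {0})" for B
  have "{br u w | u w. u \<in> span {} \<and> w \<in> lower_series (span {}) 0} \<subseteq> {0}" by auto
  then have "lower_series (span {}) (Suc 0) \<subseteq> {0}"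
    unfolding lower_series.simps(2) by (intro span_minimal) auto
  then have "lower_series (span {}) (Suc 0) = {0}"
    using subspace_0[OF lower_series_subspace[of "span {}" "Suc 0"]] by auto
  then have "\<exists>N. lower_series (span {}) N = {0}" ..
  then have "good {}" using zero_mem independent_empty by (simp add: good_def)
  moreover have "\<forall>B. good B \<longrightarrow> card B < Suc n"
    using independent_bound U(2) by (auto simp: good_def less_Suc_eq_le)
  ultimately have "\<exists>B. good B \<and> (\<forall>B'. good B' \<longrightarrow> card B' \<le> card B)"
    by (rule ex_has_greatest_nat)
  then obtain B where B: "good B" and max: "\<And>B'. good B' \<Longrightarrow> card B' \<le> card B" by auto
  have BU: "span B \<subseteq> U" using B U(1) by (simp add: good_def span_minimal)
  have BL: "span B \<subseteq> L" using BU U(2) by blast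
  obtain N where N: "lower_series (span B) N = {0}" using B by (auto simp: good_def)
  have "U \<subseteq> span B"
  proof (rule ccontr)
    assume "\<not> U \<subseteq> span B"
    then obtain x0 where x0: "x0 \<in> U" "x0 \<notin> span B" by blast
    \<comment> \<open>The k-fold brackets of x0 with elements of \<open>span B\<close>. They lie in
      the k-th term of the series of \<open>span B\<close>, hence become 0.\<close>
    define X where "X k = ((\<lambda>S. {br u w | u w. u \<in> span B \<and> w \<in> S}) ^^ k) {x0}" for k
    have X0: "X 0 = {x0}" by (simp add: X_def)
    have XS: "X (Suc k) = {br u w | u w. u \<in> span B \<and> w \<in> X k}" for k by (simp add: X_def)
    have XU: "X k \<subseteq> U" for k
    proof (induction k)
      case (Suc k)
      then show ?case using closedU BU by (auto simp: XS)
    qed (simp add: X0 x0)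
    have "X k \<subseteq> lower_series (span B) k" for k
    proof (induction k)
      case 0
      then show ?case using x0 U(2) by (auto simp: X0)
    next
      case (Suc k)
      show ?case
      proof
        fix y assume "y \<in> X (Suc k)"
        then obtain u w where "y = br u w" "u \<in> span B" "w \<in> X k" by (auto simp: XS)
        then show "y \<in> lower_series (span B) (Suc k)"
          using lower_series_Suc_mem[of u "span B" w k] Suc.IH by (simp only: subset_iff)
      qed
    qed
    from this[of N] have "X N \<subseteq> span B" unfolding N using span_zero by blast
    then have ex: "\<exists>k. X k \<subseteq> span B" ..
    \<comment> \<open>The least such k is positive as x0 is outside \<open>span B\<close>. An
      element y of the previous stage that lies outside \<open>span B\<close> then satisfies
      [span B, y] \<subseteq> span B.\<close>
    define k where "k = (LEAST k. X k \<subseteq> span B)"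
    have k: "X k \<subseteq> span B" unfolding k_def by (rule LeastI_ex[OF ex])
    have "k \<noteq> 0"
    proof
      assume "k = 0"
      then show False using k x0(2) by (simp add: X0)
    qed
    then obtain j where j: "k = Suc j" using not0_implies_Suc by blast
    have "\<not> X j \<subseteq> span B" using not_less_Least[of j "\<lambda>k. X k \<subseteq> span B"] j by (simp add: k_def)
    then obtain y where y: "y \<in> X j" "y \<notin> span B" by blast
    have yU: "y \<in> U" using y XU by blast
    have yL: "y \<in> L" using yU U(2) by blast
    have norm: "br u y \<in> span B" if "u \<in> span B" for u
      using k that y by (auto simp: j XS)
    have norm': "br y u \<in> span B" if "u \<in> span B" for u
      using antisym[OF yL, of u] norm[OF that] that BL span_neg[of "br u y" B] by auto
    have dec: "\<exists>u\<in>span B. \<exists>c. w = u + c *\<^sub>R y" if "w \<in> span (insert y B)" for w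
    proof -
      obtain c where "w - c *\<^sub>R y \<in> span B" using \<open>w \<in> span (insert y B)\<close> by (auto simp: span_insert)
      then show ?thesis by (intro bexI[of _ "w - c *\<^sub>R y"] exI[of _ c]) auto
    qed
    obtain m where m: "\<And>v. v \<in> L \<Longrightarrow> (br y ^^ m) v = 0" using nil[OF yU] by blast
    have "good (insert y B)"
      unfolding good_def
    proof (intro conjI ballI)
      show "insert y B \<subseteq> U" using B yU by (simp add: good_def)
      show "independent (insert y B)" using B y by (simp add: good_def independent_insert)
      show "\<exists>N. lower_series (span (insert y B)) N = {0}"
        by (rule lower_series_extend[OF BL N yL norm' m dec subspace_span])
      fix w z assume "w \<in> span (insert y B)" "z \<in> span (insert y B)"
      then obtain u c v d where w: "w = u + c *\<^sub>R y" "u \<in> span B" and z: "z = v + d *\<^sub>R y" "v \<in> span B"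
        using dec by blast
      have mem: "u \<in> L" "v \<in> L" "c *\<^sub>R y \<in> L" "d *\<^sub>R y \<in> L" "v + d *\<^sub>R y \<in> L"
        using w z BL yL subspace_scale[OF subspace_L] subspace_add[OF subspace_L] by auto
      have yy: "br y y = 0" using antisym[OF yL yL] by (simp add: eq_neg_iff_add_eq_0 scaleR_2[symmetric])
      have "br w z = br u v + d *\<^sub>R br u y + c *\<^sub>R br y v"
        unfolding w(1) z(1) using mem yL
        by (simp add: add_left add_right scale_left scale_right yy)
      moreover have "br u v \<in> span B" using B w z by (simp add: good_def)
      ultimately have "br w z \<in> span B"
        using norm[OF w(2)] norm'[OF z(2)] by (simp add: span_add span_scale)
      then show "br w z \<in> span (insert y B)" using span_mono[of B "insert y B"] by blast
    qed
    from max[OF this] have "card (insert y B) \<le> card B" .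
    moreover have "finite B" using independent_bound[of B] B U(2) by (auto simp: good_def)
    moreover have "y \<notin> B" using y span_base by blast
    ultimately show False by simp
  qed
  then have "span B = U" using BU by blast
  then show ?thesis using N by blast
qed

section \<open>The Killing form and its radical\<close>

definition killing :: "'v \<Rightarrow> 'v \<Rightarrow> real" where "killing x y = trace_on (\<lambda>v. br x (br y v))"

definition killing_radical :: "'v set" where "killing_radical = {x\<in>L. \<forall>y\<in>L. killing x y = 0}"

lemma killing_coef:
  "x \<in> L \<Longrightarrow> y \<in> L \<Longrightarrow> killing x y = (\<Sum>i<n. \<Sum>j<n. coef (br x (e j)) i * coef (br y (e i)) j)"
  unfolding killing_def by (intro trace_on_comp linear_right br_image)

lemma killing_sym: "x \<in> L \<Longrightarrow> y \<in> L \<Longrightarrow> killing x y = killing y x"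
  unfolding killing_def by (intro trace_on_commute linear_right br_image)

lemma killing_linear: "y \<in> L \<Longrightarrow> linear_on L (\<lambda>x. killing x y)"
proof (rule linear_onI)
  fix x z assume m: "y \<in> L" "x \<in> L" "z \<in> L"
  have "killing (x + z) y = trace_on (\<lambda>v. br x (br y v) + br z (br y v))"
    unfolding killing_def using m by (intro trace_on_cong add_left closed)
  then show "killing (x + z) y = killing x y + killing z y"
    unfolding killing_def using m by (subst (asm) trace_on_add) (auto simp: closed)
next
  fix x c assume m: "y \<in> L" "x \<in> L"
  have "killing (c *\<^sub>R x) y = trace_on (\<lambda>v. c *\<^sub>R br x (br y v))"
    unfolding killing_def using m by (intro trace_on_cong scale_left closed)
  then show "killing (c *\<^sub>R x) y = c *\<^sub>R killing x y"
    unfolding killing_def using m by (subst (asm) trace_on_scale) (auto simp: closed)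
qed

lemma trace_on_diff:
  assumes "S ` L \<subseteq> L" "T ` L \<subseteq> L"
  shows "trace_on (\<lambda>v. S v - T v) = trace_on S - trace_on T"
proof -
  have T': "(\<lambda>v. (- 1) *\<^sub>R T v) ` L \<subseteq> L"
    using assms(2) by (auto simp: image_subset_iff subspace_neg[OF subspace_L])
  show ?thesis
    using trace_on_add[OF assms(1) T'] trace_on_scale[OF assms(2), of "- 1"] by simp
qed

text \<open>Cyclicity of the trace: tr ((x y - y x) S) = tr (x (y S - S y)) for the operators ad x
  and ad y. It serves with S = ad z for the invariance of the Killing form, with S a derivation, and
  with S the identity.\<close>

lemma trace_ad_bracket:
  assumes x: "x \<in> L" and y: "y \<in> L" and S: "linear_on L S" "S ` L \<subseteq> L"
  shows "trace_on (\<lambda>v. br (br x y) (S v)) = trace_on (\<lambda>v. br x (br y (S v) - S (br y v)))"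
proof -
  have SL: "S v \<in> L" if "v \<in> L" for v using S that by auto
  have "trace_on (\<lambda>v. br (br x y) (S v)) = trace_on (\<lambda>v. br x (br y (S v)) - br y (br x (S v)))"
    by (rule trace_on_cong) (simp add: jacobi[OF x y SL])
  also have "\<dots> = trace_on (\<lambda>v. br x (br y (S v))) - trace_on (\<lambda>v. br y (br x (S v)))"
    by (rule trace_on_diff) (auto simp: closed x y SL)
  also have "trace_on (\<lambda>v. br y (br x (S v))) = trace_on (\<lambda>v. br x (S (br y v)))"
    using trace_on_commute[OF linear_right[OF y] br_image[OF y], of "\<lambda>v. br x (S v)"]
      linear_on_comp[OF linear_right[OF x] S] by (auto simp: image_subset_iff closed x SL)
  also have "trace_on (\<lambda>v. br x (br y (S v))) - trace_on (\<lambda>v. br x (S (br y v)))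
      = trace_on (\<lambda>v. br x (br y (S v)) - br x (S (br y v)))"
    by (rule trace_on_diff[symmetric]) (auto simp: closed x y SL)
  also have "\<dots> = trace_on (\<lambda>v. br x (br y (S v) - S (br y v)))"
  proof (rule trace_on_cong)
    fix v assume v: "v \<in> L"
    show "br x (br y (S v)) - br x (S (br y v)) = br x (br y (S v) - S (br y v))"
      using add_right[of "br y (S v)" "- S (br y v)" x] scale_right[of "S (br y v)" x "- 1"]
        v x y subspace_neg[OF subspace_L] by (simp add: closed SL)
  qed
  finally show ?thesis .
qed

lemma killing_invariant:
  assumes "x \<in> L" "y \<in> L" "z \<in> L"
  shows "killing (br x y) z = killing x (br y z)"
proof -
  have "killing (br x y) z = trace_on (\<lambda>v. br x (br y (br z v) - br z (br y v)))"
    unfolding killing_def by (rule trace_ad_bracket) (use assms linear_right br_image in auto)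
  also have "\<dots> = killing x (br y z)"
    unfolding killing_def by (rule trace_on_cong) (simp add: jacobi[OF assms(2,3)])
  finally show ?thesis .
qed

lemma killing_radical_subspace: "subspace killing_radical"
proof (rule subspaceI)
  have "killing 0 y = 0" if "y \<in> L" for y
    using linear_onD(2)[OF killing_linear[OF that] zero_mem, of 0] by simp
  then show "0 \<in> killing_radical" by (simp add: killing_radical_def zero_mem)
  fix x z c assume "x \<in> killing_radical"
  then have x: "x \<in> L" "\<And>y. y \<in> L \<Longrightarrow> killing x y = 0" by (auto simp: killing_radical_def)
  show "c *\<^sub>R x \<in> killing_radical"
    using x subspace_scale[OF subspace_L x(1)] by (simp add: killing_radical_def linear_onD(2)[OF killing_linear])
  assume "z \<in> killing_radical"
  then have z: "z \<in> L" "\<And>y. y \<in> L \<Longrightarrow> killing z y = 0" by (auto simp: killing_radical_def)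
  show "x + z \<in> killing_radical"
    using x z subspace_add[OF subspace_L x(1) z(1)] by (simp add: killing_radical_def linear_onD(1)[OF killing_linear])
qed

lemma killing_radical_ideal: "lie_ideal br L killing_radical"
  unfolding lie_ideal_def
proof (intro conjI ballI)
  show "subspace killing_radical" by (rule killing_radical_subspace)
  show "killing_radical \<subseteq> L" by (auto simp: killing_radical_def)
  fix x y assume "x \<in> L" "y \<in> killing_radical"
  then have m: "x \<in> L" "y \<in> L" and k: "\<And>z. z \<in> L \<Longrightarrow> killing y z = 0" by (auto simp: killing_radical_def)
  have "br y x \<in> killing_radical"
    unfolding killing_radical_def using killing_invariant[OF m(2,1)] k m closed by simp
  moreover have "br x y = - br y x" by (rule antisym[OF m])
  ultimately show "br x y \<in> killing_radical" using subspace_neg[OF killing_radical_subspace] by simp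
qed


section \<open>Cartan's criterion: solvability of the Killing radical\<close>

lemma coef_br_right: "x \<in> L \<Longrightarrow> w \<in> L \<Longrightarrow> coef (br x w) k = (\<Sum>r<n. coef (br x (e r)) k * coef w r)"
  using linear_on_expand[OF linear_on_comp[OF coef_linear linear_right br_image]] by (simp add: mult.commute)

lemma coef_br_left: "z \<in> L \<Longrightarrow> w \<in> L \<Longrightarrow> coef (br w z) k = (\<Sum>r<n. coef w r * coef (br (e r) z) k)"
  using linear_on_expand[OF linear_on_comp[OF coef_linear linear_left]] closed by (simp add: image_subset_iff)

text \<open>Reading real entries as complex numbers is the whole complexification; its vectors exist
  only as coordinate tuples.\<close>

definition ad_mat :: "'v \<Rightarrow> nat \<Rightarrow> nat \<Rightarrow> complex"
  where "ad_mat x k m = complex_of_real (coef (br x (e m)) k)"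

definition struct_const :: "nat \<Rightarrow> nat \<Rightarrow> nat \<Rightarrow> complex"
  where "struct_const i j k = complex_of_real (coef (br (e i) (e j)) k)"

lemma derivation_ad_mat:
  assumes "x \<in> L"
  shows "derivation_mat n struct_const (ad_mat x)"
  unfolding derivation_mat_def
proof (intro allI impI)
  fix i j k assume "i < n" "j < n" "k < n"
  then have ij: "e i \<in> L" "e j \<in> L" by (auto intro: e_mem)
  have "coef (br x (br (e i) (e j))) k = coef (br (br x (e i)) (e j)) k + coef (br (e i) (br x (e j))) k"
    using jacobi[OF assms ij] linear_onD(1)[OF coef_linear] assms ij closed by simp
  then have "(\<Sum>r<n. coef (br x (e r)) k * coef (br (e i) (e j)) r)
      = (\<Sum>r<n. coef (br x (e i)) r * coef (br (e r) (e j)) k) + (\<Sum>r<n. coef (br x (e j)) r * coef (br (e i) (e r)) k)"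
    using coef_br_right[of x "br (e i) (e j)"] coef_br_left[of "e j" "br x (e i)"] coef_br_right[of "e i" "br x (e j)"]
      assms ij closed by (simp add: mult.commute)
  from arg_cong[OF this, of complex_of_real]
  show "(\<Sum>r<n. ad_mat x k r * struct_const i j r)
      = (\<Sum>r<n. ad_mat x r i * struct_const r j k) + (\<Sum>r<n. ad_mat x r j * struct_const i r k)"
    by (simp add: ad_mat_def struct_const_def)
qed

text \<open>Carries nilpotency of the complex matrix back to the real operator.\<close>

lemma ad_mat_power:
  assumes x: "x \<in> L" and v: "v \<in> L"
  shows "k < n \<Longrightarrow> (mat_apply n (ad_mat x) ^^ m) (\<lambda>i. complex_of_real (coef v i)) k = complex_of_real (coef ((br x ^^ m) v) k)"
proof (induction m arbitrary: k)
  case (Suc m)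
  have "(mat_apply n (ad_mat x) ^^ Suc m) (\<lambda>i. complex_of_real (coef v i)) k
      = mat_apply n (ad_mat x) (\<lambda>i. complex_of_real (coef ((br x ^^ m) v) i)) k"
    unfolding funpow.simps comp_apply by (rule mat_apply_cong) (rule Suc.IH)
  also have "\<dots> = complex_of_real (coef ((br x ^^ Suc m) v) k)"
    using coef_br_right[OF x power_mem[OF x v], of m k] by (simp add: mat_apply_def ad_mat_def)
  finally show ?case .
qed simp

text \<open>As D is a derivation, [D, ad b] = ad (D b), so cyclicity gives tr (ad [a, b] D) = - tr
  (ad a ad (D b)). The right side is the complex-linear extension of the Killing form at a and D b,
  and a is orthogonal to every basis vector.\<close>

lemma trace_radical_bracket:
  assumes D: "derivation_mat n struct_const D" and a: "a \<in> killing_radical" and b: "b \<in> L"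
  shows "(\<Sum>k<n. \<Sum>m<n. ad_mat (br a b) k m * D m k) = 0"
proof -
  have aL: "a \<in> L" and ka: "\<And>y. y \<in> L \<Longrightarrow> killing a y = 0" using a by (auto simp: killing_radical_def)
  define u where "u i = complex_of_real (coef b i)" for i
  define w where "w = mat_apply n D u"
  have ad: "ad_mat (br a b) k m = (\<Sum>r<n. ad_mat a k r * ad_mat b r m) - (\<Sum>r<n. ad_mat b k r * ad_mat a r m)"
    if "k < n" "m < n" for k m
  proof -
    have m: "e m \<in> L" using that e_mem by blast
    have "br a (br b (e m)) = br (br a b) (e m) + br b (br a (e m))" by (rule jacobi[OF aL b m])
    then have "coef (br a (br b (e m))) k = coef (br (br a b) (e m)) k + coef (br b (br a (e m))) k"
      using linear_onD(1)[OF coef_linear] closed aL b m by simp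
    then have "coef (br (br a b) (e m)) k = (\<Sum>r<n. coef (br a (e r)) k * coef (br b (e m)) r) - (\<Sum>r<n. coef (br b (e r)) k * coef (br a (e m)) r)"
      using coef_br_right[OF aL closed[OF b m]] coef_br_right[OF b closed[OF aL m]] by simp
    from arg_cong[OF this, of complex_of_real] show ?thesis by (simp add: ad_mat_def)
  qed
  \<comment> \<open>The Leibniz rule at b and the m-th basis vector, in entries: D (ad b) = ad (D b)
    + (ad b) D, where \<open>w\<close> holds the complex coordinates of D b.\<close>
  have DA: "(\<Sum>r<n. D k r * ad_mat b r m) = (\<Sum>i<n. w i * struct_const i m k) + (\<Sum>r<n. ad_mat b k r * D r m)"
    if "k < n" "m < n" for k m
  proof -
    let ?d = "\<lambda>r. if r = m then (1::complex) else 0"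
    have bl: "bilin n struct_const u v = mat_apply n (ad_mat b) v" for v
    proof
      fix k
      have "bilin n struct_const u v k = (\<Sum>j<n. \<Sum>i<n. u i * v j * struct_const i j k)"
        unfolding bilin_def by (rule sum.swap)
      also have "\<dots> = (\<Sum>j<n. complex_of_real (\<Sum>i<n. coef b i * coef (br (e i) (e j)) k) * v j)"
        by (simp add: u_def struct_const_def sum_distrib_right sum_distrib_left mult.assoc mult.commute mult.left_commute)
      also have "\<dots> = mat_apply n (ad_mat b) v k"
        unfolding mat_apply_def ad_mat_def using coef_br_left[OF e_mem b] by simp
      finally show "bilin n struct_const u v k = mat_apply n (ad_mat b) v k" .
    qed
    have "mat_apply n D (bilin n struct_const u ?d) k
      = bilin n struct_const (mat_apply n D u) ?d k + bilin n struct_const u (mat_apply n D ?d) k"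
      by (rule derivation_mat_bilin[OF D that(1)])
    then show ?thesis
      unfolding bl using that by (simp add: bilin_delta2 mat_apply_delta w_def)
        (simp add: mat_apply_def[of n D] mat_apply_def[of n "ad_mat b"] mat_apply_delta[unfolded mat_apply_def])
  qed
  have "(\<Sum>k<n. \<Sum>m<n. ad_mat (br a b) k m * D m k)
      = (\<Sum>k<n. \<Sum>m<n. \<Sum>r<n. ad_mat a k r * ad_mat b r m * D m k) - (\<Sum>k<n. \<Sum>m<n. \<Sum>r<n. ad_mat b k r * ad_mat a r m * D m k)"
    by (simp add: ad left_diff_distrib sum_subtractf sum_distrib_right)
  also have "(\<Sum>k<n. \<Sum>m<n. \<Sum>r<n. ad_mat a k r * ad_mat b r m * D m k)
      = (\<Sum>k<n. \<Sum>r<n. ad_mat a k r * (\<Sum>m<n. ad_mat b r m * D m k))"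
    unfolding sum_distrib_left by (rule sum.cong[OF refl], subst sum.swap) (simp add: mult.assoc)
  also have "(\<Sum>k<n. \<Sum>m<n. \<Sum>r<n. ad_mat b k r * ad_mat a r m * D m k)
      = (\<Sum>k<n. \<Sum>r<n. \<Sum>m<n. ad_mat b k r * ad_mat a r m * D m k)"
    by (rule sum.cong[OF refl], rule sum.swap)
  also have "\<dots> = (\<Sum>r<n. \<Sum>k<n. \<Sum>m<n. ad_mat b k r * ad_mat a r m * D m k)"
    by (rule sum.swap)
  also have "\<dots> = (\<Sum>r<n. \<Sum>m<n. ad_mat a r m * (\<Sum>k<n. D m k * ad_mat b k r))"
    unfolding sum_distrib_left by (rule sum.cong[OF refl], subst sum.swap) (simp add: algebra_simps)
  also have "(\<Sum>k<n. \<Sum>r<n. ad_mat a k r * (\<Sum>m<n. ad_mat b r m * D m k)) - (\<Sum>r<n. \<Sum>m<n. ad_mat a r m * (\<Sum>k<n. D m k * ad_mat b k r))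
      = - (\<Sum>k<n. \<Sum>r<n. \<Sum>i<n. w i * (ad_mat a k r * struct_const i k r))"
    using DA by (simp add: sum_subtractf[symmetric] sum_negf[symmetric] algebra_simps sum_distrib_left)
  also have "(\<Sum>k<n. \<Sum>r<n. \<Sum>i<n. w i * (ad_mat a k r * struct_const i k r))
      = (\<Sum>k<n. \<Sum>i<n. \<Sum>r<n. w i * (ad_mat a k r * struct_const i k r))"
    by (rule sum.cong[OF refl], rule sum.swap)
  also have "\<dots> = (\<Sum>i<n. \<Sum>k<n. \<Sum>r<n. w i * (ad_mat a k r * struct_const i k r))"
    by (rule sum.swap)
  also have "\<dots> = (\<Sum>i<n. w i * complex_of_real (killing a (e i)))"
    by (rule sum.cong[OF refl])
      (simp add: killing_coef[OF aL e_mem] sum_distrib_left ad_mat_def struct_const_def)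
  also have "\<dots> = 0" using ka e_mem by simp
  finally show ?thesis by simp
qed

text \<open>For the conjugate derivation D of ad x, the number tr (ad x D) is the sum of the squared
  moduli of the eigenvalues of ad x. It is 0, hence so are all eigenvalues.\<close>

lemma radical_bracket_nilpotent:
  assumes x: "x \<in> span {br a b | a b. a \<in> killing_radical \<and> b \<in> L}" and v: "v \<in> L"
  shows "(br x ^^ n) v = 0"
proof -
  let ?S = "{br a b | a b. a \<in> killing_radical \<and> b \<in> L}"
  have SL: "?S \<subseteq> L" using closed by (auto simp: killing_radical_def)
  have xL: "x \<in> L" using x span_minimal[OF SL subspace_L] by blast
  obtain D l where D: "derivation_mat n struct_const D"
    and tr: "(\<Sum>k<n. \<Sum>m<n. ad_mat x k m * D m k) = of_real (\<Sum>r<n. (cmod (l r))\<^sup>2)"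
    and nil: "(\<forall>r<n. l r = 0) \<Longrightarrow> (\<forall>u. \<forall>k<n. (mat_apply n (ad_mat x) ^^ n) u k = 0)"
    by (rule conjugate_derivation[OF derivation_ad_mat[OF xL]]) blast
  \<comment> \<open>D is chosen from x and then held fixed, which makes the trace linear in y; it
    suffices that it vanishes on single brackets.\<close>
  let ?t = "\<lambda>y. \<Sum>k<n. \<Sum>m<n. ad_mat y k m * D m k"
  have "subspace {y\<in>L. ?t y = 0}"
  proof (rule subspaceI)
    show "0 \<in> {y\<in>L. ?t y = 0}"
      using linear_onD(2)[OF coef_linear zero_mem, of 0] zero_mem e_mem by (simp add: ad_mat_def)
    fix y z c assume y: "y \<in> {y\<in>L. ?t y = 0}"
    have "ad_mat (c *\<^sub>R y) k m = of_real c * ad_mat y k m" if "m < n" for k m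
      using y that e_mem closed by (simp add: ad_mat_def scale_left linear_onD(2)[OF coef_linear])
    then show "c *\<^sub>R y \<in> {y\<in>L. ?t y = 0}"
      using y subspace_scale[OF subspace_L, of y c] by (simp add: mult.assoc flip: sum_distrib_left)
    assume z: "z \<in> {y\<in>L. ?t y = 0}"
    have "ad_mat (y + z) k m = ad_mat y k m + ad_mat z k m" if "m < n" for k m
      using y z that e_mem closed by (simp add: ad_mat_def add_left linear_onD(1)[OF coef_linear])
    then show "y + z \<in> {y\<in>L. ?t y = 0}"
      using y z subspace_add[OF subspace_L, of y z] by (simp add: distrib_right sum.distrib)
  qed
  moreover have "?S \<subseteq> {y\<in>L. ?t y = 0}"
    using SL trace_radical_bracket[OF D] by auto
  ultimately have "span ?S \<subseteq> {y\<in>L. ?t y = 0}" by (rule span_minimal[rotated])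
  then have "?t x = 0" using x by blast
  then have "(\<Sum>r<n. (cmod (l r))\<^sup>2) = 0" unfolding tr of_real_eq_0_iff .
  then have "\<forall>r<n. l r = 0" by (simp add: sum_nonneg_eq_0_iff)
  from nil[OF this] have "coef ((br x ^^ n) v) k = 0" if "k < n" for k
    using ad_mat_power[OF xL v that, of n] that by simp
  then show ?thesis using expand[OF power_mem[OF xL v, of n]] by simp
qed

text \<open>The elements of U = [R, R] are ad-nilpotent, so Engel's theorem makes the series of
  \<open>U\<close> on \<open>L\<close> end at 0. The derived series of R, shifted by one since
  nilpotency is known on [R, R], stays inside that series.\<close>

lemma killing_radical_solvable: "solvable br killing_radical"
proof -
  let ?R = killing_radical
  have RL: "?R \<subseteq> L" by (auto simp: killing_radical_def)
  have Rbr: "br x y \<in> ?R" if "x \<in> L" "y \<in> ?R" for x y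
    using killing_radical_ideal that by (simp add: lie_ideal_def)
  define U where "U = derived_series br ?R (Suc 0)"
  have U: "U = span {br x y | x y. x \<in> ?R \<and> y \<in> ?R}" by (simp add: U_def)
  have "{br x y | x y. x \<in> ?R \<and> y \<in> ?R} \<subseteq> ?R" using Rbr RL by blast
  then have UR: "U \<subseteq> ?R" unfolding U by (rule span_minimal[OF _ killing_radical_subspace])
  then have UL: "U \<subseteq> L" using RL by blast
  have "{br x y | x y. x \<in> ?R \<and> y \<in> ?R} \<subseteq> {br x y | x y. x \<in> ?R \<and> y \<in> L}" using RL by blast
  then have U2: "U \<subseteq> span {br x y | x y. x \<in> ?R \<and> y \<in> L}" unfolding U by (rule span_mono)
  have "\<exists>N. lower_series U N = {0}"
  proof (rule engel[OF _ UL])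
    show "subspace U" unfolding U by (rule subspace_span)
    show "br x y \<in> U" if "x \<in> U" "y \<in> U" for x y
    proof -
      have "x \<in> ?R" "y \<in> ?R" using that UR by auto
      then show ?thesis unfolding U by (intro span_base) blast
    qed
    show "\<exists>m. \<forall>v\<in>L. (br x ^^ m) v = 0" if "x \<in> U" for x
      using radical_bracket_nilpotent that U2 by blast
  qed
  then obtain N where N: "lower_series U N = {0}" ..
  have decr: "derived_series br ?R (Suc k) \<subseteq> U" for k
  proof (induction k)
    case (Suc k)
    have "{br x y | x y. x \<in> derived_series br ?R (Suc k) \<and> y \<in> derived_series br ?R (Suc k)} \<subseteq> {br x y | x y. x \<in> ?R \<and> y \<in> ?R}"
      using Suc UR by (auto simp del: derived_series.simps)
    then show ?case unfolding U derived_series.simps(2)[of _ _ "Suc k"] by (rule span_mono)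
  qed (simp add: U_def del: derived_series.simps)
  have "derived_series br ?R (Suc k) \<subseteq> lower_series U k" for k
  proof (induction k)
    case 0
    then show ?case using decr[of 0] UL by (simp del: derived_series.simps)
  next
    case (Suc k)
    have "{br x y | x y. x \<in> derived_series br ?R (Suc k) \<and> y \<in> derived_series br ?R (Suc k)} \<subseteq> {br x y | x y. x \<in> U \<and> y \<in> lower_series U k}"
      using Suc decr[of k] by (auto simp del: derived_series.simps lower_series.simps)
    then show ?case unfolding derived_series.simps(2)[of _ _ "Suc k"] lower_series.simps(2) by (rule span_mono)
  qed
  from this[of N] have "derived_series br ?R (Suc N) \<subseteq> {0}" unfolding N .
  moreover have "0 \<in> derived_series br ?R (Suc N)" by (simp add: span_zero)
  ultimately have "derived_series br ?R (Suc N) = {0}" by (simp del: derived_series.simps add: set_eq_subset)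
  then show ?thesis unfolding solvable_def ..
qed

section \<open>Consequences of nondegeneracy: perfectness and inner derivations\<close>

lemma semisimple_killing_nondegenerate:
  assumes "semisimple br L" "x \<in> L" "\<And>y. y \<in> L \<Longrightarrow> killing x y = 0"
  shows "x = 0"
proof -
  have "killing_radical = {0}"
    using assms(1) killing_radical_ideal killing_radical_solvable by (simp add: semisimple_def)
  moreover have "x \<in> killing_radical" using assms(2,3) by (simp add: killing_radical_def)
  ultimately show ?thesis by simp
qed

text \<open>An injective endomorphism of a finite-dimensional space is onto. \<open>f\<close>
  records the values of the Killing form against the basis, nondegeneracy makes it injective, and so
  the prescribed values \<phi> (e j) are attained at some d.\<close>

lemma semisimple_functional:
  assumes ss: "semisimple br L" and \<phi>: "linear_on L (\<phi> :: 'v \<Rightarrow> real)"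
  obtains d where "d \<in> L" "\<And>x. x \<in> L \<Longrightarrow> \<phi> x = killing d x"
proof -
  define f where "f x = (\<Sum>j<n. killing x (e j) *\<^sub>R e j)" for x
  have kl: "linear_on L (killing x)" if "x \<in> L" for x
    using killing_linear[OF that] killing_sym[OF that] subspace_add[OF subspace_L] subspace_scale[OF subspace_L]
    by (simp add: linear_on_def)
  have fL: "linear_on L f"
    by (rule linear_onI)
      (simp_all add: f_def linear_onD[OF killing_linear[OF e_mem]] scaleR_left_distrib sum.distrib scaleR_sum_right)
  have fmem: "f x \<in> L" for x
    unfolding f_def by (intro subspace_sum[OF subspace_L] subspace_scale[OF subspace_L] e_mem) auto
  \<comment> \<open>\<open>f\<close> is linear on \<open>L\<close>; \<open>g\<close> agrees with it
    there and is linear on the whole type, so the general facts on \<open>linear\<close> maps apply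
    to \<open>g\<close>.\<close>
  obtain g where g: "linear g" "\<And>x. x \<in> e ` {..<n} \<Longrightarrow> g x = f x"
    using linear_independent_extend[OF indep, of f] by blast
  have gf: "g x = f x" if "x \<in> L" for x
  proof -
    have "g x = (\<Sum>i<n. coef x i *\<^sub>R g (e i))"
      using expand[OF that] g(1) by (metis (no_types, lifting) linear_scale linear_sum sum.cong)
    also have "\<dots> = (\<Sum>i<n. coef x i *\<^sub>R f (e i))" using g(2) by simp
    also have "\<dots> = f x" using linear_on_expand[OF fL that] by simp
    finally show ?thesis .
  qed
  have inj: "inj_on g L"
  proof -
    have "x = 0" if x: "x \<in> L" "g x = 0" for x
    proof (rule semisimple_killing_nondegenerate[OF ss x(1)])
      fix y assume y: "y \<in> L"
      have "killing x (e j) = 0" if "j < n" for j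
        using coef_sum[OF that, of "\<lambda>j. killing x (e j)"] x gf linear_onD(2)[OF coef_linear zero_mem, of 0 j]
        by (simp add: f_def)
      then show "killing x y = 0" using linear_on_expand[OF kl[OF x(1)] y] by simp
    qed
    then show ?thesis using linear_inj_on_iff_eq_0[OF g(1) subspace_L] by blast
  qed
  have ind: "independent (g ` e ` {..<n})"
    by (rule linear_independent_injective_image[OF g(1) indep]) (use inj span_e in simp)
  have "inj_on g (e ` {..<n})" using inj e_mem by (auto intro: inj_on_subset)
  then have "card (g ` e ` {..<n}) = n" by (simp add: card_image inj_e)
  then have "span (g ` e ` {..<n}) = L"
    by (intro independent_card_span[OF ind]) (auto simp: e_mem gf fmem)
  then have "g ` L = L" using linear_span_image[OF g(1), of "e ` {..<n}"] span_e by simp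
  moreover have "(\<Sum>j<n. \<phi> (e j) *\<^sub>R e j) \<in> L"
    by (intro subspace_sum[OF subspace_L] subspace_scale[OF subspace_L] e_mem) auto
  ultimately obtain d where d: "d \<in> L" "g d = (\<Sum>j<n. \<phi> (e j) *\<^sub>R e j)" by (metis imageE)
  have "killing d (e j) = \<phi> (e j)" if "j < n" for j
    using coef_sum[OF that, of "\<lambda>j. killing d (e j)"] coef_sum[OF that, of "\<lambda>j. \<phi> (e j)"] d gf
    by (simp add: f_def)
  then have "\<phi> x = killing d x" if "x \<in> L" for x
    using linear_on_expand[OF kl[OF d(1)] that] linear_on_expand[OF \<phi> that] by simp
  then show ?thesis using that d(1) by blast
qed

text \<open>Perfectness of \<open>L\<close> in dual form. If K(d, -) represents \<phi>, invariance
  and nondegeneracy make d central; then ad d = 0 and K(d, -) = 0.\<close>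

theorem semisimple_functional_eq_0:
  assumes ss: "semisimple br L" and \<phi>: "linear_on L (\<phi> :: 'v \<Rightarrow> real)"
    and br: "\<And>x y. x \<in> L \<Longrightarrow> y \<in> L \<Longrightarrow> \<phi> (br x y) = 0" and x: "x \<in> L"
  shows "\<phi> x = 0"
proof -
  obtain d where d: "d \<in> L" and \<phi>d: "\<And>x. x \<in> L \<Longrightarrow> \<phi> x = killing d x"
    using semisimple_functional[OF ss \<phi>] by blast
  have z: "br d y = 0" if y: "y \<in> L" for y
  proof (rule semisimple_killing_nondegenerate[OF ss closed[OF d y]])
    fix z assume z: "z \<in> L"
    show "killing (br d y) z = 0"
      using killing_invariant[OF d y z] \<phi>d[OF closed[OF y z]] br[OF y z] by simp
  qed
  have "killing d x = 0"
    unfolding killing_def trace_on_def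
    using z x closed e_mem linear_onD(2)[OF coef_linear zero_mem, of 0] by simp
  then show ?thesis using \<phi>d[OF x] by simp
qed

text \<open>If d represents the functional x \<mapsto> tr (ad x D), then D y and [d, y] have the
  same Killing product with every z, so D = ad d. The trace of ad d is 0 because x \<mapsto> tr (ad
  x) vanishes on brackets and \<open>L\<close> is perfect.\<close>

theorem semisimple_derivation_trace_eq_0:
  assumes ss: "semisimple br L" and D: "linear_on L D" "D ` L \<subseteq> L"
    and der: "\<And>x y. x \<in> L \<Longrightarrow> y \<in> L \<Longrightarrow> D (br x y) = br (D x) y + br x (D y)"
  shows "trace_on D = 0"
proof -
  have DL: "D x \<in> L" if "x \<in> L" for x using D(2) that by auto
  define \<phi> where "\<phi> x = trace_on (\<lambda>v. br x (D v))" for x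
  have "linear_on L \<phi>"
  proof (rule linear_onI)
    fix x y assume m: "x \<in> L" "y \<in> L"
    have "\<phi> (x + y) = trace_on (\<lambda>v. br x (D v) + br y (D v))"
      unfolding \<phi>_def using m by (intro trace_on_cong add_left DL)
    also have "\<dots> = \<phi> x + \<phi> y"
      unfolding \<phi>_def by (rule trace_on_add) (auto simp: m closed DL)
    finally show "\<phi> (x + y) = \<phi> x + \<phi> y" .
  next
    fix x c assume m: "x \<in> L"
    have "\<phi> (c *\<^sub>R x) = trace_on (\<lambda>v. c *\<^sub>R br x (D v))"
      unfolding \<phi>_def using m by (intro trace_on_cong scale_left DL)
    also have "\<dots> = c *\<^sub>R \<phi> x"
      unfolding \<phi>_def real_scaleR_def by (rule trace_on_scale) (auto simp: m closed DL)
    finally show "\<phi> (c *\<^sub>R x) = c *\<^sub>R \<phi> x" .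
  qed
  then obtain d where d: "d \<in> L" and \<phi>d: "\<And>x. x \<in> L \<Longrightarrow> \<phi> x = killing d x"
    using semisimple_functional[OF ss] by blast
  have inner: "D y = br d y" if y: "y \<in> L" for y
  proof -
    have "D y - br d y = 0"
    proof (rule semisimple_killing_nondegenerate[OF ss])
      show "D y - br d y \<in> L" using subspace_diff[OF subspace_L] DL closed d y by blast
      fix z assume z: "z \<in> L"
      have "killing (D y) z = trace_on (\<lambda>v. br z (br (D y) v))"
        unfolding killing_def using linear_right br_image DL y z by (intro trace_on_commute) auto
      \<comment> \<open>The Leibniz rule in operator form: ad (D y) = [D, ad y].\<close>
      also have "\<dots> = trace_on (\<lambda>v. br z (D (br y v) - br y (D v)))"
        by (rule trace_on_cong) (simp add: der[OF y])
      also have "\<dots> = - \<phi> (br z y)"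
      proof -
        have "\<phi> (br z y) = trace_on (\<lambda>v. br z (br y (D v) - D (br y v)))"
          unfolding \<phi>_def by (rule trace_ad_bracket[OF z y D])
        also have "\<dots> = trace_on (\<lambda>v. (- 1) *\<^sub>R br z (D (br y v) - br y (D v)))"
        proof (rule trace_on_cong)
          fix v assume v: "v \<in> L"
          have "br z ((- 1) *\<^sub>R (D (br y v) - br y (D v))) = (- 1) *\<^sub>R br z (D (br y v) - br y (D v))"
            by (rule scale_right[OF _ z]) (use subspace_diff[OF subspace_L] DL closed y v in blast)
          then show "br z (br y (D v) - D (br y v)) = (- 1) *\<^sub>R br z (D (br y v) - br y (D v))" by simp
        qed
        also have "\<dots> = (- 1) * trace_on (\<lambda>v. br z (D (br y v) - br y (D v)))"
          using subspace_diff[OF subspace_L] DL closed y z by (intro trace_on_scale) auto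
        finally show ?thesis by simp
      qed
      also have "\<dots> = killing d (br y z)"
        using \<phi>d[OF closed[OF z y]] antisym[OF z y] linear_onD(2)[OF killing_linear[OF d], of "br y z" "- 1"]
          killing_sym[OF d] closed[OF y z] closed[OF z y] by simp
      also have "\<dots> = killing (br d y) z" using killing_invariant[OF d y z] by simp
      finally have e: "killing (D y) z = killing (br d y) z" .
      have "killing (D y + (- 1) *\<^sub>R br d y) z = killing (D y) z + (- 1) * killing (br d y) z"
        using linear_onD[OF killing_linear[OF z]] DL[OF y] closed[OF d y] subspace_neg[OF subspace_L, of "br d y"]
        by (metis real_scaleR_def scaleR_minus1_left)
      then show "killing (D y - br d y) z = 0" using e by simp
    qed
    then show ?thesis by simp
  qed
  define \<psi> where "\<psi> x = trace_on (br x)" for x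
  have "linear_on L \<psi>"
  proof (rule linear_onI)
    fix x y assume m: "x \<in> L" "y \<in> L"
    have "\<psi> (x + y) = trace_on (\<lambda>v. br x v + br y v)"
      unfolding \<psi>_def using m by (intro trace_on_cong add_left)
    also have "\<dots> = \<psi> x + \<psi> y" unfolding \<psi>_def using trace_on_add[OF br_image[OF m(1)] br_image[OF m(2)]] .
    finally show "\<psi> (x + y) = \<psi> x + \<psi> y" .
  next
    fix x c assume m: "x \<in> L"
    have "\<psi> (c *\<^sub>R x) = trace_on (\<lambda>v. c *\<^sub>R br x v)"
      unfolding \<psi>_def using m by (intro trace_on_cong scale_left)
    also have "\<dots> = c *\<^sub>R \<psi> x" unfolding \<psi>_def real_scaleR_def using trace_on_scale[OF br_image[OF m]] .
    finally show "\<psi> (c *\<^sub>R x) = c *\<^sub>R \<psi> x" .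
  qed
  moreover have "\<psi> (br x y) = 0" if m: "x \<in> L" "y \<in> L" for x y
  proof -
    have "\<psi> (br x y) = trace_on (\<lambda>v. br x (br y v - br y v))"
      using trace_ad_bracket[OF m, of "\<lambda>v. v"] by (simp add: \<psi>_def linear_on_def)
    also have "\<dots> = 0" using m linear_onD(2)[OF coef_linear zero_mem, of 0] by (simp add: trace_on_def)
    finally show ?thesis .
  qed
  ultimately have "\<psi> d = 0" using semisimple_functional_eq_0[OF ss] d by blast
  then show ?thesis using trace_on_cong[of D "br d"] inner by (simp add: \<psi>_def)
qed

end


section \<open>Conformal actions on an orthogonal complement\<close>

lemma linear_on_subset: "linear_on G T \<Longrightarrow> L \<subseteq> G \<Longrightarrow> linear_on L T"
  by (simp add: linear_on_def subset_iff)

text \<open>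
  On a space of dimension at most two, the alternating form \<open>b (C X) Y\<close> of a skew operator \<open>C\<close> is
  determined by one number, so any two skew operators are proportional.
\<close>

lemma skew_operators_commute:
  fixes b :: "'v::real_vector \<Rightarrow> 'v \<Rightarrow> real"
  assumes m: "subspace m" and b: "\<And>y. y \<in> m \<Longrightarrow> linear_on m (\<lambda>x. b x y)"
    and sym: "\<And>x y. x \<in> m \<Longrightarrow> y \<in> m \<Longrightarrow> b x y = b y x"
    and nondeg: "\<And>x. x \<in> m \<Longrightarrow> (\<And>y. y \<in> m \<Longrightarrow> b x y = 0) \<Longrightarrow> x = 0"
    and xy: "x \<in> m" "y \<in> m" and span: "\<And>w. w \<in> m \<Longrightarrow> \<exists>\<alpha> \<beta>. w = \<alpha> *\<^sub>R x + \<beta> *\<^sub>R y"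
    and A: "linear_on m A" "A ` m \<subseteq> m" "\<And>X Y. X \<in> m \<Longrightarrow> Y \<in> m \<Longrightarrow> b (A X) Y + b X (A Y) = 0"
    and B: "linear_on m B" "B ` m \<subseteq> m" "\<And>X Y. X \<in> m \<Longrightarrow> Y \<in> m \<Longrightarrow> b (B X) Y + b X (B Y) = 0"
    and X: "X \<in> m"
  shows "A (B X) = B (A X)"
proof -
  note add = subspace_add[OF m] and scale = subspace_scale[OF m]
  have b2: "b w (u + v) = b w u + b w v" "b w (c *\<^sub>R u) = c * b w u" if "w \<in> m" "u \<in> m" "v \<in> m" for w u v c
    using that linear_onD[OF b[OF that(1)]] sym add scale by auto
  have b1: "b (u + v) w = b u w + b v w" "b (c *\<^sub>R u) w = c * b u w" if "w \<in> m" "u \<in> m" "v \<in> m" for w u v c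
    using that linear_onD[OF b[OF that(1)]] by auto
  \<comment> \<open>The form b (C X) Y is alternating, so on combinations of x and y it is a
    multiple of its value at (x, y). If that value is 0, nondegeneracy gives C = 0.\<close>
  have zero: "C X = 0"
    if C: "linear_on m C" "C ` m \<subseteq> m" "\<And>X Y. X \<in> m \<Longrightarrow> Y \<in> m \<Longrightarrow> b (C X) Y + b X (C Y) = 0"
      and xy0: "b (C x) y = 0" and X: "X \<in> m" for C X
  proof (rule nondeg)
    have Cm: "C v \<in> m" if "v \<in> m" for v using C(2) that by auto
    show "C X \<in> m" using Cm X .
    fix Y assume Y: "Y \<in> m"
    have xx: "b (C x) x = 0" and yy: "b (C y) y = 0" and yx: "b (C y) x = 0"
      using C(3)[OF xy(1,1)] C(3)[OF xy(2,2)] C(3)[OF xy(2,1)] sym Cm xy xy0 by auto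
    obtain p q r s where X': "X = p *\<^sub>R x + q *\<^sub>R y" and Y': "Y = r *\<^sub>R x + s *\<^sub>R y"
      using span[OF X] span[OF Y] by blast
    have "C X = p *\<^sub>R C x + q *\<^sub>R C y"
      unfolding X' using linear_onD[OF C(1)] xy scale by simp
    then show "b (C X) Y = 0"
      unfolding Y' using xx yy yx xy0 xy Cm by (simp add: b1 b2 scale add)
  qed
  have mem: "A v \<in> m" "B v \<in> m" if "v \<in> m" for v using A(2) B(2) that by auto
  define s where "s = b (A x) y"
  define t where "t = b (B x) y"
  show ?thesis
  proof (cases "s = 0")
    case True
    then have "A v = 0" if "v \<in> m" for v using zero[OF A _ that] by (simp add: s_def)
    moreover have "B 0 = 0" using linear_onD(2)[OF B(1) subspace_0[OF m], of 0] by simp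
    ultimately show ?thesis using X mem by simp
  next
    case False
    \<comment> \<open>The value of this combination at (x, y) is t s - s t = 0.\<close>
    have "t *\<^sub>R A v + (- s) *\<^sub>R B v = 0" if v: "v \<in> m" for v
    proof (rule zero[of "\<lambda>v. t *\<^sub>R A v + (- s) *\<^sub>R B v", OF _ _ _ _ v])
      show "linear_on m (\<lambda>v. t *\<^sub>R A v + (- s) *\<^sub>R B v)"
        using linear_onD[OF A(1)] linear_onD[OF B(1)] by (intro linear_onI) (simp_all add: algebra_simps)
      show "(\<lambda>v. t *\<^sub>R A v + (- s) *\<^sub>R B v) ` m \<subseteq> m"
        using mem add scale by blast
      show "b (t *\<^sub>R A x + (- s) *\<^sub>R B x) y = 0"
        using b1 xy mem scale by (simp add: s_def t_def del: scaleR_minus_left)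
      fix X Y assume XY: "X \<in> m" "Y \<in> m"
      have "b (t *\<^sub>R A X + (- s) *\<^sub>R B X) Y + b X (t *\<^sub>R A Y + (- s) *\<^sub>R B Y)
        = t * (b (A X) Y + b X (A Y)) + (- s) * (b (B X) Y + b X (B Y))"
        using b1 b2 XY mem scale by (simp add: distrib_left del: scaleR_minus_left)
      then show "b (t *\<^sub>R A X + (- s) *\<^sub>R B X) Y + b X (t *\<^sub>R A Y + (- s) *\<^sub>R B Y) = 0"
        using A(3)[OF XY] B(3)[OF XY] by simp
    qed
    then have "s *\<^sub>R B v = t *\<^sub>R A v" if "v \<in> m" for v using that by simp
    then have Bv: "B v = (t / s) *\<^sub>R A v" if "v \<in> m" for v
      using that False by (metis (no_types, lifting) divide_inverse_commute inverse_eq_divide scaleR_scaleR left_inverse scaleR_one)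
    show ?thesis using Bv X mem linear_onD(2)[OF A(1)] by simp
  qed
qed

context fin_lie_alg
begin

text \<open>The algebraic core, with \<open>L\<close> for \<kk> and \<open>G\<close> for the ambient
  Lie algebra; conformality enters only as \<open>conf\<close>, with factor \<omega>. As
  \<open>e\<close> is orthonormal, the sum is the trace of ad X on \<open>L\<close> once ad X is
  known to preserve \<open>L\<close>.\<close>

theorem conformal_complement_trace_eq_0:
  fixes b :: "'v \<Rightarrow> 'v \<Rightarrow> real"
  assumes G: "lie_alg G br" and LG: "L \<subseteq> G" and ss: "semisimple br L"
    and b: "\<And>y. y \<in> G \<Longrightarrow> linear_on G (\<lambda>x. b x y)"
    and sym: "\<And>x y. x \<in> G \<Longrightarrow> y \<in> G \<Longrightarrow> b x y = b y x"
    and nondeg: "\<And>x. x \<in> G \<Longrightarrow> (\<And>y. y \<in> G \<Longrightarrow> b x y = 0) \<Longrightarrow> x = 0"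
    and ortho: "\<And>i j. i < n \<Longrightarrow> j < n \<Longrightarrow> b (e i) (e j) = (if i = j then \<epsilon> i else 0)"
    and eps: "\<And>i. i < n \<Longrightarrow> \<epsilon> i * \<epsilon> i = 1"
    and xy: "x \<in> G" "y \<in> G" and span: "G \<subseteq> span (insert x (insert y (e ` {..<n})))"
    and conf: "\<And>Z X Y. Z \<in> L \<Longrightarrow> X \<in> m \<Longrightarrow> Y \<in> m \<Longrightarrow> b (br Z X) Y + b X (br Z Y) = \<omega> Z * b X Y"
    and m_def: "m = {X\<in>G. \<forall>Z\<in>L. b Z X = 0}"
    and X: "X \<in> m"
  shows "(\<Sum>i<n. \<epsilon> i * b (br X (e i)) (e i)) = 0"
proof -
  interpret G: lie_alg G br by (rule G)
  note add = subspace_add[OF G.subspace_L] and scale = subspace_scale[OF G.subspace_L]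
    and diff = subspace_diff[OF G.subspace_L]
  have eG: "e i \<in> G" if "i < n" for i using e_mem[OF that] LG by blast
  have b1: "b (u + v) w = b u w + b v w" "b (c *\<^sub>R u) w = c * b u w" "b (u - v) w = b u w - b v w"
    if "w \<in> G" "u \<in> G" "v \<in> G" for w u v c
    using that linear_onD[OF b[OF that(1)]] linear_onD(1)[OF b[OF that(1)], of "u - v" v] diff by auto
  have b2: "b w (u + v) = b w u + b w v" "b w (c *\<^sub>R u) = c * b w u" "b w (u - v) = b w u - b w v"
    if "w \<in> G" "u \<in> G" "v \<in> G" for w u v c
    using that b1[OF that] sym add scale diff by auto
  have bcoef: "b w (e j) = coef w j * \<epsilon> j" if w: "w \<in> L" and j: "j < n" for w j
  proof -
    have "linear_on L (\<lambda>x. b x (e j))" by (rule linear_on_subset[OF b[OF eG[OF j]] LG])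
    from linear_on_expand[OF this w] show ?thesis
      using ortho j by (simp add: mult_delta_right if_distrib cong: if_cong)
  qed
  \<comment> \<open>The orthogonal projection onto \<open>L\<close> in the orthonormal basis;
    \<open>H\<close> below projects onto \<open>m\<close>.\<close>
  define V where "V w = (\<Sum>i<n. (\<epsilon> i * b w (e i)) *\<^sub>R e i)" for w
  define H where "H w = w - V w" for w
  have VL: "V w \<in> L" for w
    unfolding V_def by (intro subspace_sum[OF subspace_L] subspace_scale[OF subspace_L] e_mem) auto
  have VG: "V w \<in> G" for w using VL LG by blast
  have HG: "H w \<in> G" if "w \<in> G" for w unfolding H_def using diff[OF that VG] .
  have Vlin: "linear_on G V"
    by (rule linear_onI) (simp_all add: V_def linear_onD[OF b[OF eG]] algebra_simps sum.distrib scaleR_sum_right)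
  then have Hlin: "linear_on G H"
    by (auto simp: linear_on_def H_def algebra_simps)
  have Hd: "H (u + v) = H u + H v" "H (c *\<^sub>R u) = c *\<^sub>R H u" if "u \<in> G" "v \<in> G" for u v c
    using that linear_onD[OF Hlin] by auto
  have HL: "H w = 0" if w: "w \<in> L" for w
  proof -
    have "\<epsilon> i * b w (e i) = coef w i" if "i < n" for i
      using bcoef[OF w that] eps[OF that] by (simp add: mult.left_commute)
    then show ?thesis using expand[OF w] by (simp add: H_def V_def)
  qed
  have He: "b (H w) (e j) = 0" if w: "w \<in> G" and j: "j < n" for w j
  proof -
    have "b (V w) (e j) = coef (V w) j * \<epsilon> j" by (rule bcoef[OF VL j])
    also have "\<dots> = b w (e j)"
      using coef_sum[OF j, of "\<lambda>i. \<epsilon> i * b w (e i)"] eps[OF j] by (simp add: V_def mult.commute mult.left_commute)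
    finally show ?thesis using b1(3)[OF eG[OF j] w VG] by (simp add: H_def)
  qed
  have Hm: "H w \<in> m" if w: "w \<in> G" for w
    unfolding m_def
  proof (intro CollectI conjI ballI)
    show "H w \<in> G" using HG[OF w] .
    fix Z assume Z: "Z \<in> L"
    have "linear_on L (\<lambda>x. b x (H w))" by (rule linear_on_subset[OF b[OF HG[OF w]] LG])
    from linear_on_expand[OF this Z] show "b Z (H w) = 0"
      using He[OF w] sym[OF HG[OF w] eG] by simp
  qed
  have mG: "m \<subseteq> G" by (auto simp: m_def)
  have m_sub: "subspace m"
  proof (rule subspaceI)
    have "b Z 0 = 0" if "Z \<in> L" for Z using b2(2)[of Z 0 0 0] that LG G.zero_mem by auto
    then show "0 \<in> m" by (simp add: m_def G.zero_mem)
    fix u v c assume u: "u \<in> m"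
    have LGD: "Z \<in> G" if "Z \<in> L" for Z using that LG by blast
    show "c *\<^sub>R u \<in> m" using u b2(2)[OF LGD _ G.zero_mem] scale by (simp add: m_def)
    assume v: "v \<in> m"
    show "u + v \<in> m" using u v b2(1)[OF LGD] add by (simp add: m_def)
  qed
  have Hid: "H w = w" if "w \<in> m" for w
  proof -
    have "b w (e i) = 0" if "i < n" for i
      using \<open>w \<in> m\<close> sym[of w "e i"] eG[OF that] e_mem[OF that] by (simp add: m_def)
    then show ?thesis by (simp add: H_def V_def)
  qed
  have bH: "b (H w) Y = b w Y" if w: "w \<in> G" and Y: "Y \<in> m" for w Y
    using b1(3)[of Y w "V w"] w Y VG VL by (simp add: H_def m_def)
  have bH': "b Y (H w) = b Y w" if w: "w \<in> G" and Y: "Y \<in> m" for w Y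
    using bH[OF that] sym w Y HG mG by auto
  have m_nondeg: "w = 0" if w: "w \<in> m" and 0: "\<And>Y. Y \<in> m \<Longrightarrow> b w Y = 0" for w
  proof (rule nondeg)
    show "w \<in> G" using w mG by blast
    fix u assume u: "u \<in> G"
    show "b w u = 0" using bH'[OF u w] 0[OF Hm[OF u]] by simp
  qed
  \<comment> \<open>H kills \<open>L\<close> and fixes \<open>m\<close>, so the images of x and y
    under H span \<open>m\<close>.\<close>
  have span_m: "\<exists>\<alpha> \<beta>. w = \<alpha> *\<^sub>R H x + \<beta> *\<^sub>R H y" if w: "w \<in> m" for w
  proof -
    have "w \<in> span (insert x (insert y (e ` {..<n})))" using w mG span by blast
    then obtain \<alpha> \<beta> where "w - \<alpha> *\<^sub>R x - \<beta> *\<^sub>R y \<in> span (e ` {..<n})" by (auto simp: span_insert)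
    then have u: "w - \<alpha> *\<^sub>R x - \<beta> *\<^sub>R y \<in> L" by (simp add: span_e)
    define u where "u = w - \<alpha> *\<^sub>R x - \<beta> *\<^sub>R y"
    have "u \<in> G" "H u = 0" using u LG HL by (auto simp: u_def)
    moreover have "w = u + (\<alpha> *\<^sub>R x + \<beta> *\<^sub>R y)" by (simp add: u_def)
    ultimately have "H w = \<alpha> *\<^sub>R H x + \<beta> *\<^sub>R H y"
      using Hd xy add scale by simp
    then show ?thesis using Hid[OF w] by metis
  qed
  define \<rho> where "\<rho> Z X = H (br Z X)" for Z X
  have \<rho>m: "\<rho> Z X \<in> m" if "Z \<in> L" "X \<in> m" for Z X
    unfolding \<rho>_def using that LG mG by (intro Hm G.closed) auto
  have \<rho>lin: "linear_on m (\<rho> Z)" if Z: "Z \<in> L" for Z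
    unfolding \<rho>_def
    by (rule linear_onI) (use Z LG mG in \<open>auto simp: subset_iff G.add_right G.scale_right Hd G.closed\<close>)
  \<comment> \<open>Subtracting half the conformal factor leaves a skew operator, and scalars do not
    affect commutators.\<close>
  define A where "A Z X = \<rho> Z X - (\<omega> Z / 2) *\<^sub>R X" for Z X
  have Alin: "linear_on m (A Z)" if "Z \<in> L" for Z
    using linear_onD[OF \<rho>lin[OF that]] by (intro linear_onI) (simp_all add: A_def algebra_simps)
  have Am: "A Z X \<in> m" if "Z \<in> L" "X \<in> m" for Z X
    unfolding A_def using \<rho>m that subspace_diff[OF m_sub] subspace_scale[OF m_sub] by blast
  have skew: "b (A Z X) Y + b X (A Z Y) = 0" if Z: "Z \<in> L" and XY: "X \<in> m" "Y \<in> m" for Z X Y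
  proof -
    have g: "X \<in> G" "Y \<in> G" "Z \<in> G" "br Z X \<in> G" "br Z Y \<in> G" "\<rho> Z X \<in> G" "\<rho> Z Y \<in> G"
      using Z XY mG LG \<rho>m by (auto simp: subset_iff intro!: G.closed)
    have "b (A Z X) Y = b (br Z X) Y - \<omega> Z / 2 * b X Y"
      unfolding A_def using b1(3)[OF g(2) g(6) scale[OF g(1)]] b1(2)[OF g(2) g(1) g(1)] bH[OF g(4) XY(2)]
      by (simp add: \<rho>_def)
    moreover have "b X (A Z Y) = b X (br Z Y) - \<omega> Z / 2 * b X Y"
      unfolding A_def using b2(3)[OF g(1) g(7) scale[OF g(2)]] b2(2)[OF g(1) g(2) g(2)] bH'[OF g(5) XY(1)]
      by (simp add: \<rho>_def)
    ultimately show ?thesis using conf[OF Z XY] by simp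
  qed
  have commute: "A Z (A W X) = A W (A Z X)" if "Z \<in> L" "W \<in> L" "X \<in> m" for Z W X
  proof (rule skew_operators_commute[OF m_sub _ _ m_nondeg Hm[OF xy(1)] Hm[OF xy(2)] span_m, where b = b])
    show "linear_on m (\<lambda>x. b x y)" if "y \<in> m" for y
      using b[of y] that mG by (auto simp: linear_on_def subset_iff)
    show "b x y = b y x" if "x \<in> m" "y \<in> m" for x y using sym that mG by blast
  qed (use that Alin Am skew in auto)
  have \<rho>A: "\<rho> Z X = A Z X + (\<omega> Z / 2) *\<^sub>R X" for Z X by (simp add: A_def)
  have \<rho>commute: "\<rho> Z (\<rho> W X) = \<rho> W (\<rho> Z X)" if "Z \<in> L" "W \<in> L" "X \<in> m" for Z W X
  proof -
    have ms: "A Z X \<in> m" "A W X \<in> m" "c *\<^sub>R X \<in> m" for c using that Am subspace_scale[OF m_sub] by auto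
    show ?thesis
      unfolding \<rho>A using linear_onD[OF Alin[OF that(1)]] linear_onD[OF Alin[OF that(2)]] ms that
      by (simp add: commute algebra_simps)
  qed
  \<comment> \<open>\<rho> is a representation: replacing w by H w inside the bracket changes [Z, w]
    by [Z, V w], which lies in the subalgebra \<open>L\<close> and is killed by H.\<close>
  have \<rho>hom: "\<rho> (br Z W) X = \<rho> Z (\<rho> W X) - \<rho> W (\<rho> Z X)" if Z: "Z \<in> L" and W: "W \<in> L" and X: "X \<in> m" for Z W X
  proof -
    have g: "X \<in> G" "Z \<in> G" "W \<in> G" using Z W X LG mG by auto
    have H: "H (br Z w) = H (br Z (H w))" if Z: "Z \<in> L" and w: "w \<in> G" for Z w
    proof -
      have "br Z w = br Z (V w) + br Z (H w)"
        using G.add_right[OF VG HG[OF w], of Z w] Z LG by (auto simp: H_def)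
      then show ?thesis using Hd(1) HL[OF closed[OF Z VL]] G.closed VG HG[OF w] Z LG by auto
    qed
    have "br Z (br W X) = br (br Z W) X + br W (br Z X)" using G.jacobi g by blast
    then have "H (br Z (br W X)) = H (br (br Z W) X) + H (br W (br Z X))"
      using Hd(1)[of "br (br Z W) X" "br W (br Z X)"] g G.closed by simp
    then show ?thesis
      using H[OF Z, of "br W X"] H[OF W, of "br Z X"] g G.closed by (simp add: \<rho>_def)
  qed
  \<comment> \<open>The values of \<rho> commute, so \<rho> vanishes on brackets; perfectness of
    \<open>L\<close> applies to each scalar function Z \<mapsto> b (\<rho> Z X) Y.\<close>
  have \<rho>0: "\<rho> Z X = 0" if Z: "Z \<in> L" for Z
  proof (rule nondeg)
    show "\<rho> Z X \<in> G" using \<rho>m[OF Z X] mG by blast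
    fix Y assume Y: "Y \<in> G"
    show "b (\<rho> Z X) Y = 0"
    proof (rule semisimple_functional_eq_0[OF ss _ _ Z, of "\<lambda>Z. b (\<rho> Z X) Y"])
      have XG: "X \<in> G" using X mG by blast
      show "linear_on L (\<lambda>Z. b (\<rho> Z X) Y)"
      proof (rule linear_onI)
        fix u v c assume u: "u \<in> L"
        have g: "u \<in> G" using u LG by blast
        show "b (\<rho> (c *\<^sub>R u) X) Y = c *\<^sub>R b (\<rho> u X) Y"
          unfolding \<rho>_def using g XG Y by (simp add: G.scale_left Hd(2) G.closed b1(2) HG)
        assume v: "v \<in> L"
        have g2: "v \<in> G" using v LG by blast
        show "b (\<rho> (u + v) X) Y = b (\<rho> u X) Y + b (\<rho> v X) Y"
          unfolding \<rho>_def using g g2 XG Y by (simp add: G.add_left Hd(1) G.closed b1(1) HG)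
      qed
      fix Z W assume ZW: "Z \<in> L" "W \<in> L"
      have "\<rho> (br Z W) X = 0" using \<rho>hom[OF ZW X] \<rho>commute[OF ZW X] by simp
      then show "b (\<rho> (br Z W) X) Y = 0" using b1(2)[OF Y Y Y, of 0] by simp
    qed
  qed
  have XG: "X \<in> G" using X mG by blast
  have XL: "br X Z \<in> L" if Z: "Z \<in> L" for Z
  proof -
    have "br Z X = V (br Z X)" using \<rho>0[OF Z] by (simp add: \<rho>_def H_def)
    then have "br Z X \<in> L" using VL by metis
    moreover have "br X Z = - br Z X" using G.antisym[OF XG, of Z] Z LG by blast
    ultimately show ?thesis using subspace_neg[OF subspace_L] by simp
  qed
  have "trace_on (br X) = 0"
  proof (rule semisimple_derivation_trace_eq_0[OF ss])
    show "linear_on L (br X)" by (rule linear_on_subset[OF G.linear_right[OF XG] LG])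
    show "br X ` L \<subseteq> L" using XL by auto
    show "br X (br u v) = br (br X u) v + br u (br X v)" if "u \<in> L" "v \<in> L" for u v
      using G.jacobi[OF XG, of u v] that LG by blast
  qed
  moreover have "\<epsilon> i * b (br X (e i)) (e i) = coef (br X (e i)) i" if "i < n" for i
    using bcoef[OF XL[OF e_mem[OF that]] that] eps[OF that] by (simp add: mult.left_commute)
  ultimately show ?thesis by (simp add: trace_on_def)
qed

end


section \<open>Differentiation on open subsets of a subspace\<close>

text \<open>The derivatives in \<open>Ck_on\<close> are existentially quantified and determined only
  on \<open>E\<close>. This value along a line does not depend on the choice.\<close>

definition dir_deriv :: "('e::real_normed_vector \<Rightarrow> 'f::real_normed_vector) \<Rightarrow> 'e \<Rightarrow> 'e \<Rightarrow> 'f"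
  where "dir_deriv f v x = vector_derivative (\<lambda>t. f (x + t *\<^sub>R v)) (at 0)"

lemma line_mem_eventually:
  fixes E :: "'e::euclidean_space set"
  assumes E: "subspace E" and S: "openin (top_of_set E) S" and x: "x \<in> S" and v: "v \<in> E"
  shows "\<exists>e>0. \<forall>t. \<bar>t\<bar> < e \<longrightarrow> x + t *\<^sub>R v \<in> S"
proof -
  obtain d where d: "d > 0" "\<And>y. y \<in> E \<Longrightarrow> dist y x < d \<Longrightarrow> y \<in> S"
    using S x unfolding openin_euclidean_subtopology_iff by blast
  have xE: "x \<in> E" using S x openin_imp_subset by blast
  define e where "e = d / (norm v + 1)"
  have e: "e > 0" using d by (simp add: e_def add_nonneg_pos)
  have "x + t *\<^sub>R v \<in> S" if "\<bar>t\<bar> < e" for t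
  proof (rule d(2))
    show "x + t *\<^sub>R v \<in> E" using xE v E by (simp add: subspace_add subspace_scale)
    have "norm (t *\<^sub>R v) \<le> \<bar>t\<bar> * (norm v + 1)" by (simp add: mult_left_mono)
    also have "\<dots> < d" using that by (simp add: e_def add_nonneg_pos pos_less_divide_eq)
    finally show "dist (x + t *\<^sub>R v) x < d" by (simp add: dist_norm)
  qed
  then show ?thesis using e by blast
qed

lemma has_vector_derivative_along_line:
  fixes E :: "'e::euclidean_space set"
  assumes E: "subspace E" and S: "openin (top_of_set E) S" and x: "x \<in> S" and v: "v \<in> E"
    and f: "(f has_derivative A) (at x within S)"
  shows "((\<lambda>t. f (x + t *\<^sub>R v)) has_vector_derivative A v) (at 0)"
proof -
  obtain e where e: "e > 0" "\<And>t. \<bar>t\<bar> < e \<Longrightarrow> x + t *\<^sub>R v \<in> S"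
    using line_mem_eventually[OF assms(1-4)] by blast
  define I where "I = {-e<..<e}"
  have I: "(\<lambda>t. x + t *\<^sub>R v) ` I \<subseteq> S" using e by (auto simp: I_def)
  have "((\<lambda>t. x + t *\<^sub>R v) has_derivative (\<lambda>t. t *\<^sub>R v)) (at 0 within I)"
    by (auto intro!: derivative_eq_intros)
  moreover have "(f has_derivative A) (at (x + 0 *\<^sub>R v) within (\<lambda>t. x + t *\<^sub>R v) ` I)"
    using has_derivative_subset[OF f I] by simp
  ultimately have "((\<lambda>t. f (x + t *\<^sub>R v)) has_derivative (\<lambda>t. A (t *\<^sub>R v))) (at 0 within I)"
    by (rule has_derivative_in_compose)
  moreover have "A (t *\<^sub>R v) = t *\<^sub>R A v" for t
    using linear_scale[OF has_derivative_linear[OF f]] .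
  moreover have "at 0 within I = at 0" using e(1) by (intro at_within_open) (auto simp: I_def)
  ultimately show ?thesis by (simp add: has_vector_derivative_def)
qed

lemma dir_deriv_eq:
  fixes E :: "'e::euclidean_space set"
  assumes "subspace E" "openin (top_of_set E) S" "x \<in> S" "v \<in> E" "(f has_derivative A) (at x within S)"
  shows "dir_deriv f v x = A v"
  unfolding dir_deriv_def using has_vector_derivative_along_line[OF assms] by (rule vector_derivative_at)

lemma dir_deriv_cong:
  fixes E :: "'e::euclidean_space set"
  assumes "subspace E" "openin (top_of_set E) S" "x \<in> S" "v \<in> E" "\<And>y. y \<in> S \<Longrightarrow> f y = g y"
  shows "dir_deriv f v x = dir_deriv g v x"
proof -
  obtain e where e: "e > 0" "\<And>t. \<bar>t\<bar> < e \<Longrightarrow> x + t *\<^sub>R v \<in> S"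
    using line_mem_eventually[OF assms(1-4)] by blast
  have "eventually (\<lambda>t. f (x + t *\<^sub>R v) = g (x + t *\<^sub>R v)) (nhds 0)"
    using e assms(5) by (intro eventually_nhds_metric[THEN iffD2]) (auto simp: dist_real_def)
  then show ?thesis
    unfolding dir_deriv_def using assms(3,5)
    by (intro vector_derivative_cong_eq) (auto elim: eventually_mono)
qed

lemma Ck_on_cong:
  assumes "\<And>x. x \<in> S \<Longrightarrow> f x = g x"
  shows "Ck_on k E S f \<longleftrightarrow> Ck_on k E S g"
proof -
  have "Ck_on k E S h" if ck: "Ck_on k E S f" and eq: "\<And>x. x \<in> S \<Longrightarrow> f x = h x" for f h :: "'a \<Rightarrow> 'b"
  proof (cases k)
    case 0
    then show ?thesis using ck eq continuous_on_cong[of S S f h] by auto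
  next
    case (Suc j)
    then obtain f' where f': "\<forall>x\<in>S. (f has_derivative f' x) (at x within S)" "\<forall>v\<in>E. Ck_on j E S (\<lambda>x. f' x v)"
      using ck by auto
    then have "\<forall>x\<in>S. (h has_derivative f' x) (at x within S)"
      using eq has_derivative_transform[of _ S h f] by auto
    then show ?thesis using Suc f'(2) by auto
  qed
  from this[of f g, OF _ assms] this[of g f, OF _ assms[symmetric]] show ?thesis by (rule iffI)
qed

lemma Ck_on_subset: "Ck_on k E S f \<Longrightarrow> T \<subseteq> S \<Longrightarrow> Ck_on k E T f"
proof (induction k arbitrary: f)
  case 0
  then show ?case using continuous_on_subset by auto
next
  case (Suc k)
  then obtain f' where "\<forall>x\<in>S. (f has_derivative f' x) (at x within S)" "\<forall>v\<in>E. Ck_on k E S (\<lambda>x. f' x v)"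
    by auto
  then have "(\<forall>x\<in>T. (f has_derivative f' x) (at x within T)) \<and> (\<forall>v\<in>E. Ck_on k E T (\<lambda>x. f' x v))"
    using Suc.prems(2) by (auto intro: Suc.IH[OF _ Suc.prems(2)] has_derivative_subset)
  then show ?case unfolding Ck_on.simps(2) by (rule exI[of _ f'])
qed

text \<open>Trades the quantified derivative for directional ones, so that smoothness of derivatives
  becomes a property of definite functions.\<close>

lemma Ck_on_Suc_iff:
  fixes E :: "'e::euclidean_space set"
  assumes "subspace E" "openin (top_of_set E) S"
  shows "Ck_on (Suc k) E S f \<longleftrightarrow>
    (\<forall>x\<in>S. f differentiable (at x within S)) \<and> (\<forall>v\<in>E. Ck_on k E S (dir_deriv f v))" (is "?l \<longleftrightarrow> ?r")
proof
  assume ?l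
  then obtain f' where f': "\<And>x. x \<in> S \<Longrightarrow> (f has_derivative f' x) (at x within S)"
      "\<And>v. v \<in> E \<Longrightarrow> Ck_on k E S (\<lambda>x. f' x v)"
    by auto
  have "Ck_on k E S (dir_deriv f v)" if "v \<in> E" for v
    using f'(2)[OF that] Ck_on_cong[of S "dir_deriv f v" "\<lambda>x. f' x v" k E] dir_deriv_eq[OF assms _ that f'(1)]
    by simp
  then show ?r using f'(1) by (auto simp: differentiable_def)
next
  assume r: ?r
  then obtain f' where f': "\<And>x. x \<in> S \<Longrightarrow> (f has_derivative f' x) (at x within S)"
    unfolding differentiable_def using bchoice[of S "\<lambda>x D. (f has_derivative D) (at x within S)"] by auto
  have "Ck_on k E S (\<lambda>x. f' x v)" if "v \<in> E" for v
    using r that Ck_on_cong[of S "dir_deriv f v" "\<lambda>x. f' x v" k E] dir_deriv_eq[OF assms _ that f'(1)]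
    by simp
  then show ?l using f' by auto
qed

lemma Ck_on_Suc_imp: "Ck_on (Suc k) E S f \<Longrightarrow> Ck_on k E S f"
proof (induction k arbitrary: f)
  case 0
  then show ?case
    by (auto intro: has_derivative_continuous_on)
next
  case (Suc k)
  from Suc.prems obtain f' where f': "\<forall>x\<in>S. (f has_derivative f' x) (at x within S)"
    "\<forall>v\<in>E. Ck_on (Suc k) E S (\<lambda>x. f' x v)" unfolding Ck_on.simps(2)[of "Suc k"] by (elim exE conjE) (rule that)
  then have "(\<forall>x\<in>S. (f has_derivative f' x) (at x within S)) \<and> (\<forall>v\<in>E. Ck_on k E S (\<lambda>x. f' x v))"
    by (auto intro: Suc.IH simp del: Ck_on.simps)
  then show ?case unfolding Ck_on.simps(2) by (rule exI[of _ f'])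
qed

lemma Ck_on_le: "Ck_on k E S f \<Longrightarrow> j \<le> k \<Longrightarrow> Ck_on j E S f"
  by (induction k arbitrary: j) (auto simp: le_Suc_eq simp del: Ck_on.simps intro: Ck_on_Suc_imp)

lemma Ck_on_imp_differentiable:
  "Ck_on (Suc k) E S f \<Longrightarrow> x \<in> S \<Longrightarrow> f differentiable (at x within S)"
  by (auto simp: differentiable_def)

lemma Ck_on_imp_continuous: "Ck_on k E S f \<Longrightarrow> continuous_on S f"
  using Ck_on_le[of k E S f 0] by simp

text \<open>Near x the relatively open sets T and S coincide, so the filters
  \<open>at x within T\<close> and \<open>at x within S\<close> are equal.\<close>

lemma Ck_on_local:
  fixes E :: "'e::euclidean_space set"
  assumes E: "subspace E" and S: "openin (top_of_set E) S"
    and loc: "\<And>x. x \<in> S \<Longrightarrow> \<exists>T. openin (top_of_set E) T \<and> x \<in> T \<and> T \<subseteq> S \<and> Ck_on k E T f"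
  shows "Ck_on k E S f"
  using loc
proof (induction k arbitrary: f)
  case 0
  have "continuous (at x within S) f" if x: "x \<in> S" for x
  proof -
    obtain T where T: "openin (top_of_set E) T" "x \<in> T" "T \<subseteq> S" "continuous_on T f" using 0[OF x] by auto
    obtain U where U: "open U" "T = E \<inter> U" using T(1) openin_open by blast
    have "at x within T = at x within S"
      using openin_imp_subset[OF S] T U by (intro at_within_nhd[of _ U]) auto
    then show ?thesis using T(2,4) by (metis continuous_on_eq_continuous_within)
  qed
  then show ?case by (simp add: continuous_on_eq_continuous_within)
next
  case (Suc k)
  have "f differentiable (at x within S)" if x: "x \<in> S" for x
  proof -
    obtain T where T: "openin (top_of_set E) T" "x \<in> T" "T \<subseteq> S" "Ck_on (Suc k) E T f" using Suc.prems[OF x] by auto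
    obtain U where U: "open U" "T = E \<inter> U" using T(1) openin_open by blast
    have "at x within T = at x within S"
      using openin_imp_subset[OF S] T U by (intro at_within_nhd[of _ U]) auto
    then show ?thesis using Ck_on_imp_differentiable[OF T(4,2)] by simp
  qed
  moreover have "Ck_on k E S (dir_deriv f v)" if v: "v \<in> E" for v
  proof (rule Suc.IH)
    fix x assume "x \<in> S"
    then obtain T where T: "openin (top_of_set E) T" "x \<in> T" "T \<subseteq> S" "Ck_on (Suc k) E T f"
      using Suc.prems[of x] by blast
    then have "Ck_on k E T (dir_deriv f v)" using Ck_on_Suc_iff[OF E T(1), of k f] v by simp
    then show "\<exists>T. openin (top_of_set E) T \<and> x \<in> T \<and> T \<subseteq> S \<and> Ck_on k E T (dir_deriv f v)"
      using T by blast
  qed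
  ultimately show ?case using Ck_on_Suc_iff[OF E S, of k f] by simp
qed

section \<open>Closure properties of C^k maps\<close>

lemma Ck_on_const:
  fixes c :: "'b::real_normed_vector"
  shows "Ck_on k E S (\<lambda>x. c)"
proof (induction k arbitrary: c)
  case (Suc k)
  have "(\<forall>x\<in>S. ((\<lambda>x. c) has_derivative (\<lambda>v. 0)) (at x within S)) \<and> (\<forall>v\<in>E. Ck_on k E S (\<lambda>x. 0::'b))"
    using Suc by auto
  then show ?case unfolding Ck_on.simps(2) by (rule exI[of _ "\<lambda>x v. 0"])
qed simp

lemma Ck_on_bounded_linear:
  assumes "bounded_linear f"
  shows "Ck_on k E S f"
proof (cases k)
  case (Suc j)
  have "(\<forall>x\<in>S. (f has_derivative f) (at x within S)) \<and> (\<forall>v\<in>E. Ck_on j E S (\<lambda>x. f v))"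
    using bounded_linear_imp_has_derivative[OF assms] Ck_on_const by auto
  then show ?thesis unfolding Suc Ck_on.simps(2) by (rule exI[of _ "\<lambda>x. f"])
qed (simp add: linear_continuous_on[OF assms])

lemma Ck_on_linear_comp: "bounded_linear L \<Longrightarrow> Ck_on k E S f \<Longrightarrow> Ck_on k E S (\<lambda>x. L (f x))"
proof (induction k arbitrary: f)
  case 0
  then show ?case by (auto intro: bounded_linear.continuous_on)
next
  case (Suc k)
  then obtain f' where f': "\<forall>x\<in>S. (f has_derivative f' x) (at x within S)" "\<forall>v\<in>E. Ck_on k E S (\<lambda>x. f' x v)"
    by auto
  have "(\<forall>x\<in>S. ((\<lambda>x. L (f x)) has_derivative (\<lambda>v. L (f' x v))) (at x within S)) \<and> (\<forall>v\<in>E. Ck_on k E S (\<lambda>x. L (f' x v)))"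
    using f' Suc by (auto intro: bounded_linear.has_derivative)
  then show ?case by auto
qed

lemma Ck_on_add: "Ck_on k E S f \<Longrightarrow> Ck_on k E S g \<Longrightarrow> Ck_on k E S (\<lambda>x. f x + g x)"
proof (induction k arbitrary: f g)
  case 0
  then show ?case by (auto intro: continuous_on_add)
next
  case (Suc k)
  then obtain f' g' where f': "\<forall>x\<in>S. (f has_derivative f' x) (at x within S)" "\<forall>v\<in>E. Ck_on k E S (\<lambda>x. f' x v)"
    and g': "\<forall>x\<in>S. (g has_derivative g' x) (at x within S)" "\<forall>v\<in>E. Ck_on k E S (\<lambda>x. g' x v)"
    by auto
  have "(\<forall>x\<in>S. ((\<lambda>x. f x + g x) has_derivative (\<lambda>v. f' x v + g' x v)) (at x within S)) \<and> (\<forall>v\<in>E. Ck_on k E S (\<lambda>x. f' x v + g' x v))"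
    using f' g' Suc.IH by (auto intro: has_derivative_add)
  then show ?case by auto
qed

lemma Ck_on_bilinear:
  assumes bl: "bounded_bilinear B"
  shows "Ck_on k E S f \<Longrightarrow> Ck_on k E S g \<Longrightarrow> Ck_on k E S (\<lambda>x. B (f x) (g x))"
proof (induction k arbitrary: f g)
  case 0
  then show ?case using bounded_bilinear.continuous_on[OF bl] by auto
next
  case (Suc k)
  then obtain f' g' where f': "\<forall>x\<in>S. (f has_derivative f' x) (at x within S)" "\<forall>v\<in>E. Ck_on k E S (\<lambda>x. f' x v)"
    and g': "\<forall>x\<in>S. (g has_derivative g' x) (at x within S)" "\<forall>v\<in>E. Ck_on k E S (\<lambda>x. g' x v)"
    unfolding Ck_on.simps(2) by (elim exE conjE) (rule that)
  have fg: "Ck_on k E S f" "Ck_on k E S g" using Ck_on_Suc_imp[OF Suc.prems(1)] Ck_on_Suc_imp[OF Suc.prems(2)] .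
  have "(\<forall>x\<in>S. ((\<lambda>x. B (f x) (g x)) has_derivative (\<lambda>v. B (f x) (g' x v) + B (f' x v) (g x))) (at x within S)) \<and>
    (\<forall>v\<in>E. Ck_on k E S (\<lambda>x. B (f x) (g' x v) + B (f' x v) (g x)))"
  proof (intro conjI ballI)
    show "((\<lambda>x. B (f x) (g x)) has_derivative (\<lambda>v. B (f x) (g' x v) + B (f' x v) (g x))) (at x within S)"
      if "x \<in> S" for x
      using f'(1) g'(1) that by (intro bounded_bilinear.FDERIV[OF bl]) auto
    show "Ck_on k E S (\<lambda>x. B (f x) (g' x v) + B (f' x v) (g x))" if "v \<in> E" for v
      using f'(2) g'(2) that by (intro Ck_on_add Suc.IH fg) auto
  qed
  then show ?case
    unfolding Ck_on.simps(2) by (rule exI[of _ "\<lambda>x v. B (f x) (g' x v) + B (f' x v) (g x)"])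
qed

lemmas Ck_on_mult = Ck_on_bilinear[OF bounded_bilinear_mult]

lemma Ck_on_sum: "(\<And>i. i \<in> I \<Longrightarrow> Ck_on k E S (f i)) \<Longrightarrow> Ck_on k E S (\<lambda>x. \<Sum>i\<in>I. f i x)"
  by (induction I rule: infinite_finite_induct) (auto intro: Ck_on_const Ck_on_add)

lemma subspace_orthonormal_basis:
  fixes F :: "'f::euclidean_space set"
  assumes "subspace F"
  shows "\<exists>B. finite B \<and> B \<subseteq> F \<and> card B = dim F \<and> independent B \<and> span B = F \<and>
    (\<forall>w\<in>F. (\<Sum>b\<in>B. (w \<bullet> b) *\<^sub>R b) = w) \<and> (\<forall>b\<in>B. \<forall>c\<in>B. b \<bullet> c = (if b = c then 1 else 0))"
proof (rule orthonormal_basis_subspace[OF assms])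
  fix B assume B: "B \<subseteq> F" "pairwise orthogonal B" "\<And>x. x \<in> B \<Longrightarrow> norm x = 1"
    "independent B" "card B = dim F" "span B = F"
  have fin: "finite B" using B(4) independent_imp_finite by blast
  have on: "b \<bullet> c = (if b = c then 1 else 0)" if "b \<in> B" "c \<in> B" for b c
    using that B(2,3) by (auto simp: pairwise_def real_inner_class.orthogonal_def norm_eq_1)
  have "(\<Sum>b\<in>B. (w \<bullet> b) *\<^sub>R b) = w" if "w \<in> F" for w
  proof -
    obtain u where u: "w = (\<Sum>b\<in>B. u b *\<^sub>R b)" using \<open>w \<in> F\<close> B(6) span_finite[OF fin] by auto
    have "w \<bullet> c = u c" if "c \<in> B" for c
    proof -
      have "w \<bullet> c = (\<Sum>b\<in>B. if b = c then u c else 0)"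
        unfolding u inner_sum_left by (intro sum.cong refl) (use on that in auto)
      then show ?thesis using fin that by simp
    qed
    then show ?thesis using u by simp
  qed
  then show ?thesis using fin B(1,4-6) on by (intro exI[of _ B] conjI ballI)
qed

text \<open>A v is a limit of difference quotients of g, which lie in the closed set
  \<open>F\<close>.\<close>

lemma derivative_mem_subspace:
  fixes E :: "'e::euclidean_space set" and F :: "'f::euclidean_space set"
  assumes "subspace E" "openin (top_of_set E) S" "x \<in> S" "v \<in> E" "(g has_derivative A) (at x within S)"
    and F: "subspace F" and gF: "g ` S \<subseteq> F"
  shows "A v \<in> F"
proof -
  obtain e where e: "e > 0" "\<And>t. \<bar>t\<bar> < e \<Longrightarrow> x + t *\<^sub>R v \<in> S"
    using line_mem_eventually[OF assms(1-4)] by blast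
  have "((\<lambda>t. norm (g (x + t *\<^sub>R v) - g x - t *\<^sub>R A v) / norm t) \<longlongrightarrow> 0) (at 0)"
    using has_vector_derivative_along_line[OF assms(1-5)]
    by (simp add: has_vector_derivative_def has_derivative_iff_norm)
  moreover have "eventually (\<lambda>t. norm (g (x + t *\<^sub>R v) - g x - t *\<^sub>R A v) / norm t
      = norm ((g (x + t *\<^sub>R v) - g x) /\<^sub>R t - A v)) (at 0)"
  proof (rule eventually_at_filter[THEN iffD2], rule always_eventually, intro allI impI)
    fix t :: real assume t: "t \<noteq> 0"
    have "(g (x + t *\<^sub>R v) - g x) /\<^sub>R t - A v = (g (x + t *\<^sub>R v) - g x - t *\<^sub>R A v) /\<^sub>R t"
      using t by (simp add: scaleR_diff_right)
    then show "norm (g (x + t *\<^sub>R v) - g x - t *\<^sub>R A v) / norm t = norm ((g (x + t *\<^sub>R v) - g x) /\<^sub>R t - A v)"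
      by (simp add: divide_inverse_commute)
  qed
  ultimately have "((\<lambda>t. norm ((g (x + t *\<^sub>R v) - g x) /\<^sub>R t - A v)) \<longlongrightarrow> 0) (at 0)"
    by (rule Lim_transform_eventually)
  then have lim: "((\<lambda>t. (g (x + t *\<^sub>R v) - g x) /\<^sub>R t) \<longlongrightarrow> A v) (at 0)"
    by (rule LIM_zero_cancel[OF tendsto_norm_zero_cancel])
  have ev: "eventually (\<lambda>t. (g (x + t *\<^sub>R v) - g x) /\<^sub>R t \<in> F) (at 0)"
    unfolding eventually_at
  proof (intro exI[of _ e] conjI ballI impI)
    fix t :: real assume "t \<noteq> 0 \<and> dist t 0 < e"
    then have "x + t *\<^sub>R v \<in> S" using e by (simp add: dist_real_def)
    then show "(g (x + t *\<^sub>R v) - g x) /\<^sub>R t \<in> F"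
      using gF assms(3) F by (intro subspace_scale subspace_diff) auto
  qed (rule e(1))
  show ?thesis
    by (rule Lim_in_closed_set[OF closed_subspace[OF F] ev _ lim]) simp
qed

text \<open>Induction by the chain rule. \<open>Ck_on\<close> controls f' y w only for a fixed
  direction w in \<open>F\<close>, while the direction g' x v varies with x. Expanding it in an
  orthonormal basis of \<open>F\<close> leaves fixed directions with C^k coefficients.\<close>

lemma Ck_on_compose:
  fixes E :: "'e::euclidean_space set" and F :: "'f::euclidean_space set"
  assumes E: "subspace E" "openin (top_of_set E) S" and F: "subspace F" "openin (top_of_set F) T"
    and gT: "g ` S \<subseteq> T"
  shows "Ck_on k E S g \<Longrightarrow> Ck_on k F T f \<Longrightarrow> Ck_on k E S (\<lambda>x. f (g x))"
proof (induction k arbitrary: f)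
  case 0
  then show ?case using gT continuous_on_compose2[of T f S g] by auto
next
  case (Suc k)
  obtain f' where f': "\<And>y. y \<in> T \<Longrightarrow> (f has_derivative f' y) (at y within T)" "\<And>v. v \<in> F \<Longrightarrow> Ck_on k F T (\<lambda>x. f' x v)"
    using Suc.prems(2) by auto
  obtain g' where g': "\<And>x. x \<in> S \<Longrightarrow> (g has_derivative g' x) (at x within S)" "\<And>v. v \<in> E \<Longrightarrow> Ck_on k E S (\<lambda>x. g' x v)"
    using Suc.prems(1) by auto
  obtain B where B: "finite B" "B \<subseteq> F" "\<forall>w\<in>F. (\<Sum>b\<in>B. (w \<bullet> b) *\<^sub>R b) = w"
    using subspace_orthonormal_basis[OF F(1)] by (elim exE conjE) (rule that)
  have gF: "g ` S \<subseteq> F" using gT openin_imp_subset[OF F(2)] by blast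
  have D: "((\<lambda>x. f (g x)) has_derivative (\<lambda>v. f' (g x) (g' x v))) (at x within S)" if x: "x \<in> S" for x
    using f'(1) gT by (intro has_derivative_in_compose2[OF _ gT x g'(1)[OF x]]) auto
  have "Ck_on k E S (\<lambda>x. f' (g x) (g' x v))" if v: "v \<in> E" for v
  proof -
    have eq: "f' (g x) (g' x v) = (\<Sum>b\<in>B. (g' x v \<bullet> b) *\<^sub>R f' (g x) b)" if x: "x \<in> S" for x
    proof -
      have "g' x v \<in> F" by (rule derivative_mem_subspace[OF E x v g'(1)[OF x] F(1) gF])
      then have "f' (g x) (g' x v) = f' (g x) (\<Sum>b\<in>B. (g' x v \<bullet> b) *\<^sub>R b)" using B(3) by simp
      moreover have "linear (f' (g x))" by (rule has_derivative_linear[OF f'(1)]) (use gT x in auto)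
      ultimately show ?thesis by (simp add: linear_sum linear_scale)
    qed
    have "Ck_on k E S (\<lambda>x. \<Sum>b\<in>B. (g' x v \<bullet> b) *\<^sub>R f' (g x) b)"
    proof (rule Ck_on_sum)
      fix b assume b: "b \<in> B"
      have 1: "Ck_on k E S (\<lambda>x. g' x v \<bullet> b)"
        by (rule Ck_on_linear_comp[OF bounded_linear_inner_left g'(2)[OF v]])
      have 2: "Ck_on k E S (\<lambda>x. f' (g x) b)"
        using b B(2) by (intro Suc.IH Ck_on_Suc_imp[OF Suc.prems(1)] f'(2)) auto
      show "Ck_on k E S (\<lambda>x. (g' x v \<bullet> b) *\<^sub>R f' (g x) b)"
        by (rule Ck_on_bilinear[OF bounded_bilinear_scaleR 1 2])
    qed
    from iffD2[OF Ck_on_cong[OF eq] this] show ?thesis .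
  qed
  then have "(\<forall>x\<in>S. ((\<lambda>x. f (g x)) has_derivative (\<lambda>v. f' (g x) (g' x v))) (at x within S)) \<and>
    (\<forall>v\<in>E. Ck_on k E S (\<lambda>x. f' (g x) (g' x v)))"
    using D by auto
  then show ?case unfolding Ck_on.simps(2) by (rule exI[of _ "\<lambda>x v. f' (g x) (g' x v)"])
qed

text \<open>Increments between points of S stay in \<open>E\<close>, so a derivative within S may be
  altered off \<open>E\<close>.\<close>

lemma has_derivative_within_subspace_cong:
  fixes E :: "'e::euclidean_space set"
  assumes E: "subspace E" "S \<subseteq> E" "x \<in> S" and f: "(f has_derivative A) (at x within S)"
    and B: "bounded_linear B" "\<And>v. v \<in> E \<Longrightarrow> A v = B v"
  shows "(f has_derivative B) (at x within S)"
proof -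
  have "eventually (\<lambda>y. norm (f y - f x - A (y - x)) / norm (y - x) = norm (f y - f x - B (y - x)) / norm (y - x)) (at x within S)"
    unfolding eventually_at_filter
  proof (rule always_eventually, intro allI impI)
    fix y assume "y \<in> S"
    then have "y - x \<in> E" using E by (intro subspace_diff) auto
    then show "norm (f y - f x - A (y - x)) / norm (y - x) = norm (f y - f x - B (y - x)) / norm (y - x)"
      using B(2) by simp
  qed
  moreover have "((\<lambda>y. norm (f y - f x - A (y - x)) / norm (y - x)) \<longlongrightarrow> 0) (at x within S)"
    using f by (simp add: has_derivative_iff_norm)
  ultimately have "((\<lambda>y. norm (f y - f x - B (y - x)) / norm (y - x)) \<longlongrightarrow> 0) (at x within S)"
    by (rule Lim_transform_eventually[rotated])
  then show ?thesis using B(1) by (simp add: has_derivative_iff_norm)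
qed

section \<open>Hadamard's lemma by integration along segments\<close>

lemma segment_mem:
  assumes "convex S" "x0 \<in> S" "x \<in> S" "t \<in> {0..1}"
  shows "x0 + t *\<^sub>R (x - x0) \<in> S"
proof -
  have "(1 - t) *\<^sub>R x0 + t *\<^sub>R x \<in> S" by (rule convexD[OF assms(1-3)]) (use assms(4) in auto)
  moreover have "(1 - t) *\<^sub>R x0 + t *\<^sub>R x = x0 + t *\<^sub>R (x - x0)" by (simp add: algebra_simps)
  ultimately show ?thesis by simp
qed

lemma continuous_on_segments:
  fixes x0 :: "'e::real_normed_vector"
  assumes "convex S" "x0 \<in> S" "continuous_on S g"
  shows "continuous_on (S \<times> cbox 0 (1::real)) (\<lambda>(x, t). g (x0 + t *\<^sub>R (x - x0)))"
proof -
  have "continuous_on (S \<times> cbox 0 (1::real)) (\<lambda>p. x0 + snd p *\<^sub>R (fst p - x0))"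
    by (intro continuous_intros)
  moreover have "(\<lambda>p. x0 + snd p *\<^sub>R (fst p - x0)) ` (S \<times> cbox 0 (1::real)) \<subseteq> S"
    using segment_mem[OF assms(1,2)] by auto
  ultimately show ?thesis
    unfolding case_prod_beta' by (rule continuous_on_compose2[OF assms(3)])
qed

text \<open>The weight t^j lets the induction close: differentiation under the integral in direction
  v replaces t^j by t^(j+1) and f by its derivative along v. The application has j = 0.\<close>

lemma Ck_on_param_integral:
  fixes E :: "'e::euclidean_space set" and f :: "'e \<Rightarrow> real"
  assumes E: "subspace E" and S: "openin (top_of_set E) S" and cv: "convex S" and x0: "x0 \<in> S"
  shows "Ck_on k E S f \<Longrightarrow> Ck_on k E S (\<lambda>x. integral (cbox 0 1) (\<lambda>t. t ^ j * f (x0 + t *\<^sub>R (x - x0))))"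
proof (induction k arbitrary: f j)
  case 0
  then have "continuous_on S f" by simp
  then have "continuous_on (S \<times> cbox 0 1) (\<lambda>(x, t). t ^ j * f (x0 + t *\<^sub>R (x - x0)))"
    using continuous_on_segments[OF cv x0] unfolding case_prod_beta' by (intro continuous_intros) auto
  from integral_continuous_on_param[OF this] show ?case by simp
next
  case (Suc k)
  obtain B where B: "finite B" "B \<subseteq> E" "\<forall>w\<in>E. (\<Sum>b\<in>B. (w \<bullet> b) *\<^sub>R b) = w"
    using subspace_orthonormal_basis[OF E] by (elim exE conjE) (rule that)
  obtain f' where f': "\<And>x. x \<in> S \<Longrightarrow> (f has_derivative f' x) (at x within S)"
    using Suc.prems by auto
  have fC: "continuous_on S f" using Ck_on_imp_continuous[OF Suc.prems] .
  have dC: "Ck_on k E S (dir_deriv f v)" if "v \<in> E" for v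
    using Suc.prems that Ck_on_Suc_iff[OF E S] by blast
  have SE: "S \<subseteq> E" using openin_imp_subset[OF S] .
  let ?p = "\<lambda>x t. x0 + t *\<^sub>R (x - x0)"
  \<comment> \<open>The Leibniz rule for integrals takes the derivative as a bounded operator
    continuous in (x, t). \<open>fx\<close> agrees on \<open>E\<close> with the true derivative and
    is assembled from finitely many directional derivatives.\<close>
  define fx where "fx x t = (\<Sum>b\<in>B. (t ^ Suc j * dir_deriv f b (?p x t)) *\<^sub>R blinfun_inner_right b)" for x and t :: real
  have fxv: "blinfun_apply (fx x t) v = t ^ Suc j * dir_deriv f v (?p x t)"
    if x: "x \<in> S" and t: "t \<in> cbox 0 1" and v: "v \<in> E" for x t v
  proof -
    have p: "?p x t \<in> S" using segment_mem[OF cv x0 x] t by simp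
    have d: "dir_deriv f w (?p x t) = f' (?p x t) w" if "w \<in> E" for w
      by (rule dir_deriv_eq[OF E S p that f'[OF p]])
    have lin: "linear (f' (?p x t))" using has_derivative_linear[OF f'[OF p]] .
    have "f' (?p x t) v = f' (?p x t) (\<Sum>b\<in>B. (v \<bullet> b) *\<^sub>R b)" using B(3) v by simp
    also have "\<dots> = (\<Sum>b\<in>B. (v \<bullet> b) * f' (?p x t) b)" using lin by (simp add: linear_sum linear_scale)
    also have "\<dots> = (\<Sum>b\<in>B. (v \<bullet> b) * dir_deriv f b (?p x t))"
      using d B(2) by (intro sum.cong refl) auto
    finally have fp: "dir_deriv f v (?p x t) = (\<Sum>b\<in>B. (v \<bullet> b) * dir_deriv f b (?p x t))"
      by (simp only: d[OF v])
    show ?thesis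
      unfolding fx_def blinfun.sum_left blinfun.scaleR_left fp sum_distrib_left
      by (intro sum.cong refl) (simp add: inner_commute)
  qed
  have der: "((\<lambda>x. t ^ j * f (?p x t)) has_derivative blinfun_apply (fx x t)) (at x within S)"
    if x: "x \<in> S" and t: "t \<in> cbox 0 1" for x t
  proof (rule has_derivative_within_subspace_cong[OF E SE x _ blinfun.bounded_linear_right])
    have p: "?p x t \<in> S" using segment_mem[OF cv x0 x] t by simp
    have "((\<lambda>x. ?p x t) has_derivative (\<lambda>v. t *\<^sub>R v)) (at x within S)"
      by (auto intro!: derivative_eq_intros)
    moreover have "(f has_derivative f' (?p x t)) (at (?p x t) within (\<lambda>x. ?p x t) ` S)"
      using segment_mem[OF cv x0] t by (intro has_derivative_subset[OF f'[OF p]]) auto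
    ultimately have "((\<lambda>x. f (?p x t)) has_derivative (\<lambda>v. f' (?p x t) (t *\<^sub>R v))) (at x within S)"
      by (rule has_derivative_in_compose)
    then show "((\<lambda>x. t ^ j * f (?p x t)) has_derivative (\<lambda>v. t ^ j * f' (?p x t) (t *\<^sub>R v))) (at x within S)"
      by (rule has_derivative_mult_right)
    fix v assume v: "v \<in> E"
    have "f' (?p x t) (t *\<^sub>R v) = t * dir_deriv f v (?p x t)"
      using linear_scale[OF has_derivative_linear[OF f'[OF p]]] dir_deriv_eq[OF E S p v f'[OF p]] by simp
    then show "t ^ j * f' (?p x t) (t *\<^sub>R v) = blinfun_apply (fx x t) v"
      using fxv[OF x t v] by simp
  qed
  have cont_t: "continuous_on (cbox 0 1) (\<lambda>t. g (?p x t))" if g: "continuous_on S g" and x: "x \<in> S" for g :: "'e \<Rightarrow> real" and x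
  proof -
    have "continuous_on (cbox 0 1) (\<lambda>t::real. ?p x t)" by (intro continuous_intros)
    then show ?thesis
      by (rule continuous_on_compose2[OF g]) (use segment_mem[OF cv x0 x] in auto)
  qed
  have int: "(\<lambda>t. t ^ j * f (?p x t)) integrable_on cbox 0 1" if x: "x \<in> S" for x
    using cont_t[OF fC x] by (intro integrable_continuous continuous_intros)
  have cont_fx: "continuous_on (S \<times> cbox 0 1) (\<lambda>(x, t). fx x t)"
  proof -
    have "continuous_on (S \<times> cbox 0 1) (\<lambda>p. dir_deriv f b (?p (fst p) (snd p)))" if "b \<in> B" for b
    proof -
      have "b \<in> E" using that B(2) by auto
      from continuous_on_segments[OF cv x0 Ck_on_imp_continuous[OF dC[OF this]]]
      show ?thesis unfolding case_prod_beta' .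
    qed
    then show ?thesis unfolding fx_def case_prod_beta' by (intro continuous_intros) auto
  qed
  have fx_int: "fx x integrable_on cbox 0 1" if x: "x \<in> S" for x
  proof -
    have "continuous_on (cbox 0 1) (\<lambda>t. dir_deriv f b (?p x t))" if "b \<in> B" for b
      by (rule cont_t[OF Ck_on_imp_continuous[OF dC] x]) (use that B(2) in auto)
    then show ?thesis
      unfolding fx_def by (intro integrable_continuous continuous_intros)
  qed
  show ?case
    unfolding Ck_on.simps
  proof (intro exI[of _ "\<lambda>x. blinfun_apply (integral (cbox 0 1) (fx x))"] conjI ballI)
    fix x assume x: "x \<in> S"
    show "((\<lambda>x. integral (cbox 0 1) (\<lambda>t. t ^ j * f (?p x t))) has_derivative blinfun_apply (integral (cbox 0 1) (fx x))) (at x within S)"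
      by (rule leibniz_rule[OF der int cont_fx x cv])
  next
    fix v assume v: "v \<in> E"
    have "blinfun_apply (integral (cbox 0 1) (fx x)) v = integral (cbox 0 1) (\<lambda>t. t ^ Suc j * dir_deriv f v (?p x t))"
      if x: "x \<in> S" for x
    proof -
      have "blinfun_apply (integral (cbox 0 1) (fx x)) v = integral (cbox 0 1) (\<lambda>t. blinfun_apply (fx x t) v)"
        by (rule blinfun_apply_integral[OF fx_int[OF x]])
      also have "\<dots> = integral (cbox 0 1) (\<lambda>t. t ^ Suc j * dir_deriv f v (?p x t))"
        by (intro Henstock_Kurzweil_Integration.integral_cong fxv[OF x _ v])
      finally show ?thesis .
    qed
    from iffD2[OF Ck_on_cong[OF this] Suc.IH[OF dC[OF v]]]
    show "Ck_on k E S (\<lambda>x. blinfun_apply (integral (cbox 0 1) (fx x)) v)" .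
  qed
qed

text \<open>Integrate the derivative of t \<mapsto> f (x0 + t (x - x0)) over [0, 1]; the components
  of x - x0 come out of the integral, and \<open>h b\<close> is what remains. At x = x0 the
  integrand is constant in t.\<close>

lemma hadamard:
  fixes E :: "'e::euclidean_space set" and f :: "'e \<Rightarrow> real"
  assumes E: "subspace E" and S: "openin (top_of_set E) S" and cv: "convex S" and x0: "x0 \<in> S"
    and f: "smooth_on E S f" and B: "B \<subseteq> E" "\<forall>w\<in>E. (\<Sum>b\<in>B. (w \<bullet> b) *\<^sub>R b) = w"
  obtains h where "\<And>b. b \<in> B \<Longrightarrow> smooth_on E S (h b)" "\<And>b. b \<in> B \<Longrightarrow> h b x0 = dir_deriv f b x0"
    "\<And>x. x \<in> S \<Longrightarrow> f x = f x0 + (\<Sum>b\<in>B. ((x - x0) \<bullet> b) * h b x)"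
proof
  let ?p = "\<lambda>x t. x0 + t *\<^sub>R (x - x0)"
  define h where "h b x = integral (cbox 0 1) (\<lambda>t. t ^ 0 * dir_deriv f b (?p x t))" for b x
  have dC: "Ck_on k E S (dir_deriv f v)" if "v \<in> E" for v k
    using f that Ck_on_Suc_iff[OF E S, of k f] by (simp add: smooth_on_def del: Ck_on.simps)
  show "smooth_on E S (h b)" if "b \<in> B" for b
    unfolding smooth_on_def h_def
    by (intro allI Ck_on_param_integral[OF E S cv x0] dC) (use that B(1) in auto)
  show "h b x0 = dir_deriv f b x0" if "b \<in> B" for b
    by (simp add: h_def)
  fix x assume x: "x \<in> S"
  have "Ck_on (Suc 0) E S f" using f by (simp add: smooth_on_def del: Ck_on.simps)
  then obtain f' where f': "\<And>x. x \<in> S \<Longrightarrow> (f has_derivative f' x) (at x within S)" by auto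
  have xE: "x - x0 \<in> E" using x x0 openin_imp_subset[OF S] E by (intro subspace_diff) auto
  have p: "?p x t \<in> S" if "t \<in> {0..1}" for t using segment_mem[OF cv x0 x that] .
  have "((\<lambda>t. f (?p x t)) has_vector_derivative (\<Sum>b\<in>B. ((x - x0) \<bullet> b) * dir_deriv f b (?p x t))) (at t within {0..1})"
    if t: "t \<in> {0..1}" for t
  proof -
    have "((\<lambda>t. ?p x t) has_derivative (\<lambda>s. s *\<^sub>R (x - x0))) (at t within {0..1})"
      by (auto intro!: derivative_eq_intros)
    moreover have "(f has_derivative f' (?p x t)) (at (?p x t) within (\<lambda>t. ?p x t) ` {0..1})"
      using p by (intro has_derivative_subset[OF f'[OF p[OF t]]]) auto
    ultimately have d: "((\<lambda>t. f (?p x t)) has_derivative (\<lambda>s. f' (?p x t) (s *\<^sub>R (x - x0)))) (at t within {0..1})"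
      by (rule has_derivative_in_compose)
    have lin: "linear (f' (?p x t))" using has_derivative_linear[OF f'[OF p[OF t]]] .
    have "f' (?p x t) (x - x0) = f' (?p x t) (\<Sum>b\<in>B. ((x - x0) \<bullet> b) *\<^sub>R b)" using B(2) xE by simp
    also have "\<dots> = (\<Sum>b\<in>B. ((x - x0) \<bullet> b) * f' (?p x t) b)" using lin by (simp add: linear_sum linear_scale)
    also have "\<dots> = (\<Sum>b\<in>B. ((x - x0) \<bullet> b) * dir_deriv f b (?p x t))"
      using dir_deriv_eq[OF E S p[OF t] _ f'[OF p[OF t]]] B(1) by (intro sum.cong refl) auto
    finally show ?thesis
      using d lin by (simp add: has_vector_derivative_def linear_scale)
  qed
  from fundamental_theorem_of_calculus[OF _ this]
  have "((\<lambda>t. \<Sum>b\<in>B. ((x - x0) \<bullet> b) * dir_deriv f b (?p x t)) has_integral f (?p x 1) - f (?p x 0)) {0..1}"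
    by simp
  then have "f x - f x0 = integral {0..1} (\<lambda>t. \<Sum>b\<in>B. ((x - x0) \<bullet> b) * dir_deriv f b (?p x t))"
    by (simp add: integral_unique)
  also have "\<dots> = (\<Sum>b\<in>B. ((x - x0) \<bullet> b) * h b x)"
  proof -
    have "continuous_on {0..1} (\<lambda>t. dir_deriv f b (?p x t))" if "b \<in> B" for b
    proof -
      have c: "continuous_on S (dir_deriv f b)" using dC[of b 0] B(1) that by auto
      show ?thesis
      proof (rule continuous_on_compose2[OF c])
        show "continuous_on {0..1} (\<lambda>t. ?p x t)" by (intro continuous_intros)
        show "(\<lambda>t. ?p x t) ` {0..1} \<subseteq> S" by (rule image_subsetI) (rule p)
      qed
    qed
    then have int: "(\<lambda>t. dir_deriv f b (?p x t)) integrable_on {0..1}" if "b \<in> B" for b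
      using that by (intro integrable_continuous_real)
    show ?thesis
    \<comment> \<open>For infinite \<open>B\<close> both sums are 0 by convention.\<close>
    proof (cases "finite B")
      case True
      have "integral {0..1} (\<lambda>t. \<Sum>b\<in>B. ((x - x0) \<bullet> b) * dir_deriv f b (?p x t))
        = (\<Sum>b\<in>B. integral {0..1} (\<lambda>t. ((x - x0) \<bullet> b) * dir_deriv f b (?p x t)))"
        by (rule integral_sum[OF True]) (rule integrable_on_mult_right[OF int])
      then show ?thesis by (simp add: h_def)
    qed simp
  qed
  finally show "f x = f x0 + (\<Sum>b\<in>B. ((x - x0) \<bullet> b) * h b x)" by simp
qed

section \<open>Smooth maps and the rules for directional derivatives\<close>

lemma smooth_on_cong: "(\<And>x. x \<in> S \<Longrightarrow> f x = g x) \<Longrightarrow> smooth_on E S f \<longleftrightarrow> smooth_on E S g"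
  unfolding smooth_on_def by (simp add: Ck_on_cong[of S f g])

lemma smooth_on_subset: "smooth_on E S f \<Longrightarrow> T \<subseteq> S \<Longrightarrow> smooth_on E T f"
  by (simp add: smooth_on_def Ck_on_subset[of _ E S f T])

lemma smooth_on_const: "smooth_on E S (\<lambda>x. c)"
  by (simp add: smooth_on_def Ck_on_const)

lemma smooth_on_bounded_linear: "bounded_linear f \<Longrightarrow> smooth_on E S f"
  by (simp add: smooth_on_def Ck_on_bounded_linear)

lemma smooth_on_add: "smooth_on E S f \<Longrightarrow> smooth_on E S g \<Longrightarrow> smooth_on E S (\<lambda>x. f x + g x)"
  by (simp add: smooth_on_def Ck_on_add)

lemma smooth_on_mult:
  fixes f g :: "'e::euclidean_space \<Rightarrow> real"
  shows "smooth_on E S f \<Longrightarrow> smooth_on E S g \<Longrightarrow> smooth_on E S (\<lambda>x. f x * g x)"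
  by (simp add: smooth_on_def Ck_on_mult)

lemma smooth_on_compose:
  fixes E :: "'e::euclidean_space set" and F :: "'f::euclidean_space set"
  assumes "subspace E" "openin (top_of_set E) S" "subspace F" "openin (top_of_set F) T"
    and "g ` S \<subseteq> T" "smooth_on E S g" "smooth_on F T f"
  shows "smooth_on E S (\<lambda>x. f (g x))"
  using assms(6,7) unfolding smooth_on_def by (auto intro: Ck_on_compose[OF assms(1-5)])

lemma smooth_on_local:
  fixes E :: "'e::euclidean_space set"
  assumes "subspace E" "openin (top_of_set E) S"
    and "\<And>x. x \<in> S \<Longrightarrow> \<exists>T. openin (top_of_set E) T \<and> x \<in> T \<and> T \<subseteq> S \<and> smooth_on E T f"
  shows "smooth_on E S f"
  unfolding smooth_on_def
proof (intro allI Ck_on_local[OF assms(1,2)])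
  fix k x assume "x \<in> S"
  from assms(3)[OF this] obtain T where T: "openin (top_of_set E) T" "x \<in> T" "T \<subseteq> S" "smooth_on E T f"
    by (elim exE conjE) (rule that)
  have "Ck_on k E T f" using T(4) by (simp only: smooth_on_def)
  with T(1-3) show "\<exists>T. openin (top_of_set E) T \<and> x \<in> T \<and> T \<subseteq> S \<and> Ck_on k E T f"
    by (intro exI[of _ T] conjI)
qed

lemma smooth_on_dir_deriv:
  fixes E :: "'e::euclidean_space set"
  assumes "subspace E" "openin (top_of_set E) S" "smooth_on E S f" "v \<in> E"
  shows "smooth_on E S (dir_deriv f v)"
  unfolding smooth_on_def
proof
  fix k
  have "Ck_on (Suc k) E S f" using assms(3) by (simp only: smooth_on_def)
  then show "Ck_on k E S (dir_deriv f v)" using assms(4) Ck_on_Suc_iff[OF assms(1,2), of k f] by simp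
qed

lemma smooth_on_has_derivative:
  assumes "smooth_on E S f" "x \<in> S"
  shows "\<exists>A. (f has_derivative A) (at x within S)"
proof -
  have "Ck_on (Suc 0) E S f" using assms(1) by (simp only: smooth_on_def)
  then show ?thesis using assms(2) by auto
qed

lemma dir_deriv_rules:
  fixes E :: "'e::euclidean_space set" and f g :: "'e \<Rightarrow> real"
  assumes E: "subspace E" and S: "openin (top_of_set E) S" and f: "smooth_on E S f" and g: "smooth_on E S g"
    and x: "x \<in> S" and v: "v \<in> E"
  shows "dir_deriv (\<lambda>x. f x + g x) v x = dir_deriv f v x + dir_deriv g v x"
    and "dir_deriv (\<lambda>x. f x * g x) v x = f x * dir_deriv g v x + g x * dir_deriv f v x"
proof -
  obtain A where A: "(f has_derivative A) (at x within S)" using smooth_on_has_derivative[OF f x] ..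
  obtain B where B: "(g has_derivative B) (at x within S)" using smooth_on_has_derivative[OF g x] ..
  note eq = dir_deriv_eq[OF E S x v]
  show "dir_deriv (\<lambda>x. f x + g x) v x = dir_deriv f v x + dir_deriv g v x"
    using eq[OF has_derivative_add[OF A B]] eq[OF A] eq[OF B] by simp
  show "dir_deriv (\<lambda>x. f x * g x) v x = f x * dir_deriv g v x + g x * dir_deriv f v x"
    using eq[OF has_derivative_mult[OF A B]] eq[OF A] eq[OF B] by simp
qed

lemma dir_deriv_cmult:
  fixes E :: "'e::euclidean_space set" and f :: "'e \<Rightarrow> real"
  assumes E: "subspace E" and S: "openin (top_of_set E) S" and f: "smooth_on E S f" and x: "x \<in> S" and v: "v \<in> E"
  shows "dir_deriv (\<lambda>x. c * f x) v x = c * dir_deriv f v x"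
proof -
  obtain A where A: "(f has_derivative A) (at x within S)" using smooth_on_has_derivative[OF f x] ..
  show ?thesis
    using dir_deriv_eq[OF E S x v has_derivative_mult_right[OF A, of c]] dir_deriv_eq[OF E S x v A] by simp
qed

lemma dir_deriv_linear:
  fixes E :: "'e::euclidean_space set" and f :: "'e \<Rightarrow> real"
  assumes E: "subspace E" and S: "openin (top_of_set E) S" and f: "smooth_on E S f" and x: "x \<in> S"
    and v: "v \<in> E" and w: "w \<in> E"
  shows "dir_deriv f (v + w) x = dir_deriv f v x + dir_deriv f w x" "dir_deriv f (c *\<^sub>R v) x = c * dir_deriv f v x"
proof -
  obtain A where A: "(f has_derivative A) (at x within S)" using smooth_on_has_derivative[OF f x] ..
  have lin: "linear A" using has_derivative_linear[OF A] .
  note eq = dir_deriv_eq[OF E S x _ A]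
  show "dir_deriv f (v + w) x = dir_deriv f v x + dir_deriv f w x"
    using eq[OF v] eq[OF w] eq[OF subspace_add[OF E v w]] lin by (simp add: linear_add)
  show "dir_deriv f (c *\<^sub>R v) x = c * dir_deriv f v x"
    using eq[OF v] eq[OF subspace_scale[OF E v]] lin by (simp add: linear_scale)
qed


section \<open>Tangent vectors and vector fields\<close>

lemma sum_fun_apply: "(sum f A) x = (\<Sum>i\<in>A. f i x)"
  by (induction A rule: infinite_finite_induct) auto

section \<open>Charts, products of charts and smooth maps in charts\<close>

lemma chart_openin: "chart T E (U, \<phi>) \<Longrightarrow> openin T U" "chart T E (U, \<phi>) \<Longrightarrow> openin (top_of_set E) (\<phi> ` U)"
  by (auto simp: chart_def)

lemma chart_inj:
  assumes "chart T E (U, \<phi>)"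
  shows "inj_on \<phi> U"
proof -
  have "homeomorphic_map (subtopology T U) (top_of_set (\<phi> ` U)) \<phi>"
    using assms by (simp add: chart_def)
  then have "inj_on \<phi> (topspace (subtopology T U))" by (rule homeomorphic_imp_injective_map)
  moreover have "topspace (subtopology T U) = U"
    using openin_subset[OF chart_openin(1)[OF assms]] by auto
  ultimately show ?thesis by simp
qed

lemma chart_open_image:
  assumes c: "chart T E (U, \<phi>)" and W: "openin T W"
  shows "openin (top_of_set E) (\<phi> ` (U \<inter> W))"
proof -
  have "open_map (subtopology T U) (top_of_set (\<phi> ` U)) \<phi>"
    using c homeomorphic_imp_open_map by (auto simp: chart_def)
  moreover have "openin (subtopology T U) (U \<inter> W)"
    using W by (rule openin_subtopology_Int2)
  ultimately have "openin (top_of_set (\<phi> ` U)) (\<phi> ` (U \<inter> W))" by (simp add: open_map_def)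
  then show ?thesis using openin_trans chart_openin(2)[OF c] by metis
qed

lemma chart_open_preimage:
  assumes c: "chart T E (U, \<phi>)" and A: "openin (top_of_set E) A"
  shows "openin T {q\<in>U. \<phi> q \<in> A}"
proof -
  have "continuous_map (subtopology T U) (top_of_set (\<phi> ` U)) \<phi>"
    using c homeomorphic_imp_continuous_map by (auto simp: chart_def)
  moreover have "openin (top_of_set (\<phi> ` U)) (\<phi> ` U \<inter> A)"
  proof -
    obtain A' where A': "open A'" "A = E \<inter> A'" using A unfolding openin_open by auto
    have "openin (top_of_set (\<phi> ` U)) (\<phi> ` U \<inter> A')" using A'(1) by (rule openin_open_Int)
    moreover have "\<phi> ` U \<inter> A' = \<phi> ` U \<inter> A"
      using openin_imp_subset[OF chart_openin(2)[OF c]] A'(2) by auto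
    ultimately show ?thesis by simp
  qed
  ultimately have "openin (subtopology T U) {q \<in> topspace (subtopology T U). \<phi> q \<in> \<phi> ` U \<inter> A}"
    by (rule openin_continuous_map_preimage)
  moreover have "{q \<in> topspace (subtopology T U). \<phi> q \<in> \<phi> ` U \<inter> A} = {q\<in>U. \<phi> q \<in> A}"
    using openin_subset[OF chart_openin(1)[OF c]] by auto
  ultimately show ?thesis using openin_trans_full chart_openin(1)[OF c] by metis
qed

text \<open>Makes the charts of \<open>prod_manifold\<close> usable for the group
  multiplication.\<close>

lemma chart_prod:
  assumes a: "chart T E (U, \<phi>)" and b: "chart T' E' (V, \<psi>)"
  shows "chart (prod_topology T T') (E \<times> E') (U \<times> V, map_prod \<phi> \<psi>)"
proof -
  have img: "map_prod \<phi> \<psi> ` (U \<times> V) = \<phi> ` U \<times> \<psi> ` V" by (auto simp: image_iff)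
  obtain \<phi>' where p: "homeomorphic_maps (subtopology T U) (top_of_set (\<phi> ` U)) \<phi> \<phi>'"
    using a by (auto simp: chart_def homeomorphic_map_maps)
  obtain \<psi>' where q: "homeomorphic_maps (subtopology T' V) (top_of_set (\<psi> ` V)) \<psi> \<psi>'"
    using b by (auto simp: chart_def homeomorphic_map_maps)
  have "homeomorphic_maps (prod_topology (subtopology T U) (subtopology T' V))
     (prod_topology (top_of_set (\<phi> ` U)) (top_of_set (\<psi> ` V))) (\<lambda>(x,y). (\<phi> x, \<psi> y)) (\<lambda>(x,y). (\<phi>' x, \<psi>' y))"
    using p q unfolding homeomorphic_maps_prod by simp
  then have "homeomorphic_map (subtopology (prod_topology T T') (U \<times> V)) (top_of_set (\<phi> ` U \<times> \<psi> ` V)) (map_prod \<phi> \<psi>)"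
    unfolding homeomorphic_map_maps map_prod_def by (auto simp: subtopology_Times)
  moreover have "openin (top_of_set (E \<times> E')) (\<phi> ` U \<times> \<psi> ` V)"
    using chart_openin(2)[OF a] chart_openin(2)[OF b] by (rule openin_Times)
  moreover have "openin (prod_topology T T') (U \<times> V)"
    using chart_openin(1)[OF a] chart_openin(1)[OF b] by (simp add: openin_prod_Times_iff)
  ultimately show ?thesis by (simp add: chart_def img)
qed

text \<open>\<open>smooth_map\<close> speaks of the chart maps of N only; near each point f is its
  own chart expression after such a map, and smoothness is local. Only a single chart of M is
  assumed, so that M may be a product manifold.\<close>

lemma smooth_map_compose_chart:
  fixes M :: "('a, 'e::euclidean_space) manifold" and N :: "('b, 'f::euclidean_space) manifold"
  assumes E: "subspace (model M)" and c: "chart (mtop M) (model M) (U, \<phi>)" and at: "(U, \<phi>) \<in> atlas M"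
    and N: "smooth_manifold N" and F: "smooth_map M N F" and W: "openin (mtop N) W" and f: "smooth_fun N W f"
  shows "openin (mtop M) (U \<inter> F -` W)" "smooth_on (model M) (\<phi> ` (U \<inter> F -` W)) (f \<circ> F \<circ> inv_into U \<phi>)"
proof -
  have pre: "openin (mtop M) (U \<inter> F -` Z)" if "openin (mtop N) Z" for Z
  proof -
    have "openin (mtop M) {x \<in> topspace (mtop M). F x \<in> Z}"
      using F that openin_continuous_map_preimage by (auto simp: smooth_map_def)
    then have "openin (mtop M) (U \<inter> {x \<in> topspace (mtop M). F x \<in> Z})"
      using chart_openin(1)[OF c] by (rule openin_Int[rotated])
    moreover have "U \<inter> {x \<in> topspace (mtop M). F x \<in> Z} = U \<inter> F -` Z"
      using openin_subset[OF chart_openin(1)[OF c]] by auto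
    ultimately show ?thesis by simp
  qed
  show O: "openin (mtop M) (U \<inter> F -` W)" using pre[OF W] .
  have op: "openin (top_of_set (model M)) (\<phi> ` (U \<inter> F -` Z))" if "openin (mtop N) Z" for Z
    using chart_open_image[OF c pre[OF that]] by (simp add: Int_assoc[symmetric])
  have inj: "inj_on \<phi> U" using chart_inj[OF c] .
  show "smooth_on (model M) (\<phi> ` (U \<inter> F -` W)) (f \<circ> F \<circ> inv_into U \<phi>)"
  proof (rule smooth_on_local[OF E op[OF W]])
    fix x assume "x \<in> \<phi> ` (U \<inter> F -` W)"
    then obtain q where q: "x = \<phi> q" "q \<in> U" "F q \<in> W" by auto
    have "F q \<in> topspace (mtop N)" using q(3) openin_subset[OF W] by blast
    then obtain V \<psi> where V: "(V, \<psi>) \<in> atlas N" "F q \<in> V"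
      using N by (auto simp: smooth_manifold_def)
    have cV: "chart (mtop N) (model N) (V, \<psi>)" using N V(1) by (auto simp: smooth_manifold_def)
    have VW: "openin (mtop N) (V \<inter> W)" using chart_openin(1)[OF cV] W by (rule openin_Int)
    define Z where "Z = \<phi> ` (U \<inter> F -` (V \<inter> W))"
    have opZ: "openin (top_of_set (model M)) Z" unfolding Z_def by (rule op[OF VW])
    have 1: "smooth_on (model M) Z (\<psi> \<circ> F \<circ> inv_into U \<phi>)"
    proof (rule smooth_on_subset)
      show "smooth_on (model M) (\<phi> ` (U \<inter> F -` V)) (\<psi> \<circ> F \<circ> inv_into U \<phi>)"
        using F at V(1) by (auto simp: smooth_map_def)
    qed (auto simp: Z_def)
    have 2: "smooth_on (model N) (\<psi> ` (V \<inter> W)) (f \<circ> inv_into V \<psi>)"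
      using f V(1) by (auto simp: smooth_fun_def)
    have "smooth_on (model M) Z (\<lambda>x. (f \<circ> inv_into V \<psi>) ((\<psi> \<circ> F \<circ> inv_into U \<phi>) x))"
    proof (rule smooth_on_compose[OF E opZ _ _ _ 1 2])
      show "subspace (model N)" using N by (simp add: smooth_manifold_def)
      show "openin (top_of_set (model N)) (\<psi> ` (V \<inter> W))" by (rule chart_open_image[OF cV W])
      show "(\<psi> \<circ> F \<circ> inv_into U \<phi>) ` Z \<subseteq> \<psi> ` (V \<inter> W)"
        by (auto simp: Z_def inv_into_f_f[OF inj])
    qed
    moreover have "(f \<circ> inv_into V \<psi>) ((\<psi> \<circ> F \<circ> inv_into U \<phi>) x) = (f \<circ> F \<circ> inv_into U \<phi>) x" if "x \<in> Z" for x
      using that by (auto simp: Z_def inv_into_f_f[OF inj] inv_into_f_f[OF chart_inj[OF cV]])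
    ultimately have "smooth_on (model M) Z (f \<circ> F \<circ> inv_into U \<phi>)"
      using smooth_on_cong[of Z "\<lambda>x. (f \<circ> inv_into V \<psi>) ((\<psi> \<circ> F \<circ> inv_into U \<phi>) x)" "f \<circ> F \<circ> inv_into U \<phi>" "model M"] by simp
    moreover have "x \<in> Z" using q V(2) by (auto simp: Z_def)
    moreover have "Z \<subseteq> \<phi> ` (U \<inter> F -` W)" by (auto simp: Z_def)
    ultimately show "\<exists>Z. openin (top_of_set (model M)) Z \<and> x \<in> Z \<and> Z \<subseteq> \<phi> ` (U \<inter> F -` W)
       \<and> smooth_on (model M) Z (f \<circ> F \<circ> inv_into U \<phi>)"
      using opZ by (intro exI[of _ Z] conjI)
  qed
qed

locale smooth_mfd =
  fixes M :: "('a, 'e::euclidean_space) manifold"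
  assumes smooth_manifold: "smooth_manifold M"
begin

lemma subspace_model: "subspace (model M)"
  using smooth_manifold by (simp add: smooth_manifold_def)

lemma atlas_chart: "(U, \<phi>) \<in> atlas M \<Longrightarrow> chart (mtop M) (model M) (U, \<phi>)"
  using smooth_manifold by (auto simp: smooth_manifold_def)

lemmas atlas_open = chart_openin(1)[OF atlas_chart]
lemmas atlas_inj = chart_inj[OF atlas_chart]

lemma atlas_inv: "(U, \<phi>) \<in> atlas M \<Longrightarrow> q \<in> U \<Longrightarrow> inv_into U \<phi> (\<phi> q) = q"
  using atlas_inj inv_into_f_f by metis

lemma obtain_chart:
  assumes "p \<in> topspace (mtop M)"
  obtains U \<phi> where "(U, \<phi>) \<in> atlas M" "p \<in> U"
  using assms smooth_manifold by (auto simp: smooth_manifold_def)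

section \<open>Smooth functions and their germs\<close>

lemma smooth_funD: "smooth_fun M W f \<Longrightarrow> (U, \<phi>) \<in> atlas M \<Longrightarrow> smooth_on (model M) (\<phi> ` (U \<inter> W)) (f \<circ> inv_into U \<phi>)"
  by (auto simp: smooth_fun_def)

lemma smooth_fun_subset: "smooth_fun M W f \<Longrightarrow> W' \<subseteq> W \<Longrightarrow> smooth_fun M W' f"
proof -
  assume a: "smooth_fun M W f" "W' \<subseteq> W"
  show ?thesis
    unfolding smooth_fun_def
  proof (clarify)
    fix U \<phi> assume "(U, \<phi>) \<in> atlas M"
    from smooth_funD[OF a(1) this] show "smooth_on (model M) (\<phi> ` (U \<inter> W')) (f \<circ> inv_into U \<phi>)"
      by (rule smooth_on_subset) (use a(2) in auto)
  qed
qed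

lemma smooth_fun_cong:
  assumes f: "smooth_fun M W f" and eq: "\<And>q. q \<in> W \<Longrightarrow> f q = h q"
  shows "smooth_fun M W h"
  unfolding smooth_fun_def
proof (clarify)
  fix U \<phi> assume at: "(U, \<phi>) \<in> atlas M"
  have "(f \<circ> inv_into U \<phi>) x = (h \<circ> inv_into U \<phi>) x" if "x \<in> \<phi> ` (U \<inter> W)" for x
    using that eq by (auto simp: atlas_inv[OF at])
  then show "smooth_on (model M) (\<phi> ` (U \<inter> W)) (h \<circ> inv_into U \<phi>)"
    using smooth_funD[OF f at] smooth_on_cong[of "\<phi> ` (U \<inter> W)" "f \<circ> inv_into U \<phi>" "h \<circ> inv_into U \<phi>"] by simp
qed

text \<open>The transition maps carry smoothness in one chart over to all the others.\<close>

lemma smooth_fun_chartI: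
  assumes at: "(U, \<phi>) \<in> atlas M" and W: "openin (mtop M) W" "W \<subseteq> U"
    and f: "smooth_on (model M) (\<phi> ` W) (f \<circ> inv_into U \<phi>)"
  shows "smooth_fun M W f"
  unfolding smooth_fun_def
proof (clarify)
  fix V \<psi> assume at': "(V, \<psi>) \<in> atlas M"
  have "smooth_on (model M) (\<psi> ` (V \<inter> U)) (\<phi> \<circ> inv_into V \<psi>)"
    using smooth_manifold at at' by (auto simp: smooth_manifold_def)
  then have 1: "smooth_on (model M) (\<psi> ` (V \<inter> W)) (\<phi> \<circ> inv_into V \<psi>)"
    by (rule smooth_on_subset) (use W in auto)
  have o1: "openin (top_of_set (model M)) (\<psi> ` (V \<inter> W))" by (rule chart_open_image[OF atlas_chart[OF at'] W(1)])
  have "U \<inter> W = W" using W(2) by auto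
  then have o2: "openin (top_of_set (model M)) (\<phi> ` W)"
    using chart_open_image[OF atlas_chart[OF at] W(1)] by simp
  have "smooth_on (model M) (\<psi> ` (V \<inter> W)) (\<lambda>x. (f \<circ> inv_into U \<phi>) ((\<phi> \<circ> inv_into V \<psi>) x))"
  proof (rule smooth_on_compose[OF subspace_model o1 subspace_model o2 _ 1 f])
    show "(\<phi> \<circ> inv_into V \<psi>) ` \<psi> ` (V \<inter> W) \<subseteq> \<phi> ` W"
      by (auto simp: atlas_inv[OF at'])
  qed
  moreover have "(f \<circ> inv_into U \<phi>) ((\<phi> \<circ> inv_into V \<psi>) x) = (f \<circ> inv_into V \<psi>) x" if "x \<in> \<psi> ` (V \<inter> W)" for x
    using that W(2) by (auto simp: atlas_inv[OF at'] atlas_inv[OF at] subset_iff)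
  ultimately show "smooth_on (model M) (\<psi> ` (V \<inter> W)) (f \<circ> inv_into V \<psi>)"
    using smooth_on_cong[of "\<psi> ` (V \<inter> W)" "\<lambda>x. (f \<circ> inv_into U \<phi>) ((\<phi> \<circ> inv_into V \<psi>) x)" "f \<circ> inv_into V \<psi>" "model M"] by simp
qed

lemma smooth_fun_local:
  assumes W: "openin (mtop M) W"
    and loc: "\<And>p. p \<in> W \<Longrightarrow> \<exists>W'. openin (mtop M) W' \<and> p \<in> W' \<and> smooth_fun M W' f"
  shows "smooth_fun M W f"
  unfolding smooth_fun_def
proof (clarify)
  fix U \<phi> assume at: "(U, \<phi>) \<in> atlas M"
  note c = atlas_chart[OF at]
  show "smooth_on (model M) (\<phi> ` (U \<inter> W)) (f \<circ> inv_into U \<phi>)"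
  proof (rule smooth_on_local[OF subspace_model chart_open_image[OF c W]])
    fix x assume "x \<in> \<phi> ` (U \<inter> W)"
    then obtain q where q: "x = \<phi> q" "q \<in> U" "q \<in> W" by auto
    obtain W' where W': "openin (mtop M) W'" "q \<in> W'" "smooth_fun M W' f" using loc[OF q(3)] by auto
    have "openin (mtop M) (W' \<inter> W)" using W'(1) W by (rule openin_Int)
    from chart_open_image[OF c this]
    have "openin (top_of_set (model M)) (\<phi> ` (U \<inter> (W' \<inter> W)))" .
    moreover have "smooth_on (model M) (\<phi> ` (U \<inter> (W' \<inter> W))) (f \<circ> inv_into U \<phi>)"
      by (rule smooth_on_subset[OF smooth_funD[OF W'(3) at]]) auto
    moreover have "x \<in> \<phi> ` (U \<inter> (W' \<inter> W))" using q W'(2) by auto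
    moreover have "\<phi> ` (U \<inter> (W' \<inter> W)) \<subseteq> \<phi> ` (U \<inter> W)" by auto
    ultimately show "\<exists>T. openin (top_of_set (model M)) T \<and> x \<in> T \<and> T \<subseteq> \<phi> ` (U \<inter> W) \<and> smooth_on (model M) T (f \<circ> inv_into U \<phi>)"
      by (intro exI[of _ "\<phi> ` (U \<inter> (W' \<inter> W))"] conjI)
  qed
qed

lemma smooth_fun_const: "smooth_fun M W (\<lambda>q. c)"
  by (auto simp: smooth_fun_def comp_def smooth_on_const)

lemma smooth_fun_add: "smooth_fun M W f \<Longrightarrow> smooth_fun M W h \<Longrightarrow> smooth_fun M W (\<lambda>q. f q + h q)"
proof -
  assume f: "smooth_fun M W f" and h: "smooth_fun M W h"
  show "smooth_fun M W (\<lambda>q. f q + h q)"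
    unfolding smooth_fun_def
  proof (clarify)
    fix U \<phi> assume at: "(U, \<phi>) \<in> atlas M"
    from smooth_on_add[OF smooth_funD[OF f at] smooth_funD[OF h at]]
    show "smooth_on (model M) (\<phi> ` (U \<inter> W)) ((\<lambda>q. f q + h q) \<circ> inv_into U \<phi>)" by (simp add: comp_def)
  qed
qed

lemma smooth_fun_mult: "smooth_fun M W f \<Longrightarrow> smooth_fun M W h \<Longrightarrow> smooth_fun M W (\<lambda>q. f q * h q)"
proof -
  assume f: "smooth_fun M W f" and h: "smooth_fun M W h"
  show "smooth_fun M W (\<lambda>q. f q * h q)"
    unfolding smooth_fun_def
  proof (clarify)
    fix U \<phi> assume at: "(U, \<phi>) \<in> atlas M"
    from smooth_on_mult[OF smooth_funD[OF f at] smooth_funD[OF h at]]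
    show "smooth_on (model M) (\<phi> ` (U \<inter> W)) ((\<lambda>q. f q * h q) \<circ> inv_into U \<phi>)" by (simp add: comp_def)
  qed
qed

lemma smooth_fun_scale: "smooth_fun M W f \<Longrightarrow> smooth_fun M W (\<lambda>q. c * f q)"
  by (intro smooth_fun_mult smooth_fun_const)

lemma smooth_fun_diff: "smooth_fun M W f \<Longrightarrow> smooth_fun M W h \<Longrightarrow> smooth_fun M W (\<lambda>q. f q - h q)"
  using smooth_fun_add[of W f "\<lambda>q. (- 1) * h q"] smooth_fun_scale[of W h "- 1"] by simp

lemma smooth_fun_coord:
  assumes at: "(U, \<phi>) \<in> atlas M"
  shows "smooth_fun M U (\<lambda>q. \<phi> q \<bullet> b)"
proof (rule smooth_fun_chartI[OF at atlas_open[OF at]])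
  have "smooth_on (model M) (\<phi> ` U) (\<lambda>x. x \<bullet> b)"
    by (rule smooth_on_bounded_linear) (rule bounded_linear_inner_left)
  moreover have "x \<bullet> b = ((\<lambda>q. \<phi> q \<bullet> b) \<circ> inv_into U \<phi>) x" if "x \<in> \<phi> ` U" for x
    using that by (auto simp: atlas_inv[OF at])
  ultimately show "smooth_on (model M) (\<phi> ` U) ((\<lambda>q. \<phi> q \<bullet> b) \<circ> inv_into U \<phi>)"
    using smooth_on_cong[of "\<phi> ` U" "\<lambda>x. x \<bullet> b" "(\<lambda>q. \<phi> q \<bullet> b) \<circ> inv_into U \<phi>" "model M"] by simp
qed simp

lemma smooth_atI: "openin (mtop M) W \<Longrightarrow> p \<in> W \<Longrightarrow> smooth_fun M W f \<Longrightarrow> smooth_at M p f"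
  by (auto simp: smooth_at_def)

lemma smooth_at_mem: "smooth_at M p f \<Longrightarrow> p \<in> topspace (mtop M)"
  by (auto simp: smooth_at_def dest: openin_subset)

lemma smooth_at_const: "p \<in> topspace (mtop M) \<Longrightarrow> smooth_at M p (\<lambda>q. c)"
  by (rule smooth_atI[OF openin_topspace]) (auto intro: smooth_fun_const)

lemma smooth_at_binary:
  assumes "smooth_at M p f" "smooth_at M p h"
  obtains W where "openin (mtop M) W" "p \<in> W" "smooth_fun M W f" "smooth_fun M W h"
proof -
  obtain W1 W2 where W: "openin (mtop M) W1" "p \<in> W1" "smooth_fun M W1 f" "openin (mtop M) W2" "p \<in> W2" "smooth_fun M W2 h"
    using assms by (auto simp: smooth_at_def)
  show thesis
  proof (rule that[of "W1 \<inter> W2"])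
    show "openin (mtop M) (W1 \<inter> W2)" using W(1,4) by (rule openin_Int)
    show "smooth_fun M (W1 \<inter> W2) f" using smooth_fun_subset[OF W(3)] by simp
    show "smooth_fun M (W1 \<inter> W2) h" using smooth_fun_subset[OF W(6)] by simp
  qed (use W in auto)
qed

lemma smooth_at_add: "smooth_at M p f \<Longrightarrow> smooth_at M p h \<Longrightarrow> smooth_at M p (\<lambda>q. f q + h q)"
  by (erule (1) smooth_at_binary) (rule smooth_atI, auto intro: smooth_fun_add)

lemma smooth_at_mult: "smooth_at M p f \<Longrightarrow> smooth_at M p h \<Longrightarrow> smooth_at M p (\<lambda>q. f q * h q)"
  by (erule (1) smooth_at_binary) (rule smooth_atI, auto intro: smooth_fun_mult)

lemma smooth_at_diff: "smooth_at M p f \<Longrightarrow> smooth_at M p h \<Longrightarrow> smooth_at M p (\<lambda>q. f q - h q)"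
  by (erule (1) smooth_at_binary) (rule smooth_atI, auto intro: smooth_fun_diff)

lemma smooth_at_scale: "smooth_at M p f \<Longrightarrow> smooth_at M p (\<lambda>q. c * f q)"
  by (intro smooth_at_mult smooth_at_const smooth_at_mem)

lemma smooth_at_sum: "p \<in> topspace (mtop M) \<Longrightarrow> (\<And>i. i \<in> I \<Longrightarrow> smooth_at M p (f i)) \<Longrightarrow> smooth_at M p (\<lambda>q. \<Sum>i\<in>I. f i q)"
  by (induction I rule: infinite_finite_induct) (auto intro: smooth_at_const smooth_at_add)

lemma smooth_at_cong:
  assumes f: "smooth_at M p f" and W: "openin (mtop M) W" "p \<in> W" and eq: "\<And>q. q \<in> W \<Longrightarrow> f q = h q"
  shows "smooth_at M p h"
proof -
  obtain W1 where W1: "openin (mtop M) W1" "p \<in> W1" "smooth_fun M W1 f" using f by (auto simp: smooth_at_def)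
  have "smooth_fun M (W1 \<inter> W) f" using smooth_fun_subset[OF W1(3)] by simp
  then have "smooth_fun M (W1 \<inter> W) h" by (rule smooth_fun_cong) (use eq in auto)
  moreover have "openin (mtop M) (W1 \<inter> W)" using W1(1) W(1) by (rule openin_Int)
  ultimately show ?thesis using W1(2) W(2) by (intro smooth_atI[of "W1 \<inter> W"]) auto
qed

section \<open>Tangent vectors as derivations\<close>

lemma tangent_vector_rules:
  assumes v: "v \<in> tangent_space M p"
  shows tangent_add: "smooth_at M p f \<Longrightarrow> smooth_at M p h \<Longrightarrow> v (\<lambda>q. f q + h q) = v f + v h"
    and tangent_mult: "smooth_at M p f \<Longrightarrow> smooth_at M p h \<Longrightarrow> v (\<lambda>q. f q * h q) = f p * v h + h p * v f"
    and tangent_scale: "smooth_at M p f \<Longrightarrow> v (\<lambda>q. c * f q) = c * v f"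
    and tangent_undef: "\<not> smooth_at M p f \<Longrightarrow> v f = 0"
proof -
  have "v (f + h) = v f + v h \<and> v (f * h) = f p * v h + h p * v f" if "smooth_at M p f" "smooth_at M p h" for f h
    using v that by (simp add: tangent_space_def)
  then show "smooth_at M p f \<Longrightarrow> smooth_at M p h \<Longrightarrow> v (\<lambda>q. f q + h q) = v f + v h"
    "smooth_at M p f \<Longrightarrow> smooth_at M p h \<Longrightarrow> v (\<lambda>q. f q * h q) = f p * v h + h p * v f"
    by (auto simp: plus_fun_def times_fun_def)
  have "v (c *\<^sub>R f) = c * v f" if "smooth_at M p f"
    using v that by (simp add: tangent_space_def)
  then show "smooth_at M p f \<Longrightarrow> v (\<lambda>q. c * f q) = c * v f" by (simp add: scaleR_fun_def)
  show "\<not> smooth_at M p f \<Longrightarrow> v f = 0" using v by (simp add: tangent_space_def)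
qed

lemma tangent_spaceI:
  assumes "\<And>f h. smooth_at M p f \<Longrightarrow> smooth_at M p h \<Longrightarrow> v (\<lambda>q. f q + h q) = v f + v h"
    and "\<And>f h. smooth_at M p f \<Longrightarrow> smooth_at M p h \<Longrightarrow> v (\<lambda>q. f q * h q) = f p * v h + h p * v f"
    and "\<And>f c. smooth_at M p f \<Longrightarrow> v (\<lambda>q. c * f q) = c * v f"
    and "\<And>f. \<not> smooth_at M p f \<Longrightarrow> v f = 0"
  shows "v \<in> tangent_space M p"
  using assms by (simp add: tangent_space_def plus_fun_def times_fun_def scaleR_fun_def)

lemma tangent_eqI:
  assumes "v \<in> tangent_space M p" "w \<in> tangent_space M p" "\<And>f. smooth_at M p f \<Longrightarrow> v f = w f"
  shows "v = w"
proof
  fix f show "v f = w f" using assms(3) tangent_undef[OF assms(1)] tangent_undef[OF assms(2)] by (cases "smooth_at M p f") auto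
qed

lemma subspace_tangent: "subspace (tangent_space M p)"
proof (rule subspaceI)
  show "0 \<in> tangent_space M p" by (rule tangent_spaceI) (auto simp: zero_fun_def)
  fix v w c assume v: "v \<in> tangent_space M p"
  show "c *\<^sub>R v \<in> tangent_space M p"
    by (rule tangent_spaceI) (simp_all add: tangent_vector_rules[OF v] algebra_simps)
  assume w: "w \<in> tangent_space M p"
  show "v + w \<in> tangent_space M p"
    by (rule tangent_spaceI) (simp_all add: tangent_vector_rules[OF v] tangent_vector_rules[OF w] algebra_simps)
qed

lemma tangent_const:
  assumes v: "v \<in> tangent_space M p"
  shows "v (\<lambda>q. c) = 0"
proof (cases "p \<in> topspace (mtop M)")
  case True
  have "v (\<lambda>q. 1 * 1) = 1 * v (\<lambda>q. 1) + 1 * v (\<lambda>q. 1)"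
    using tangent_mult[OF v smooth_at_const[OF True] smooth_at_const[OF True], of 1 1] by simp
  then have "v (\<lambda>q. 1) = 0" by simp
  then show ?thesis using tangent_scale[OF v smooth_at_const[OF True, of 1], of c] by simp
next
  case False
  then show ?thesis using tangent_undef[OF v] smooth_at_mem by blast
qed

text \<open>Locality needs no bump functions, as the function \<open>k\<close> below need only be smooth near \<open>p\<close>.\<close>

lemma tangent_local:
  assumes v: "v \<in> tangent_space M p" and W: "openin (mtop M) W" "p \<in> W" and eq: "\<And>q. q \<in> W \<Longrightarrow> f q = h q"
  shows "v f = v h"
proof (cases "smooth_at M p f")
  case True
  then have h: "smooth_at M p h" by (rule smooth_at_cong[OF _ W eq])
  have d: "smooth_at M p (\<lambda>q. f q - h q)" by (rule smooth_at_diff[OF True h])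
  define k where "k q = (if q \<in> W then 0 else 1::real)" for q
  have k: "smooth_at M p k"
    by (rule smooth_at_cong[OF smooth_at_const[of p 0] W]) (use W openin_subset in \<open>auto simp: k_def\<close>)
  \<comment> \<open>f - h is 0 on W and k is 1 off W, so the factor k changes nothing; both factors
    vanish at p, and the Leibniz rule gives 0.\<close>
  have "(\<lambda>q. f q - h q) = (\<lambda>q. (f q - h q) * k q)" using eq by (auto simp: k_def)
  then have "v (\<lambda>q. f q - h q) = v (\<lambda>q. (f q - h q) * k q)" by simp
  also have "\<dots> = 0" using tangent_mult[OF v d k] eq[OF W(2)] W(2) by (simp add: k_def)
  finally have z: "v (\<lambda>q. f q - h q) = 0" .
  have "v f = v (\<lambda>q. (f q - h q) + h q)" by simp
  also have "\<dots> = v (\<lambda>q. f q - h q) + v h" by (rule tangent_add[OF v d h])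
  finally show ?thesis using z by simp
next
  case False
  moreover have "\<not> smooth_at M p h" using smooth_at_cong[OF _ W, of h f] eq False by auto
  ultimately show ?thesis using tangent_undef[OF v] by simp
qed

lemma tangent_sum:
  assumes v: "v \<in> tangent_space M p" and p: "p \<in> topspace (mtop M)" and f: "\<And>i. i \<in> I \<Longrightarrow> smooth_at M p (f i)"
  shows "v (\<lambda>q. \<Sum>i\<in>I. f i q) = (\<Sum>i\<in>I. v (f i))"
  using f
proof (induction I rule: infinite_finite_induct)
  case (insert i I)
  then show ?case using tangent_add[OF v, of "f i" "\<lambda>q. \<Sum>i\<in>I. f i q"] smooth_at_sum[OF p, of I f] by simp
qed (simp_all add: tangent_const[OF v])

end

text \<open>A globally linear extension gives access to the general facts on \<open>linear\<close>
  maps.\<close>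

lemma linear_on_extend:
  assumes B: "independent B" "span B = L" and T: "linear_on L T"
  obtains g where "linear g" "\<And>x. x \<in> L \<Longrightarrow> g x = T x"
proof -
  obtain g where g: "linear g" "\<forall>x\<in>B. g x = T x" using linear_independent_extend[OF B(1), of T] by auto
  have L: "subspace L" using B(2) subspace_span[of B] by simp
  have "subspace {x\<in>L. g x = T x}"
  proof (rule subspaceI)
    have "T (0 *\<^sub>R 0) = 0 *\<^sub>R T 0" by (rule linear_onD(2)[OF T subspace_0[OF L]])
    then show "0 \<in> {x\<in>L. g x = T x}" using linear_0[OF g(1)] subspace_0[OF L] by simp
    fix x y c assume x: "x \<in> {x\<in>L. g x = T x}"
    then show "c *\<^sub>R x \<in> {x\<in>L. g x = T x}"
      using linear_scale[OF g(1)] linear_onD(2)[OF T] subspace_scale[OF L] by simp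
    assume y: "y \<in> {x\<in>L. g x = T x}"
    then show "x + y \<in> {x\<in>L. g x = T x}"
      using x linear_add[OF g(1)] linear_onD(1)[OF T] subspace_add[OF L] by simp
  qed
  moreover have "B \<subseteq> {x\<in>L. g x = T x}" using g(2) B(2) span_superset[of B] by auto
  ultimately have "span B \<subseteq> {x\<in>L. g x = T x}" by (rule span_minimal[rotated])
  then have "g x = T x" if "x \<in> L" for x using that B(2) by auto
  then show thesis using that g(1) by auto
qed

lemma linear_on_injective_basis:
  assumes B: "independent B" "span B = L" and T: "linear_on L T" and inj: "\<And>x. x \<in> L \<Longrightarrow> T x = 0 \<Longrightarrow> x = 0"
  shows "independent (T ` B)" "span (T ` B) = T ` L" "card (T ` B) = card B"
proof -
  obtain g where g: "linear g" "\<And>x. x \<in> L \<Longrightarrow> g x = T x" by (rule linear_on_extend[OF B T]) (rule that)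
  have BL: "B \<subseteq> L" using B(2) span_superset[of B] by simp
  have L: "subspace L" using B(2) subspace_span[of B] by simp
  have TB: "T ` B = g ` B" using g(2) BL by (intro image_cong) auto
  have gi: "inj_on g L"
    unfolding linear_inj_on_iff_eq_0[OF g(1) L] using inj g(2) by simp
  show "independent (T ` B)"
    unfolding TB by (rule linear_independent_injective_image[OF g(1) B(1)]) (use gi B(2) in simp)
  show "span (T ` B) = T ` L"
    unfolding TB linear_span_image[OF g(1)] B(2) using g(2) by (intro image_cong) auto
  show "card (T ` B) = card B"
    unfolding TB by (rule card_image) (rule inj_on_subset[OF gi BL])
qed

section \<open>Coordinate vectors and the dimension of tangent spaces\<close>

context smooth_mfd
begin

definition coord_vec :: "'a set \<Rightarrow> ('a \<Rightarrow> 'e) \<Rightarrow> 'a \<Rightarrow> 'e \<Rightarrow> 'a tvec"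
  where "coord_vec U \<phi> p \<xi> = (\<lambda>f. if smooth_at M p f then dir_deriv (f \<circ> inv_into U \<phi>) \<xi> (\<phi> p) else 0)"

lemma smooth_at_chart:
  assumes at: "(U, \<phi>) \<in> atlas M" and p: "p \<in> U" and f: "smooth_at M p f" and h: "smooth_at M p h"
  obtains S where "openin (top_of_set (model M)) S" "\<phi> p \<in> S" "S \<subseteq> \<phi> ` U"
    "smooth_on (model M) S (f \<circ> inv_into U \<phi>)" "smooth_on (model M) S (h \<circ> inv_into U \<phi>)"
proof -
  obtain W where W: "openin (mtop M) W" "p \<in> W" "smooth_fun M W f" "smooth_fun M W h"
    by (rule smooth_at_binary[OF f h]) (rule that)
  show thesis
    using that[OF chart_open_image[OF atlas_chart[OF at] W(1)] _ _ smooth_funD[OF W(3) at] smooth_funD[OF W(4) at]]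
      p W(2) by auto
qed

lemma coord_vec_tangent:
  assumes at: "(U, \<phi>) \<in> atlas M" and p: "p \<in> U" and \<xi>: "\<xi> \<in> model M"
  shows "coord_vec U \<phi> p \<xi> \<in> tangent_space M p"
proof (rule tangent_spaceI)
  fix f h assume f: "smooth_at M p f" and h: "smooth_at M p h"
  obtain S where S: "openin (top_of_set (model M)) S" "\<phi> p \<in> S" "S \<subseteq> \<phi> ` U"
    "smooth_on (model M) S (f \<circ> inv_into U \<phi>)" "smooth_on (model M) S (h \<circ> inv_into U \<phi>)"
    by (rule smooth_at_chart[OF at p f h])
  note r = dir_deriv_rules[OF subspace_model S(1,4,5,2) \<xi>]
  show "coord_vec U \<phi> p \<xi> (\<lambda>q. f q + h q) = coord_vec U \<phi> p \<xi> f + coord_vec U \<phi> p \<xi> h"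
    using r(1) f h smooth_at_add[OF f h] by (simp add: coord_vec_def comp_def)
  show "coord_vec U \<phi> p \<xi> (\<lambda>q. f q * h q) = f p * coord_vec U \<phi> p \<xi> h + h p * coord_vec U \<phi> p \<xi> f"
    using r(2) f h smooth_at_mult[OF f h] atlas_inv[OF at p] by (simp add: coord_vec_def comp_def)
next
  fix f c assume f: "smooth_at M p f"
  obtain S where S: "openin (top_of_set (model M)) S" "\<phi> p \<in> S" "S \<subseteq> \<phi> ` U"
    "smooth_on (model M) S (f \<circ> inv_into U \<phi>)" "smooth_on (model M) S (f \<circ> inv_into U \<phi>)"
    by (rule smooth_at_chart[OF at p f f])
  show "coord_vec U \<phi> p \<xi> (\<lambda>q. c * f q) = c * coord_vec U \<phi> p \<xi> f"
    using dir_deriv_cmult[OF subspace_model S(1,4,2) \<xi>, of c] f smooth_at_scale[OF f]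
    by (simp add: coord_vec_def comp_def)
qed (simp add: coord_vec_def)

lemma coord_vec_linear:
  assumes at: "(U, \<phi>) \<in> atlas M" and p: "p \<in> U"
  shows "linear_on (model M) (coord_vec U \<phi> p)"
proof (rule linear_onI; rule ext)
  fix \<xi> \<eta> c f assume \<xi>: "\<xi> \<in> model M"
  show "coord_vec U \<phi> p (c *\<^sub>R \<xi>) f = (c *\<^sub>R coord_vec U \<phi> p \<xi>) f"
  proof (cases "smooth_at M p f")
    case True
    obtain S where S: "openin (top_of_set (model M)) S" "\<phi> p \<in> S" "S \<subseteq> \<phi> ` U"
      "smooth_on (model M) S (f \<circ> inv_into U \<phi>)" "smooth_on (model M) S (f \<circ> inv_into U \<phi>)"
      by (rule smooth_at_chart[OF at p True True])
    show ?thesis using dir_deriv_linear(2)[OF subspace_model S(1,4,2) \<xi> \<xi>] by (simp add: coord_vec_def)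
  qed (simp add: coord_vec_def)
  assume \<eta>: "\<eta> \<in> model M"
  show "coord_vec U \<phi> p (\<xi> + \<eta>) f = (coord_vec U \<phi> p \<xi> + coord_vec U \<phi> p \<eta>) f"
  proof (cases "smooth_at M p f")
    case True
    obtain S where S: "openin (top_of_set (model M)) S" "\<phi> p \<in> S" "S \<subseteq> \<phi> ` U"
      "smooth_on (model M) S (f \<circ> inv_into U \<phi>)" "smooth_on (model M) S (f \<circ> inv_into U \<phi>)"
      by (rule smooth_at_chart[OF at p True True])
    show ?thesis using dir_deriv_linear(1)[OF subspace_model S(1,4,2) \<xi> \<eta>] by (simp add: coord_vec_def)
  qed (simp add: coord_vec_def)
qed

lemma smooth_at_coord:
  assumes at: "(U, \<phi>) \<in> atlas M" and p: "p \<in> U"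
  shows "smooth_at M p (\<lambda>q. \<phi> q \<bullet> b)"
  by (rule smooth_atI[OF atlas_open[OF at] p smooth_fun_coord[OF at]])

lemma coord_vec_coord:
  assumes at: "(U, \<phi>) \<in> atlas M" and p: "p \<in> U" and \<xi>: "\<xi> \<in> model M"
  shows "coord_vec U \<phi> p \<xi> (\<lambda>q. \<phi> q \<bullet> b) = \<xi> \<bullet> b"
proof -
  have o: "openin (top_of_set (model M)) (\<phi> ` U)" by (rule chart_openin(2)[OF atlas_chart[OF at]])
  have "dir_deriv ((\<lambda>q. \<phi> q \<bullet> b) \<circ> inv_into U \<phi>) \<xi> (\<phi> p) = dir_deriv (\<lambda>x. x \<bullet> b) \<xi> (\<phi> p)"
    by (rule dir_deriv_cong[OF subspace_model o _ \<xi>]) (use p in \<open>auto simp: atlas_inv[OF at]\<close>)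
  also have "\<dots> = \<xi> \<bullet> b"
    by (rule dir_deriv_eq[OF subspace_model o _ \<xi>])
      (use p in \<open>auto intro: bounded_linear_imp_has_derivative bounded_linear_inner_left\<close>)
  finally show ?thesis using smooth_at_coord[OF at p] by (simp add: coord_vec_def)
qed

lemma coord_vec_eq_0:
  assumes at: "(U, \<phi>) \<in> atlas M" and p: "p \<in> U" and \<xi>: "\<xi> \<in> model M" and 0: "coord_vec U \<phi> p \<xi> = 0"
  shows "\<xi> = 0"
  using coord_vec_coord[OF at p \<xi>, of \<xi>] 0 by simp

text \<open>Hadamard's lemma writes f near p as a constant plus products whose first factor is a
  coordinate difference vanishing at p. The Leibniz rule then leaves only the values of v on the
  coordinates, and these are the components of \<xi>.\<close>

lemma tangent_vector_coord:
  assumes at: "(U, \<phi>) \<in> atlas M" and p: "p \<in> U" and v: "v \<in> tangent_space M p"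
  shows "\<exists>\<xi>\<in>model M. v = coord_vec U \<phi> p \<xi>"
proof -
  obtain B where B: "finite B" "B \<subseteq> model M" "\<forall>w\<in>model M. (\<Sum>b\<in>B. (w \<bullet> b) *\<^sub>R b) = w"
    using subspace_orthonormal_basis[OF subspace_model] by (elim exE conjE) (rule that)
  define \<xi> where "\<xi> = (\<Sum>b\<in>B. v (\<lambda>q. \<phi> q \<bullet> b) *\<^sub>R b)"
  have \<xi>: "\<xi> \<in> model M"
    unfolding \<xi>_def by (intro subspace_sum[OF subspace_model] subspace_scale[OF subspace_model]) (use B(2) in auto)
  have pM: "p \<in> topspace (mtop M)" using p openin_subset[OF atlas_open[OF at]] by auto
  have "v = coord_vec U \<phi> p \<xi>"
  proof (rule tangent_eqI[OF v coord_vec_tangent[OF at p \<xi>]])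
    fix f assume f: "smooth_at M p f"
    obtain S0 where S0: "openin (top_of_set (model M)) S0" "\<phi> p \<in> S0" "S0 \<subseteq> \<phi> ` U"
      "smooth_on (model M) S0 (f \<circ> inv_into U \<phi>)" "smooth_on (model M) S0 (f \<circ> inv_into U \<phi>)"
      by (rule smooth_at_chart[OF at p f f])
    obtain r where r: "r > 0" "\<And>y. y \<in> model M \<Longrightarrow> dist y (\<phi> p) < r \<Longrightarrow> y \<in> S0"
      using S0(1,2) unfolding openin_euclidean_subtopology_iff by auto
    \<comment> \<open>The integration along segments in Hadamard's lemma asks for a convex
      domain.\<close>
    define S where "S = model M \<inter> ball (\<phi> p) r"
    have SS0: "S \<subseteq> S0" using r(2) by (auto simp: S_def dist_commute)
    have So: "openin (top_of_set (model M)) S" unfolding S_def by (rule openin_open_Int) (rule open_ball)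
    have cv: "convex S" unfolding S_def using subspace_imp_convex[OF subspace_model] convex_ball by (rule convex_Int)
    have "\<phi> p \<in> model M" using S0(1,2) openin_imp_subset by auto
    then have pS: "\<phi> p \<in> S" using r(1) by (simp add: S_def)
    have sm: "smooth_on (model M) S (f \<circ> inv_into U \<phi>)" by (rule smooth_on_subset[OF S0(4) SS0])
    obtain h where h: "\<And>b. b \<in> B \<Longrightarrow> smooth_on (model M) S (h b)"
      "\<And>b. b \<in> B \<Longrightarrow> h b (\<phi> p) = dir_deriv (f \<circ> inv_into U \<phi>) b (\<phi> p)"
      "\<And>x. x \<in> S \<Longrightarrow> (f \<circ> inv_into U \<phi>) x = (f \<circ> inv_into U \<phi>) (\<phi> p) + (\<Sum>b\<in>B. ((x - \<phi> p) \<bullet> b) * h b x)"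
      by (rule hadamard[OF subspace_model So cv pS sm B(2,3)]) (rule that)
    define W where "W = {q\<in>U. \<phi> q \<in> S}"
    have W: "openin (mtop M) W" "p \<in> W" "W \<subseteq> U"
      using chart_open_preimage[OF atlas_chart[OF at] So] p pS by (auto simp: W_def)
    have hs: "smooth_at M p (\<lambda>q. h b (\<phi> q))" if b: "b \<in> B" for b
    proof (rule smooth_atI[OF W(1,2) smooth_fun_chartI[OF at W(1,3)]])
      have WS: "\<phi> ` W \<subseteq> S" by (auto simp: W_def)
      have "h b x = ((\<lambda>q. h b (\<phi> q)) \<circ> inv_into U \<phi>) x" if "x \<in> \<phi> ` W" for x
        using that W(3) by (auto simp: atlas_inv[OF at] subset_iff)
      from iffD1[OF smooth_on_cong[OF this] smooth_on_subset[OF h(1)[OF b] WS]]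
      show "smooth_on (model M) (\<phi> ` W) ((\<lambda>q. h b (\<phi> q)) \<circ> inv_into U \<phi>)" .
    qed
    have ds: "smooth_at M p (\<lambda>q. \<phi> q \<bullet> b - \<phi> p \<bullet> b)" for b
      by (intro smooth_at_diff smooth_at_coord[OF at p] smooth_at_const pM)
    have vd: "v (\<lambda>q. \<phi> q \<bullet> b - \<phi> p \<bullet> b) = v (\<lambda>q. \<phi> q \<bullet> b)" for b
      using tangent_add[OF v smooth_at_coord[OF at p, of b] smooth_at_const[OF pM, of "- (\<phi> p \<bullet> b)"]] tangent_const[OF v]
      by simp
    have "v f = v (\<lambda>q. f p + (\<Sum>b\<in>B. (\<phi> q \<bullet> b - \<phi> p \<bullet> b) * h b (\<phi> q)))"
    proof (rule tangent_local[OF v W(1,2)])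
      fix q assume q: "q \<in> W"
      then show "f q = f p + (\<Sum>b\<in>B. (\<phi> q \<bullet> b - \<phi> p \<bullet> b) * h b (\<phi> q))"
        using h(3)[of "\<phi> q"] atlas_inv[OF at] p by (simp add: W_def inner_diff_left)
    qed
    also have "\<dots> = v (\<lambda>q. \<Sum>b\<in>B. (\<phi> q \<bullet> b - \<phi> p \<bullet> b) * h b (\<phi> q))"
      using tangent_add[OF v smooth_at_const[OF pM] smooth_at_sum[OF pM smooth_at_mult[OF ds hs]]] tangent_const[OF v] by simp
    also have "\<dots> = (\<Sum>b\<in>B. v (\<lambda>q. (\<phi> q \<bullet> b - \<phi> p \<bullet> b) * h b (\<phi> q)))"
      by (rule tangent_sum[OF v pM]) (rule smooth_at_mult[OF ds hs])
    also have "\<dots> = (\<Sum>b\<in>B. v (\<lambda>q. \<phi> q \<bullet> b) * coord_vec U \<phi> p b f)"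
      using tangent_mult[OF v ds hs] vd h(2) f by (intro sum.cong refl) (simp add: coord_vec_def)
    also have "\<dots> = coord_vec U \<phi> p \<xi> f"
    proof -
      have "coord_vec U \<phi> p \<xi> = (\<Sum>b\<in>B. v (\<lambda>q. \<phi> q \<bullet> b) *\<^sub>R coord_vec U \<phi> p b)"
        unfolding \<xi>_def by (rule linear_on_sum[OF coord_vec_linear[OF at p] subspace_model]) (use B(2) in auto)
      then show ?thesis by (simp add: sum_fun_apply)
    qed
    finally show "v f = coord_vec U \<phi> p \<xi> f" .
  qed
  then show ?thesis using \<xi> by auto
qed

text \<open>Through this the dimensions of the model spaces, and with them the codimension, reach
  the Lie algebras.\<close>

lemma tangent_space_basis:
  assumes "p \<in> topspace (mtop M)"
  shows "\<exists>C. finite C \<and> independent C \<and> card C = dim (model M) \<and> span C = tangent_space M p"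
proof -
  obtain U \<phi> where at: "(U, \<phi>) \<in> atlas M" and p: "p \<in> U" by (rule obtain_chart[OF assms])
  obtain B where B: "finite B" "card B = dim (model M)" "independent B" "span B = model M"
    using subspace_orthonormal_basis[OF subspace_model] by (elim exE conjE) (rule that)
  have 0: "\<xi> = 0" if "\<xi> \<in> model M" "coord_vec U \<phi> p \<xi> = 0" for \<xi> by (rule coord_vec_eq_0[OF at p that])
  note b = linear_on_injective_basis[OF B(3,4) coord_vec_linear[OF at p] 0]
  have "coord_vec U \<phi> p ` model M = tangent_space M p"
    using tangent_vector_coord[OF at p] coord_vec_tangent[OF at p] by auto
  then show ?thesis using b B by (intro exI[of _ "coord_vec U \<phi> p ` B"] conjI) auto
qed

end

lemma differential_tangent:
  fixes M :: "('a, 'e::euclidean_space) manifold" and N :: "('b, 'f::euclidean_space) manifold"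
  assumes M: "smooth_mfd M" and N: "smooth_mfd N" and v: "v \<in> tangent_space M p" and Fp: "F p = q"
    and F: "\<And>f. smooth_at N q f \<Longrightarrow> smooth_at M p (\<lambda>x. f (F x))"
  shows "differential M F q N v \<in> tangent_space N q"
proof -
  interpret M: smooth_mfd M by (rule M)
  interpret N: smooth_mfd N by (rule N)
  show ?thesis
    by (rule N.tangent_spaceI)
      (simp_all add: differential_def comp_def N.smooth_at_add N.smooth_at_mult N.smooth_at_scale
        M.tangent_add[OF v F F] M.tangent_mult[OF v F F] M.tangent_scale[OF v F] Fp[symmetric])
qed

section \<open>Vector fields and their Lie bracket\<close>

context smooth_mfd
begin

lemma vector_fieldD:
  assumes "X \<in> vector_fields M"
  shows "p \<in> topspace (mtop M) \<Longrightarrow> X p \<in> tangent_space M p" "p \<notin> topspace (mtop M) \<Longrightarrow> X p = 0"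
    "openin (mtop M) W \<Longrightarrow> smooth_fun M W f \<Longrightarrow> smooth_fun M W (\<lambda>p. X p f)"
  using assms by (auto simp: vector_fields_def)

lemma vector_field_tangent: "X \<in> vector_fields M \<Longrightarrow> X p \<in> tangent_space M p"
  using vector_fieldD(1,2)[of X p] subspace_0[OF subspace_tangent, of p] by (cases "p \<in> topspace (mtop M)") auto

lemma vector_fieldI:
  assumes "\<And>p. p \<in> topspace (mtop M) \<Longrightarrow> X p \<in> tangent_space M p" "\<And>p. p \<notin> topspace (mtop M) \<Longrightarrow> X p = 0"
    "\<And>W f. openin (mtop M) W \<Longrightarrow> smooth_fun M W f \<Longrightarrow> smooth_fun M W (\<lambda>p. X p f)"
  shows "X \<in> vector_fields M"
  using assms by (auto simp: vector_fields_def)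

lemma vector_field_smooth_at:
  assumes X: "X \<in> vector_fields M" and f: "smooth_at M p f"
  shows "smooth_at M p (\<lambda>q. X q f)"
proof -
  obtain W where W: "openin (mtop M) W" "p \<in> W" "smooth_fun M W f" using f by (auto simp: smooth_at_def)
  show ?thesis by (rule smooth_atI[OF W(1,2) vector_fieldD(3)[OF X W(1,3)]])
qed

lemma subspace_vector_fields: "subspace (vector_fields M)"
proof (rule subspaceI)
  show "0 \<in> vector_fields M"
    by (rule vector_fieldI) (auto simp: zero_fun_def subspace_0[OF subspace_tangent, unfolded zero_fun_def] smooth_fun_const)
  fix X Y c assume X: "X \<in> vector_fields M"
  show "c *\<^sub>R X \<in> vector_fields M"
    by (rule vector_fieldI)
      (auto simp: vector_fieldD[OF X] subspace_scale[OF subspace_tangent] intro!: smooth_fun_scale)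
  assume Y: "Y \<in> vector_fields M"
  show "X + Y \<in> vector_fields M"
    by (rule vector_fieldI)
      (auto simp: vector_fieldD[OF X] vector_fieldD[OF Y] subspace_add[OF subspace_tangent] intro!: smooth_fun_add)
qed

lemma vf_mult_vector_field:
  assumes X: "X \<in> vector_fields M" and a: "smooth_fun M (topspace (mtop M)) a"
  shows "vf_mult a X \<in> vector_fields M"
proof (rule vector_fieldI)
  fix W f assume W: "openin (mtop M) W" "smooth_fun M W f"
  show "smooth_fun M W (\<lambda>p. vf_mult a X p f)"
    using smooth_fun_mult[OF smooth_fun_subset[OF a openin_subset[OF W(1)]] vector_fieldD(3)[OF X W]]
    by (simp add: vf_mult_def)
qed (auto simp: vf_mult_def vector_fieldD[OF X] subspace_scale[OF subspace_tangent])

text \<open>The mixed terms of the second-order product rule are symmetric in X and Y, so they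
  cancel in the bracket. The inner rule holds only at points where f and h are smooth, hence
  locality is applied before the outer one.\<close>

lemma vector_field_local_rules:
  assumes X: "X \<in> vector_fields M" and Y: "Y \<in> vector_fields M" and f: "smooth_at M p f" and h: "smooth_at M p h"
  shows "X p (\<lambda>q. Y q (\<lambda>r. f r + h r)) = X p (\<lambda>q. Y q f) + X p (\<lambda>q. Y q h)"
    and "X p (\<lambda>q. Y q (\<lambda>r. f r * h r)) = f p * X p (\<lambda>q. Y q h) + Y p h * X p f + h p * X p (\<lambda>q. Y q f) + Y p f * X p h"
proof -
  note Xp = vector_field_tangent[OF X]
  obtain W where W: "openin (mtop M) W" "p \<in> W" "smooth_fun M W f" "smooth_fun M W h"
    by (rule smooth_at_binary[OF f h]) (rule that)
  have s: "smooth_at M q f" "smooth_at M q h" if "q \<in> W" for q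
    using smooth_atI[OF W(1) that W(3)] smooth_atI[OF W(1) that W(4)] .
  note Yf = vector_field_smooth_at[OF Y f] and Yh = vector_field_smooth_at[OF Y h]
  have "X p (\<lambda>q. Y q (\<lambda>r. f r + h r)) = X p (\<lambda>q. Y q f + Y q h)"
    by (rule tangent_local[OF Xp W(1,2)]) (simp add: tangent_add[OF vector_field_tangent[OF Y]] s)
  then show "X p (\<lambda>q. Y q (\<lambda>r. f r + h r)) = X p (\<lambda>q. Y q f) + X p (\<lambda>q. Y q h)"
    using tangent_add[OF Xp Yf Yh] by simp
  have "X p (\<lambda>q. Y q (\<lambda>r. f r * h r)) = X p (\<lambda>q. f q * Y q h + h q * Y q f)"
    by (rule tangent_local[OF Xp W(1,2)]) (simp add: tangent_mult[OF vector_field_tangent[OF Y]] s)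
  then show "X p (\<lambda>q. Y q (\<lambda>r. f r * h r)) = f p * X p (\<lambda>q. Y q h) + Y p h * X p f + h p * X p (\<lambda>q. Y q f) + Y p f * X p h"
    using tangent_add[OF Xp smooth_at_mult[OF f Yh] smooth_at_mult[OF h Yf]] tangent_mult[OF Xp f Yh] tangent_mult[OF Xp h Yf]
    by simp
qed

lemma lie_bracket_apply:
  "smooth_at M p f \<Longrightarrow> lie_bracket M X Y p f = X p (\<lambda>q. Y q f) - Y p (\<lambda>q. X q f)"
  by (simp add: lie_bracket_def)

lemma lie_bracket_vector_field:
  assumes X: "X \<in> vector_fields M" and Y: "Y \<in> vector_fields M"
  shows "lie_bracket M X Y \<in> vector_fields M"
proof (rule vector_fieldI)
  fix p assume "p \<in> topspace (mtop M)"
  show "lie_bracket M X Y p \<in> tangent_space M p"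
  proof (rule tangent_spaceI)
    fix f h assume f: "smooth_at M p f" and h: "smooth_at M p h"
    note r = vector_field_local_rules[OF X Y f h] vector_field_local_rules[OF Y X f h]
    show "lie_bracket M X Y p (\<lambda>q. f q + h q) = lie_bracket M X Y p f + lie_bracket M X Y p h"
      using smooth_at_add[OF f h] f h r by (simp add: lie_bracket_apply)
    show "lie_bracket M X Y p (\<lambda>q. f q * h q) = f p * lie_bracket M X Y p h + h p * lie_bracket M X Y p f"
      using smooth_at_mult[OF f h] f h r by (simp add: lie_bracket_apply algebra_simps)
  next
    fix f c assume f: "smooth_at M p f"
    have pM: "p \<in> topspace (mtop M)" using smooth_at_mem[OF f] .
    \<comment> \<open>Homogeneity is the product rule with a constant first factor.\<close>
    have c: "smooth_at M p (\<lambda>q. c)" by (rule smooth_at_const[OF pM])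
    have z: "Z p (\<lambda>q. Z' q (\<lambda>r. c)) = 0" if "Z \<in> vector_fields M" "Z' \<in> vector_fields M" for Z Z'
      using tangent_const[OF vector_field_tangent[OF that(2)]] tangent_const[OF vector_field_tangent[OF that(1)]] by simp
    show "lie_bracket M X Y p (\<lambda>q. c * f q) = c * lie_bracket M X Y p f"
      using vector_field_local_rules(2)[OF X Y c f] vector_field_local_rules(2)[OF Y X c f] smooth_at_scale[OF f, of c] f
        z[OF X Y] z[OF Y X] tangent_const[OF vector_field_tangent[OF X]] tangent_const[OF vector_field_tangent[OF Y]]
      by (simp add: lie_bracket_apply algebra_simps)
  qed (simp add: lie_bracket_def)
next
  fix p assume "p \<notin> topspace (mtop M)"
  then have "\<not> smooth_at M p f" for f using smooth_at_mem by blast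
  then show "lie_bracket M X Y p = 0" by (simp add: lie_bracket_def zero_fun_def)
next
  fix W f assume W: "openin (mtop M) W" and f: "smooth_fun M W f"
  have "smooth_fun M W (\<lambda>p. X p (\<lambda>q. Y q f) - Y p (\<lambda>q. X q f))"
    by (intro smooth_fun_diff vector_fieldD(3)[OF X W] vector_fieldD(3)[OF Y W] f)
  then show "smooth_fun M W (\<lambda>p. lie_bracket M X Y p f)"
    by (rule smooth_fun_cong) (simp add: lie_bracket_apply smooth_atI[OF W _ f])
qed

lemma lie_alg_vector_fields: "lie_alg (vector_fields M) (lie_bracket M)"
proof
  fix X Y Z c assume X: "X \<in> vector_fields M" and Z: "Z \<in> vector_fields M"
  note Xt = vector_field_tangent[OF X] and Zt = vector_field_tangent[OF Z]
  show "lie_bracket M (c *\<^sub>R X) Z = c *\<^sub>R lie_bracket M X Z"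
    by (intro ext) (simp add: lie_bracket_def tangent_scale[OF Zt vector_field_smooth_at[OF X]] algebra_simps)
  assume Y: "Y \<in> vector_fields M"
  note Yt = vector_field_tangent[OF Y]
  show "lie_bracket M X Y \<in> vector_fields M" by (rule lie_bracket_vector_field[OF X Y])
  show "lie_bracket M (X + Y) Z = lie_bracket M X Z + lie_bracket M Y Z"
    by (intro ext) (simp add: lie_bracket_def tangent_add[OF Zt vector_field_smooth_at[OF X] vector_field_smooth_at[OF Y]])
  show "lie_bracket M X Y = - lie_bracket M Y X"
    by (intro ext) (simp add: lie_bracket_def)
  \<comment> \<open>The bracket equals the difference of second-order terms only where f is smooth,
    that is, near p; locality suffices.\<close>
  have iter: "A p (\<lambda>q. lie_bracket M B C q f) = A p (\<lambda>q. B q (\<lambda>r. C r f)) - A p (\<lambda>q. C q (\<lambda>r. B r f))"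
    if A: "A \<in> vector_fields M" and B: "B \<in> vector_fields M" and C: "C \<in> vector_fields M" and f: "smooth_at M p f" for A B C p f
  proof -
    note At = vector_field_tangent[OF A]
    obtain W where W: "openin (mtop M) W" "p \<in> W" "smooth_fun M W f" using f by (auto simp: smooth_at_def)
    have "A p (\<lambda>q. lie_bracket M B C q f) = A p (\<lambda>q. B q (\<lambda>r. C r f) + (- 1) * C q (\<lambda>r. B r f))"
      by (rule tangent_local[OF At W(1,2)]) (simp add: lie_bracket_apply smooth_atI[OF W(1) _ W(3)])
    also have "\<dots> = A p (\<lambda>q. B q (\<lambda>r. C r f)) + A p (\<lambda>q. (- 1) * C q (\<lambda>r. B r f))"
      by (intro tangent_add[OF At] smooth_at_scale vector_field_smooth_at[OF B] vector_field_smooth_at[OF C] f)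
    also have "A p (\<lambda>q. (- 1) * C q (\<lambda>r. B r f)) = (- 1) * A p (\<lambda>q. C q (\<lambda>r. B r f))"
      by (intro tangent_scale[OF At] vector_field_smooth_at[OF B] vector_field_smooth_at[OF C] f)
    finally show ?thesis by simp
  qed
  show "lie_bracket M X (lie_bracket M Y Z) = lie_bracket M (lie_bracket M X Y) Z + lie_bracket M Y (lie_bracket M X Z)"
  proof (intro ext)
    fix p f
    show "lie_bracket M X (lie_bracket M Y Z) p f = (lie_bracket M (lie_bracket M X Y) Z + lie_bracket M Y (lie_bracket M X Z)) p f"
    proof (cases "smooth_at M p f")
      case True
      note v = vector_field_smooth_at[OF _ True]
      show ?thesis
        using True v[OF X] v[OF Y] v[OF Z]
        by (simp add: lie_bracket_apply iter X Y Z)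
    qed (simp add: lie_bracket_def)
  qed
qed (rule subspace_vector_fields)

end


section \<open>Left-invariant vector fields\<close>

text \<open>Fixing one variable is composition with an affine embedding.\<close>

lemma
  fixes E :: "'e::euclidean_space set" and E' :: "'f::euclidean_space set" and F :: "'e \<times> 'f \<Rightarrow> 'g::real_normed_vector"
  assumes E: "subspace E" "subspace E'" and Om: "openin (top_of_set (E \<times> E')) Om" and F: "smooth_on (E \<times> E') Om F"
  shows slice_smooth_left: "y0 \<in> E' \<Longrightarrow> smooth_on E {x\<in>E. (x, y0) \<in> Om} (\<lambda>x. F (x, y0))"
    and slice_smooth_right: "x0 \<in> E \<Longrightarrow> smooth_on E' {y\<in>E'. (x0, y) \<in> Om} (\<lambda>y. F (x0, y))"
proof -
  obtain Om' where Om': "open Om'" "Om = (E \<times> E') \<inter> Om'" using Om unfolding openin_open by auto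
  have EE: "subspace (E \<times> E')" by (rule subspace_Times[OF E])
  have o1: "openin (top_of_set E) {x\<in>E. (x, y0) \<in> Om}" if "y0 \<in> E'" for y0
  proof -
    have "open ((\<lambda>x. (x, y0)) -` Om')" by (rule open_vimage[OF Om'(1)]) (intro continuous_intros)
    then have "openin (top_of_set E) (E \<inter> (\<lambda>x. (x, y0)) -` Om')" by (rule openin_open_Int)
    moreover have "E \<inter> (\<lambda>x. (x, y0)) -` Om' = {x\<in>E. (x, y0) \<in> Om}" using that Om'(2) by auto
    ultimately show ?thesis by simp
  qed
  have o2: "openin (top_of_set E') {y\<in>E'. (x0, y) \<in> Om}" if "x0 \<in> E" for x0
  proof -
    have "open ((\<lambda>y. (x0, y)) -` Om')" by (rule open_vimage[OF Om'(1)]) (intro continuous_intros)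
    then have "openin (top_of_set E') (E' \<inter> (\<lambda>y. (x0, y)) -` Om')" by (rule openin_open_Int)
    moreover have "E' \<inter> (\<lambda>y. (x0, y)) -` Om' = {y\<in>E'. (x0, y) \<in> Om}" using that Om'(2) by auto
    ultimately show ?thesis by simp
  qed
  show "smooth_on E {x\<in>E. (x, y0) \<in> Om} (\<lambda>x. F (x, y0))" if y0: "y0 \<in> E'" for y0
  proof (rule smooth_on_compose[OF E(1) o1[OF y0] EE Om _ _ F])
    have "smooth_on E {x\<in>E. (x, y0) \<in> Om} (\<lambda>x. (x, 0) + (0, y0))"
      by (intro smooth_on_add smooth_on_const smooth_on_bounded_linear bounded_linear_Pair bounded_linear_ident bounded_linear_zero)
    then show "smooth_on E {x\<in>E. (x, y0) \<in> Om} (\<lambda>x. (x, y0))" by simp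
  qed auto
  show "smooth_on E' {y\<in>E'. (x0, y) \<in> Om} (\<lambda>y. F (x0, y))" if x0: "x0 \<in> E" for x0
  proof (rule smooth_on_compose[OF E(2) o2[OF x0] EE Om _ _ F])
    have "smooth_on E' {y\<in>E'. (x0, y) \<in> Om} (\<lambda>y. (0, y) + (x0, 0))"
      by (intro smooth_on_add smooth_on_const smooth_on_bounded_linear bounded_linear_Pair bounded_linear_ident bounded_linear_zero)
    then show "smooth_on E' {y\<in>E'. (x0, y) \<in> Om} (\<lambda>y. (x0, y))" by simp
  qed auto
qed

lemma dir_deriv_second:
  "dir_deriv F (0, \<eta>) (x, y) = dir_deriv (\<lambda>y. F (x, y)) \<eta> y"
  by (simp add: dir_deriv_def)

lemma lie_alg_subalgebra:
  assumes "lie_alg L br" "subspace L'" "L' \<subseteq> L" "\<And>x y. x \<in> L' \<Longrightarrow> y \<in> L' \<Longrightarrow> br x y \<in> L'"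
  shows "lie_alg L' br"
proof -
  interpret lie_alg L br by (rule assms(1))
  have L: "x \<in> L" if "x \<in> L'" for x using that assms(3) by auto
  show ?thesis
    by unfold_locales (fact assms(2) assms(4) | rule add_left scale_left antisym jacobi; rule L; assumption)+
qed

locale lie_grp =
  fixes G :: "('a, 'b) monoid_scheme" and M :: "('a, 'e::euclidean_space) manifold"
  assumes lie_group: "lie_group G M"

sublocale lie_grp \<subseteq> smooth_mfd M
  using lie_group by unfold_locales (simp add: lie_group_def)

sublocale lie_grp \<subseteq> grp: group G
  using lie_group by (simp add: lie_group_def)

context lie_grp
begin

lemma topspace_carrier: "topspace (mtop M) = carrier G"
  using lie_group by (simp add: lie_group_def)

lemma one_mem: "\<one>\<^bsub>G\<^esub> \<in> topspace (mtop M)" by (simp add: topspace_carrier)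

lemma open_carrier: "openin (mtop M) (carrier G)"
  using openin_topspace[of "mtop M"] by (simp add: topspace_carrier)

lemma open_left_mult:
  assumes a: "a \<in> carrier G" and W: "openin (mtop M) W"
  shows "openin (mtop M) {q\<in>carrier G. a \<otimes>\<^bsub>G\<^esub> q \<in> W}"
proof -
  have m: "continuous_map (prod_topology (mtop M) (mtop M)) (mtop M) (\<lambda>(x, y). x \<otimes>\<^bsub>G\<^esub> y)"
    using lie_group by (simp add: lie_group_def smooth_map_def prod_manifold_def)
  have "continuous_map (mtop M) (prod_topology (mtop M) (mtop M)) (\<lambda>q. (a, q))"
    using a by (intro continuous_map_pairedI) (auto simp: topspace_carrier)
  from continuous_map_compose[OF this m]
  have "continuous_map (mtop M) (mtop M) (\<lambda>q. a \<otimes>\<^bsub>G\<^esub> q)" by (simp add: comp_def)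
  from openin_continuous_map_preimage[OF this W] show ?thesis by (simp add: topspace_carrier)
qed

text \<open>The group law in charts, followed by a test function. Fixing the first variable gives
  smoothness of left translations; differentiating in the second at the identity gives smoothness of
  left-invariant fields.\<close>

lemma mult_chart:
  assumes U: "(U, \<phi>) \<in> atlas M" and V: "(V, \<psi>) \<in> atlas M" and W: "openin (mtop M) W" and f: "smooth_fun M W f"
  defines "F \<equiv> (\<lambda>z. f (inv_into U \<phi> (fst z) \<otimes>\<^bsub>G\<^esub> inv_into V \<psi> (snd z)))"
  obtains Om where "openin (top_of_set (model M \<times> model M)) Om" "smooth_on (model M \<times> model M) Om F"
    "\<And>p q. p \<in> U \<Longrightarrow> q \<in> V \<Longrightarrow> p \<otimes>\<^bsub>G\<^esub> q \<in> W \<Longrightarrow> (\<phi> p, \<psi> q) \<in> Om"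
proof -
  let ?P = "prod_manifold M M"
  let ?m = "\<lambda>(x, y). x \<otimes>\<^bsub>G\<^esub> y"
  define Om where "Om = map_prod \<phi> \<psi> ` ((U \<times> V) \<inter> ?m -` W)"
  have P: "mtop ?P = prod_topology (mtop M) (mtop M)" "model ?P = model M \<times> model M"
    by (simp_all add: prod_manifold_def)
  have at: "(U \<times> V, map_prod \<phi> \<psi>) \<in> atlas ?P"
    using U V by (auto simp: prod_manifold_def)
  have c: "chart (mtop ?P) (model ?P) (U \<times> V, map_prod \<phi> \<psi>)"
    unfolding P by (rule chart_prod[OF atlas_chart[OF U] atlas_chart[OF V]])
  have sp: "subspace (model ?P)" unfolding P by (rule subspace_Times[OF subspace_model subspace_model])
  have sm: "smooth_map ?P M ?m" using lie_group by (simp add: lie_group_def)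
  note r = smooth_map_compose_chart[OF sp c at smooth_manifold sm W f]
  have Om: "openin (top_of_set (model M \<times> model M)) Om"
    using chart_open_image[OF c r(1)] unfolding P Om_def by (simp add: Int_assoc[symmetric])
  have "(f \<circ> ?m \<circ> inv_into (U \<times> V) (map_prod \<phi> \<psi>)) z = F z" if "z \<in> Om" for z
  proof -
    obtain p q where z: "z = (\<phi> p, \<psi> q)" "p \<in> U" "q \<in> V" using \<open>z \<in> Om\<close> by (auto simp: Om_def)
    have "inv_into (U \<times> V) (map_prod \<phi> \<psi>) z = (p, q)"
      using inv_into_f_f[OF chart_inj[OF c], of "(p, q)"] z by simp
    then show ?thesis using z by (simp add: F_def atlas_inv[OF U] atlas_inv[OF V])
  qed
  then have "smooth_on (model M \<times> model M) Om (f \<circ> ?m \<circ> inv_into (U \<times> V) (map_prod \<phi> \<psi>)) \<longleftrightarrow> smooth_on (model M \<times> model M) Om F"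
    by (rule smooth_on_cong)
  moreover have "smooth_on (model M \<times> model M) Om (f \<circ> ?m \<circ> inv_into (U \<times> V) (map_prod \<phi> \<psi>))"
    using r(2) unfolding P Om_def .
  ultimately have sF: "smooth_on (model M \<times> model M) Om F" by (rule iffD1)
  show thesis by (rule that[OF Om sF]) (auto simp: Om_def)
qed

lemma left_mult_smooth:
  assumes a: "a \<in> carrier G" and p: "p \<in> carrier G" and f: "smooth_at M (a \<otimes>\<^bsub>G\<^esub> p) f"
  shows "smooth_at M p (\<lambda>q. f (a \<otimes>\<^bsub>G\<^esub> q))"
proof -
  obtain W where W: "openin (mtop M) W" "a \<otimes>\<^bsub>G\<^esub> p \<in> W" "smooth_fun M W f" using f by (auto simp: smooth_at_def)
  obtain U \<phi> where U: "(U, \<phi>) \<in> atlas M" "a \<in> U" using obtain_chart a topspace_carrier by metis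
  obtain V \<psi> where V: "(V, \<psi>) \<in> atlas M" "p \<in> V" using obtain_chart p topspace_carrier by metis
  obtain Om where Om: "openin (top_of_set (model M \<times> model M)) Om"
    "smooth_on (model M \<times> model M) Om (\<lambda>z. f (inv_into U \<phi> (fst z) \<otimes>\<^bsub>G\<^esub> inv_into V \<psi> (snd z)))"
    "\<And>p q. p \<in> U \<Longrightarrow> q \<in> V \<Longrightarrow> p \<otimes>\<^bsub>G\<^esub> q \<in> W \<Longrightarrow> (\<phi> p, \<psi> q) \<in> Om"
    by (rule mult_chart[OF U(1) V(1) W(1,3)]) (rule that)
  have a': "\<phi> a \<in> model M" and V': "\<psi> ` V \<subseteq> model M"
    using openin_imp_subset[OF chart_openin(2)[OF atlas_chart[OF U(1)]]] U(2)
      openin_imp_subset[OF chart_openin(2)[OF atlas_chart[OF V(1)]]] by auto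
  define W' where "W' = V \<inter> {q\<in>carrier G. a \<otimes>\<^bsub>G\<^esub> q \<in> W}"
  have W': "openin (mtop M) W'"
    unfolding W'_def by (rule openin_Int[OF atlas_open[OF V(1)] open_left_mult[OF a W(1)]])
  have "smooth_on (model M) (\<psi> ` W') (\<lambda>y. f (inv_into U \<phi> (\<phi> a) \<otimes>\<^bsub>G\<^esub> inv_into V \<psi> y))"
  proof (rule smooth_on_subset)
    show "smooth_on (model M) {y\<in>model M. (\<phi> a, y) \<in> Om} (\<lambda>y. f (inv_into U \<phi> (\<phi> a) \<otimes>\<^bsub>G\<^esub> inv_into V \<psi> y))"
      using slice_smooth_right[OF subspace_model subspace_model Om(1,2) a'] by simp
    show "\<psi> ` W' \<subseteq> {y\<in>model M. (\<phi> a, y) \<in> Om}" using V' Om(3)[OF U(2)] by (auto simp: W'_def)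
  qed
  then have "smooth_on (model M) (\<psi> ` W') ((\<lambda>q. f (a \<otimes>\<^bsub>G\<^esub> q)) \<circ> inv_into V \<psi>)"
    by (simp add: comp_def atlas_inv[OF U])
  then have "smooth_fun M W' (\<lambda>q. f (a \<otimes>\<^bsub>G\<^esub> q))"
    by (rule smooth_fun_chartI[OF V(1) W', rotated]) (simp add: W'_def)
  then show ?thesis using V(2) W(2) p by (intro smooth_atI[OF W']) (auto simp: W'_def)
qed

text \<open>The translates of \<open>v\<close> by the differentials of left multiplications. The
  guards implement the conventions that tangent vectors vanish on functions not smooth at the point
  and fields vanish off the manifold.\<close>

definition left_inv_field :: "'a tvec \<Rightarrow> 'a vfield"
  where "left_inv_field v = (\<lambda>p f. if p \<in> carrier G \<and> smooth_at M p f then v (\<lambda>q. f (p \<otimes>\<^bsub>G\<^esub> q)) else 0)"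

lemma left_mult_smooth_one: "p \<in> carrier G \<Longrightarrow> smooth_at M p f \<Longrightarrow> smooth_at M \<one>\<^bsub>G\<^esub> (\<lambda>q. f (p \<otimes>\<^bsub>G\<^esub> q))"
  using left_mult_smooth[of p "\<one>\<^bsub>G\<^esub>" f] by simp

text \<open>With \<xi> the coordinates of v at the identity, the value on f at p is, in charts, the
  partial derivative along \<xi> in the second variable, taken at the identity, of the smooth
  function of \<open>mult_chart\<close>.\<close>

lemma left_inv_field_vector_field:
  assumes v: "v \<in> tangent_space M \<one>\<^bsub>G\<^esub>"
  shows "left_inv_field v \<in> vector_fields M"
proof (rule vector_fieldI)
  fix p assume "p \<in> topspace (mtop M)"
  then have p: "p \<in> carrier G" by (simp add: topspace_carrier)
  note s = left_mult_smooth_one[OF p]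
  show "left_inv_field v p \<in> tangent_space M p"
    by (rule tangent_spaceI)
      (simp_all add: left_inv_field_def p smooth_at_add smooth_at_mult smooth_at_scale
        tangent_add[OF v s s] tangent_mult[OF v s s] tangent_scale[OF v s])
next
  fix p assume "p \<notin> topspace (mtop M)"
  then show "left_inv_field v p = 0" by (simp add: left_inv_field_def topspace_carrier zero_fun_def)
next
  fix W f assume W: "openin (mtop M) W" and f: "smooth_fun M W f"
  obtain V \<psi> where V: "(V, \<psi>) \<in> atlas M" "\<one>\<^bsub>G\<^esub> \<in> V" using obtain_chart one_mem by metis
  obtain \<xi> where \<xi>: "\<xi> \<in> model M" "v = coord_vec V \<psi> \<one>\<^bsub>G\<^esub> \<xi>" using tangent_vector_coord[OF V v] by auto
  show "smooth_fun M W (\<lambda>p. left_inv_field v p f)"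
  proof (rule smooth_fun_local[OF W])
    fix p0 assume p0: "p0 \<in> W"
    have "p0 \<in> topspace (mtop M)" using p0 openin_subset[OF W] by auto
    then obtain U \<phi> where U: "(U, \<phi>) \<in> atlas M" "p0 \<in> U" by (rule obtain_chart)
    define F where "F = (\<lambda>z. f (inv_into U \<phi> (fst z) \<otimes>\<^bsub>G\<^esub> inv_into V \<psi> (snd z)))"
    obtain Om where Om: "openin (top_of_set (model M \<times> model M)) Om"
      "smooth_on (model M \<times> model M) Om (\<lambda>z. f (inv_into U \<phi> (fst z) \<otimes>\<^bsub>G\<^esub> inv_into V \<psi> (snd z)))"
      "\<And>p q. p \<in> U \<Longrightarrow> q \<in> V \<Longrightarrow> p \<otimes>\<^bsub>G\<^esub> q \<in> W \<Longrightarrow> (\<phi> p, \<psi> q) \<in> Om"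
      by (rule mult_chart[OF U(1) V(1) W f]) (rule that)
    note Om = Om[folded F_def]
    have y0: "\<psi> \<one>\<^bsub>G\<^esub> \<in> model M" and U': "\<phi> ` U \<subseteq> model M"
      using openin_imp_subset[OF chart_openin(2)[OF atlas_chart[OF U(1)]]] V(2)
        openin_imp_subset[OF chart_openin(2)[OF atlas_chart[OF V(1)]]] by auto
    have EE: "subspace (model M \<times> model M)" by (rule subspace_Times[OF subspace_model subspace_model])
    have d: "smooth_on (model M \<times> model M) Om (dir_deriv F (0, \<xi>))"
      by (rule smooth_on_dir_deriv[OF EE Om(1,2)]) (use \<xi>(1) subspace_0[OF subspace_model] in auto)
    define W' where "W' = U \<inter> W"
    have W': "openin (mtop M) W'" "W' \<subseteq> U" "p0 \<in> W'"
      unfolding W'_def using atlas_open[OF U(1)] W U(2) p0 by (auto intro: openin_Int)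
    have W'c: "p \<in> carrier G" "p \<in> U" "p \<in> W" if "p \<in> W'" for p
      using that openin_subset[OF W] by (auto simp: W'_def topspace_carrier)
    have "smooth_on (model M) (\<phi> ` W') (\<lambda>x. dir_deriv F (0, \<xi>) (x, \<psi> \<one>\<^bsub>G\<^esub>))"
    proof (rule smooth_on_subset)
      show "smooth_on (model M) {x\<in>model M. (x, \<psi> \<one>\<^bsub>G\<^esub>) \<in> Om} (\<lambda>x. dir_deriv F (0, \<xi>) (x, \<psi> \<one>\<^bsub>G\<^esub>))"
        by (rule slice_smooth_left[OF subspace_model subspace_model Om(1) d y0])
      show "\<phi> ` W' \<subseteq> {x\<in>model M. (x, \<psi> \<one>\<^bsub>G\<^esub>) \<in> Om}"
        using U' Om(3)[OF _ V(2)] W'c by auto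
    qed
    moreover have "dir_deriv F (0, \<xi>) (x, \<psi> \<one>\<^bsub>G\<^esub>) = ((\<lambda>p. left_inv_field v p f) \<circ> inv_into U \<phi>) x" if "x \<in> \<phi> ` W'" for x
    proof -
      obtain p where p: "x = \<phi> p" "p \<in> W'" using \<open>x \<in> \<phi> ` W'\<close> by auto
      note c = W'c[OF p(2)]
      have sf: "smooth_at M p f" by (rule smooth_atI[OF W c(3) f])
      have "((\<lambda>p. left_inv_field v p f) \<circ> inv_into U \<phi>) x = v (\<lambda>q. f (p \<otimes>\<^bsub>G\<^esub> q))"
        using p(1) c sf by (simp add: atlas_inv[OF U(1)] left_inv_field_def)
      also have "\<dots> = dir_deriv (\<lambda>y. f (p \<otimes>\<^bsub>G\<^esub> inv_into V \<psi> y)) \<xi> (\<psi> \<one>\<^bsub>G\<^esub>)"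
        unfolding \<xi>(2) using left_mult_smooth_one[OF c(1) sf] by (simp add: coord_vec_def comp_def)
      also have "\<dots> = dir_deriv F (0, \<xi>) (x, \<psi> \<one>\<^bsub>G\<^esub>)"
        unfolding dir_deriv_second by (simp add: F_def p(1) atlas_inv[OF U(1) c(2)])
      finally show ?thesis by simp
    qed
    ultimately have "smooth_on (model M) (\<phi> ` W') ((\<lambda>p. left_inv_field v p f) \<circ> inv_into U \<phi>)"
      using smooth_on_cong[of "\<phi> ` W'" "\<lambda>x. dir_deriv F (0, \<xi>) (x, \<psi> \<one>\<^bsub>G\<^esub>)" "(\<lambda>p. left_inv_field v p f) \<circ> inv_into U \<phi>" "model M"]
      by simp
    from smooth_fun_chartI[OF U(1) W'(1,2) this] W'(1,3)
    show "\<exists>W'. openin (mtop M) W' \<and> p0 \<in> W' \<and> smooth_fun M W' (\<lambda>p. left_inv_field v p f)"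
      by (intro exI[of _ W'] conjI)
  qed
qed

lemma lie_algebra_vector_field: "X \<in> lie_algebra G M \<Longrightarrow> X \<in> vector_fields M"
  by (simp add: lie_algebra_def)

lemma lie_algebra_apply:
  assumes X: "X \<in> lie_algebra G M" and a: "a \<in> carrier G" and p: "p \<in> carrier G" and f: "smooth_at M (a \<otimes>\<^bsub>G\<^esub> p) f"
  shows "X (a \<otimes>\<^bsub>G\<^esub> p) f = X p (\<lambda>q. f (a \<otimes>\<^bsub>G\<^esub> q))"
proof -
  have "X (a \<otimes>\<^bsub>G\<^esub> p) = left_translation G M a p (X p)" using X a p by (simp add: lie_algebra_def)
  then have "X (a \<otimes>\<^bsub>G\<^esub> p) f = left_translation G M a p (X p) f" by simp
  then show ?thesis using f by (simp add: differential_def comp_def)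
qed

lemma lie_algebraI:
  assumes X: "X \<in> vector_fields M"
    and inv: "\<And>a p f. a \<in> carrier G \<Longrightarrow> p \<in> carrier G \<Longrightarrow> smooth_at M (a \<otimes>\<^bsub>G\<^esub> p) f \<Longrightarrow> X (a \<otimes>\<^bsub>G\<^esub> p) f = X p (\<lambda>q. f (a \<otimes>\<^bsub>G\<^esub> q))"
  shows "X \<in> lie_algebra G M"
  unfolding lie_algebra_def
proof (intro CollectI conjI ballI ext)
  fix a p f assume a: "a \<in> carrier G" and p: "p \<in> carrier G"
  show "left_translation G M a p (X p) f = X (a \<otimes>\<^bsub>G\<^esub> p) f"
    using inv[OF a p, of f] tangent_undef[OF vector_field_tangent[OF X], of "a \<otimes>\<^bsub>G\<^esub> p" f]
    by (simp add: differential_def comp_def)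
qed (rule X)

lemma lie_algebra_eq_left_inv_field:
  assumes X: "X \<in> lie_algebra G M"
  shows "X = left_inv_field (X \<one>\<^bsub>G\<^esub>)"
proof (intro ext)
  fix p f
  note Xv = lie_algebra_vector_field[OF X]
  show "X p f = left_inv_field (X \<one>\<^bsub>G\<^esub>) p f"
  proof (cases "p \<in> carrier G \<and> smooth_at M p f")
    case True
    then show ?thesis using lie_algebra_apply[OF X, of p "\<one>\<^bsub>G\<^esub>" f] by (simp add: left_inv_field_def)
  next
    case False
    then have "\<not> smooth_at M p f" using smooth_at_mem topspace_carrier by auto
    then show ?thesis using tangent_undef[OF vector_field_tangent[OF Xv]] by (simp add: left_inv_field_def)
  qed
qed

lemma left_inv_field_lie_algebra:
  assumes v: "v \<in> tangent_space M \<one>\<^bsub>G\<^esub>"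
  shows "left_inv_field v \<in> lie_algebra G M"
proof (rule lie_algebraI[OF left_inv_field_vector_field[OF v]])
  fix a p f assume a: "a \<in> carrier G" and p: "p \<in> carrier G" and f: "smooth_at M (a \<otimes>\<^bsub>G\<^esub> p) f"
  have "left_inv_field v (a \<otimes>\<^bsub>G\<^esub> p) f = v (\<lambda>q. f (a \<otimes>\<^bsub>G\<^esub> p \<otimes>\<^bsub>G\<^esub> q))"
    using a p f by (simp add: left_inv_field_def)
  \<comment> \<open>Associativity is available on the group only, so the two functions agree just on
    the open set \<open>carrier G\<close>.\<close>
  also have "\<dots> = v (\<lambda>q. f (a \<otimes>\<^bsub>G\<^esub> (p \<otimes>\<^bsub>G\<^esub> q)))"
    by (rule tangent_local[OF v open_carrier]) (use a p in \<open>auto simp: grp.m_assoc\<close>)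
  also have "\<dots> = left_inv_field v p (\<lambda>q. f (a \<otimes>\<^bsub>G\<^esub> q))"
    using p left_mult_smooth[OF a p f] by (simp add: left_inv_field_def)
  finally show "left_inv_field v (a \<otimes>\<^bsub>G\<^esub> p) f = left_inv_field v p (\<lambda>q. f (a \<otimes>\<^bsub>G\<^esub> q))" .
qed

lemma left_inv_field_one:
  assumes v: "v \<in> tangent_space M \<one>\<^bsub>G\<^esub>"
  shows "left_inv_field v \<one>\<^bsub>G\<^esub> = v"
proof (rule tangent_eqI[OF vector_field_tangent[OF left_inv_field_vector_field[OF v]] v])
  fix f assume f: "smooth_at M \<one>\<^bsub>G\<^esub> f"
  have "v (\<lambda>q. f (\<one>\<^bsub>G\<^esub> \<otimes>\<^bsub>G\<^esub> q)) = v f"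
    by (rule tangent_local[OF v open_carrier]) auto
  then show "left_inv_field v \<one>\<^bsub>G\<^esub> f = v f" using f by (simp add: left_inv_field_def)
qed

lemma subspace_lie_algebra: "subspace (lie_algebra G M)"
proof (rule subspaceI)
  note S = subspace_vector_fields
  show "0 \<in> lie_algebra G M" by (rule lie_algebraI) (auto simp: subspace_0[OF S])
  fix X Y c assume X: "X \<in> lie_algebra G M"
  note Xv = lie_algebra_vector_field[OF X]
  show "c *\<^sub>R X \<in> lie_algebra G M"
    by (rule lie_algebraI[OF subspace_scale[OF S Xv]]) (simp add: lie_algebra_apply[OF X])
  assume Y: "Y \<in> lie_algebra G M"
  note Yv = lie_algebra_vector_field[OF Y]
  show "X + Y \<in> lie_algebra G M"
    by (rule lie_algebraI[OF subspace_add[OF S Xv Yv]]) (simp add: lie_algebra_apply[OF X] lie_algebra_apply[OF Y])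
qed

lemma lie_bracket_lie_algebra:
  assumes X: "X \<in> lie_algebra G M" and Y: "Y \<in> lie_algebra G M"
  shows "lie_bracket M X Y \<in> lie_algebra G M"
proof -
  note Xv = lie_algebra_vector_field[OF X] and Yv = lie_algebra_vector_field[OF Y]
  have iter: "A (a \<otimes>\<^bsub>G\<^esub> p) (\<lambda>q. B q f) = A p (\<lambda>q. B q (\<lambda>r. f (a \<otimes>\<^bsub>G\<^esub> r)))"
    if A: "A \<in> lie_algebra G M" and B: "B \<in> lie_algebra G M" and a: "a \<in> carrier G" and p: "p \<in> carrier G"
      and f: "smooth_at M (a \<otimes>\<^bsub>G\<^esub> p) f" for A B a p f
  proof -
    note Av = lie_algebra_vector_field[OF A] and Bv = lie_algebra_vector_field[OF B]
    obtain W where W: "openin (mtop M) W" "a \<otimes>\<^bsub>G\<^esub> p \<in> W" "smooth_fun M W f" using f by (auto simp: smooth_at_def)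
    have "A (a \<otimes>\<^bsub>G\<^esub> p) (\<lambda>q. B q f) = A p (\<lambda>q. B (a \<otimes>\<^bsub>G\<^esub> q) f)"
      by (rule lie_algebra_apply[OF A a p vector_field_smooth_at[OF Bv f]])
    also have "\<dots> = A p (\<lambda>q. B q (\<lambda>r. f (a \<otimes>\<^bsub>G\<^esub> r)))"
    proof (rule tangent_local[OF vector_field_tangent[OF Av] open_left_mult[OF a W(1)]])
      show "p \<in> {q \<in> carrier G. a \<otimes>\<^bsub>G\<^esub> q \<in> W}" using p W(2) by simp
      fix q assume "q \<in> {q \<in> carrier G. a \<otimes>\<^bsub>G\<^esub> q \<in> W}"
      then have q: "q \<in> carrier G" "a \<otimes>\<^bsub>G\<^esub> q \<in> W" by auto
      show "B (a \<otimes>\<^bsub>G\<^esub> q) f = B q (\<lambda>r. f (a \<otimes>\<^bsub>G\<^esub> r))"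
        by (rule lie_algebra_apply[OF B a q(1) smooth_atI[OF W(1) q(2) W(3)]])
    qed
    finally show ?thesis .
  qed
  show ?thesis
  proof (rule lie_algebraI[OF lie_bracket_vector_field[OF Xv Yv]])
    fix a p f assume a: "a \<in> carrier G" and p: "p \<in> carrier G" and f: "smooth_at M (a \<otimes>\<^bsub>G\<^esub> p) f"
    show "lie_bracket M X Y (a \<otimes>\<^bsub>G\<^esub> p) f = lie_bracket M X Y p (\<lambda>q. f (a \<otimes>\<^bsub>G\<^esub> q))"
      using iter[OF X Y a p f] iter[OF Y X a p f] f left_mult_smooth[OF a p f] by (simp add: lie_bracket_apply)
  qed
qed

lemma lie_alg_lie_algebra: "lie_alg (lie_algebra G M) (lie_bracket M)"
  by (rule lie_alg_subalgebra[OF lie_alg_vector_fields subspace_lie_algebra _ lie_bracket_lie_algebra])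
    (auto intro: lie_algebra_vector_field)

lemma lie_algebra_eq_0:
  assumes X: "X \<in> lie_algebra G M" and p: "p \<in> carrier G" and 0: "X p = 0"
  shows "X = 0"
proof -
  note Xv = lie_algebra_vector_field[OF X]
  have "X \<one>\<^bsub>G\<^esub> = 0"
  proof (rule tangent_eqI[OF vector_field_tangent[OF Xv] subspace_0[OF subspace_tangent]])
    fix f assume f: "smooth_at M \<one>\<^bsub>G\<^esub> f"
    show "X \<one>\<^bsub>G\<^esub> f = 0 f"
      using lie_algebra_apply[OF X grp.inv_closed[OF p] p, of f] f p 0 by simp
  qed
  then have "X = left_inv_field 0" using lie_algebra_eq_left_inv_field[OF X] by simp
  then show ?thesis by (simp add: left_inv_field_def fun_eq_iff)
qed

text \<open>Translate w back to the identity and spread it from there.\<close>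

lemma lie_algebra_eval_surj:
  assumes p: "p \<in> carrier G" and w: "w \<in> tangent_space M p"
  shows "\<exists>X\<in>lie_algebra G M. X p = w"
proof -
  let ?i = "inv\<^bsub>G\<^esub> p"
  have i: "?i \<in> carrier G" "?i \<otimes>\<^bsub>G\<^esub> p = \<one>\<^bsub>G\<^esub>" using p by auto
  have s: "smooth_at M p (\<lambda>x. f (?i \<otimes>\<^bsub>G\<^esub> x))" if "smooth_at M \<one>\<^bsub>G\<^esub> f" for f
    using left_mult_smooth[OF i(1) p, of f] that i(2) by simp
  define v where "v = differential M (\<lambda>x. ?i \<otimes>\<^bsub>G\<^esub> x) \<one>\<^bsub>G\<^esub> M w"
  have v: "v \<in> tangent_space M \<one>\<^bsub>G\<^esub>"
    unfolding v_def
  proof (rule differential_tangent[OF smooth_mfd_axioms smooth_mfd_axioms w])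
    show "?i \<otimes>\<^bsub>G\<^esub> p = \<one>\<^bsub>G\<^esub>" by (rule i(2))
    show "smooth_at M p (\<lambda>x. f (?i \<otimes>\<^bsub>G\<^esub> x))" if "smooth_at M \<one>\<^bsub>G\<^esub> f" for f using s[OF that] .
  qed
  have "left_inv_field v p = w"
  proof (rule tangent_eqI[OF vector_field_tangent[OF left_inv_field_vector_field[OF v]] w])
    fix f assume f: "smooth_at M p f"
    have "left_inv_field v p f = w (\<lambda>q. f (p \<otimes>\<^bsub>G\<^esub> (?i \<otimes>\<^bsub>G\<^esub> q)))"
      using p f left_mult_smooth_one[OF p f] by (simp add: left_inv_field_def v_def differential_def comp_def)
    also have "\<dots> = w f"
      by (rule tangent_local[OF w open_carrier p]) (use p in \<open>simp add: grp.m_assoc[symmetric]\<close>)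
    finally show "left_inv_field v p f = w f" .
  qed
  then show ?thesis using left_inv_field_lie_algebra[OF v] by auto
qed

lemma lie_algebra_basis:
  "\<exists>C. finite C \<and> independent C \<and> card C = dim (model M) \<and> span C = lie_algebra G M"
proof -
  let ?T = "tangent_space M \<one>\<^bsub>G\<^esub>"
  obtain B where B: "finite B" "independent B" "card B = dim (model M)" "span B = ?T"
    using tangent_space_basis[OF one_mem] by (elim exE conjE) (rule that)
  have lin: "linear_on ?T left_inv_field"
    by (rule linear_onI; intro ext) (simp_all add: left_inv_field_def)
  have 0: "v = 0" if "v \<in> ?T" "left_inv_field v = 0" for v
    using left_inv_field_one[OF that(1)] that(2) by simp
  note b = linear_on_injective_basis[OF B(2,4) lin 0]
  have "left_inv_field ` ?T = lie_algebra G M"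
  proof
    show "left_inv_field ` ?T \<subseteq> lie_algebra G M" using left_inv_field_lie_algebra by auto
    show "lie_algebra G M \<subseteq> left_inv_field ` ?T"
    proof
      fix X assume X: "X \<in> lie_algebra G M"
      show "X \<in> left_inv_field ` ?T"
        using lie_algebra_eq_left_inv_field[OF X] vector_field_tangent[OF lie_algebra_vector_field[OF X]] by (rule image_eqI)
    qed
  qed
  then show ?thesis using b B by (intro exI[of _ "left_inv_field ` B"] conjI) auto
qed

lemma left_invariant_metric_const:
  assumes g: "left_invariant_metric G M g" and X: "X \<in> lie_algebra G M" and Y: "Y \<in> lie_algebra G M" and p: "p \<in> carrier G"
  shows "g p (X p) (Y p) = g \<one>\<^bsub>G\<^esub> (X \<one>\<^bsub>G\<^esub>) (Y \<one>\<^bsub>G\<^esub>)"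
proof -
  have t: "Z \<one>\<^bsub>G\<^esub> \<in> tangent_space M \<one>\<^bsub>G\<^esub>" "left_translation G M p \<one>\<^bsub>G\<^esub> (Z \<one>\<^bsub>G\<^esub>) = Z p" if "Z \<in> lie_algebra G M" for Z
  proof -
    show "Z \<one>\<^bsub>G\<^esub> \<in> tangent_space M \<one>\<^bsub>G\<^esub>" by (rule vector_field_tangent[OF lie_algebra_vector_field[OF that]])
    have "left_translation G M p \<one>\<^bsub>G\<^esub> (Z \<one>\<^bsub>G\<^esub>) = Z (p \<otimes>\<^bsub>G\<^esub> \<one>\<^bsub>G\<^esub>)"
      using that p grp.one_closed unfolding lie_algebra_def by fast
    then show "left_translation G M p \<one>\<^bsub>G\<^esub> (Z \<one>\<^bsub>G\<^esub>) = Z p" using p by simp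
  qed
  have "g (p \<otimes>\<^bsub>G\<^esub> \<one>\<^bsub>G\<^esub>) (left_translation G M p \<one>\<^bsub>G\<^esub> (X \<one>\<^bsub>G\<^esub>)) (left_translation G M p \<one>\<^bsub>G\<^esub> (Y \<one>\<^bsub>G\<^esub>))
      = g \<one>\<^bsub>G\<^esub> (X \<one>\<^bsub>G\<^esub>) (Y \<one>\<^bsub>G\<^esub>)"
    using g p t(1)[OF X] t(1)[OF Y] grp.one_closed unfolding left_invariant_metric_def by blast
  then show ?thesis using t(2)[OF X] t(2)[OF Y] p by simp
qed

end


section \<open>Lie subgroups\<close>

text \<open>An ideal is pulled back along T. The derived series correspond at each stage, and
  injectivity carries solvability back.\<close>

lemma semisimple_linear_image:
  assumes T: "linear T" and L: "subspace L" and inj: "inj_on T L"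
    and closed: "\<And>x y. x \<in> L \<Longrightarrow> y \<in> L \<Longrightarrow> br x y \<in> L"
    and hom: "\<And>x y. x \<in> L \<Longrightarrow> y \<in> L \<Longrightarrow> T (br x y) = br' (T x) (T y)"
    and ss: "semisimple br L"
  shows "semisimple br' (T ` L)"
  unfolding semisimple_def
proof (intro allI impI)
  fix I assume "lie_ideal br' (T ` L) I \<and> solvable br' I"
  then have I: "subspace I" "I \<subseteq> T ` L" "\<And>x y. x \<in> T ` L \<Longrightarrow> y \<in> I \<Longrightarrow> br' x y \<in> I" and sol: "solvable br' I"
    by (auto simp: lie_ideal_def)
  define J where "J = {x\<in>L. T x \<in> I}"
  have TJ: "T ` J = I" using I(2) by (auto simp: J_def)
  have Jsub: "subspace J"
    unfolding J_def
    by (rule subspaceI)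
      (auto simp: subspace_0[OF L] subspace_0[OF I(1)] linear_0[OF T] linear_add[OF T] linear_scale[OF T]
        intro: subspace_add[OF L] subspace_add[OF I(1)] subspace_scale[OF L] subspace_scale[OF I(1)])
  have ideal: "lie_ideal br L J"
    unfolding lie_ideal_def using Jsub I(3) closed hom by (auto simp: J_def)
  have ds: "derived_series br J k \<subseteq> L \<and> T ` derived_series br J k = derived_series br' I k" for k
  proof (induction k)
    case 0
    then show ?case using TJ by (auto simp: J_def)
  next
    case (Suc k)
    let ?S = "{br x y | x y. x \<in> derived_series br J k \<and> y \<in> derived_series br J k}"
    have SL: "?S \<subseteq> L" using Suc closed by auto
    have "T ` ?S = {br' x y | x y. x \<in> derived_series br' I k \<and> y \<in> derived_series br' I k}"
    proof
      show "T ` ?S \<subseteq> {br' x y | x y. x \<in> derived_series br' I k \<and> y \<in> derived_series br' I k}"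
      proof
        fix z assume "z \<in> T ` ?S"
        then obtain x y where xy: "z = T (br x y)" "x \<in> derived_series br J k" "y \<in> derived_series br J k" by auto
        have "z = br' (T x) (T y)" using xy hom[of x y] Suc by auto
        moreover have "T x \<in> derived_series br' I k" "T y \<in> derived_series br' I k" using xy Suc by auto
        ultimately show "z \<in> {br' x y | x y. x \<in> derived_series br' I k \<and> y \<in> derived_series br' I k}" by auto
      qed
      show "{br' x y | x y. x \<in> derived_series br' I k \<and> y \<in> derived_series br' I k} \<subseteq> T ` ?S"
      proof
        fix z assume "z \<in> {br' x y | x y. x \<in> derived_series br' I k \<and> y \<in> derived_series br' I k}"
        then obtain x' y' where xy': "z = br' x' y'" "x' \<in> derived_series br' I k" "y' \<in> derived_series br' I k" by auto
        then obtain x y where xy: "x' = T x" "y' = T y" "x \<in> derived_series br J k" "y \<in> derived_series br J k"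
          using Suc by (metis imageE)
        have "x \<in> L" "y \<in> L" using xy(3,4) Suc by auto
        then have "z = T (br x y)" using xy'(1) xy(1,2) hom by simp
        then show "z \<in> T ` ?S" using xy by auto
      qed
    qed
    then have "T ` span ?S = span {br' x y | x y. x \<in> derived_series br' I k \<and> y \<in> derived_series br' I k}"
      using linear_span_image[OF T, of ?S] by simp
    then show ?case using span_minimal[OF SL L] by simp
  qed
  obtain k where k: "derived_series br' I k = {0}" using sol by (auto simp: solvable_def)
  have "derived_series br J k \<subseteq> {0}"
  proof
    fix x assume x: "x \<in> derived_series br J k"
    then have "T x = 0" using ds[of k] k by auto
    then have "T x = T 0" using linear_0[OF T] by simp
    then show "x \<in> {0}" using inj_onD[OF inj, of x 0] x ds[of k] subspace_0[OF L] by auto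
  qed
  moreover have "derived_series br J k \<noteq> {}" using ds[of k] k by auto
  ultimately have "derived_series br J k = {0}" by auto
  then have "solvable br J" by (auto simp: solvable_def)
  then have "J = {0}" using ss ideal by (auto simp: semisimple_def)
  then show "I = {0}" using TJ linear_0[OF T] by auto
qed

lemma orthonormal_independent:
  fixes b :: "'v::real_vector \<Rightarrow> 'v \<Rightarrow> real" and Z :: "nat \<Rightarrow> 'v"
  assumes L: "subspace L" and b: "\<And>y. y \<in> L \<Longrightarrow> linear_on L (\<lambda>x. b x y)" and Z: "\<And>i. i < n \<Longrightarrow> Z i \<in> L"
    and ortho: "\<And>i j. i < n \<Longrightarrow> j < n \<Longrightarrow> b (Z i) (Z j) = (if i = j then \<epsilon> i else 0)" and eps: "\<And>i. i < n \<Longrightarrow> \<epsilon> i \<noteq> (0::real)"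
  shows "inj_on Z {..<n}" "independent (Z ` {..<n})"
proof -
  show inj: "inj_on Z {..<n}"
  proof (rule inj_onI)
    fix i j assume ij: "i \<in> {..<n}" "j \<in> {..<n}" "Z i = Z j"
    then have "b (Z i) (Z j) = \<epsilon> i" using ortho[of i i] by simp
    then show "i = j" using ortho[of i j] eps[of i] ij by (auto split: if_splits)
  qed
  have "u v = 0" if 0: "(\<Sum>v\<in>Z ` {..<n}. u v *\<^sub>R v) = 0" and v: "v \<in> Z ` {..<n}" for u v
  proof -
    obtain j where j: "j < n" "v = Z j" using v by auto
    have "0 = b (\<Sum>i<n. u (Z i) *\<^sub>R Z i) (Z j)"
    proof -
      have "b (0 *\<^sub>R 0) (Z j) = 0 *\<^sub>R b 0 (Z j)" by (rule linear_onD(2)[OF b[OF Z[OF j(1)]] subspace_0[OF L]])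
      then show ?thesis using 0 by (simp add: sum.reindex[OF inj])
    qed
    also have "\<dots> = (\<Sum>i<n. u (Z i) *\<^sub>R b (Z i) (Z j))"
      by (rule linear_on_sum[OF b[OF Z[OF j(1)]] L]) (use Z in auto)
    also have "\<dots> = (\<Sum>i<n. if i = j then u (Z i) * \<epsilon> i else 0)"
      by (rule sum.cong) (use ortho j(1) in auto)
    also have "\<dots> = u (Z j) * \<epsilon> j" using j(1) by simp
    finally show ?thesis using eps[OF j(1)] j(2) by simp
  qed
  then have "\<not> (\<exists>u. (\<exists>v\<in>Z ` {..<n}. u v \<noteq> 0) \<and> (\<Sum>v\<in>Z ` {..<n}. u v *\<^sub>R v) = 0)" by auto
  then show "independent (Z ` {..<n})" using dependent_finite[of "Z ` {..<n}"] by simp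
qed

text \<open>Extending \<open>B\<close> to a maximal independent set adds at most two vectors; if
  fewer are added, x and y may coincide or be 0.\<close>

lemma codim_two_extension:
  assumes C: "finite C" "span C = L" and card: "card C \<le> card B + 2" and B: "independent B" "B \<subseteq> L"
  obtains x y where "x \<in> L" "y \<in> L" "L \<subseteq> span (insert x (insert y B))"
proof -
  have L: "subspace L" using C(2) subspace_span[of C] by simp
  obtain B' where B': "B \<subseteq> B'" "B' \<subseteq> L" "independent B'" "L \<subseteq> span B'"
    by (rule maximal_independent_subset_extend[OF B(2,1)]) (rule that)
  have fin: "finite B'" "card B' \<le> card C" using independent_span_bound[OF C(1) B'(3)] B'(2) C(2) by auto
  have "card (B' - B) \<le> 2" using card fin card_Diff_subset[OF finite_subset[OF B'(1) fin(1)] B'(1)] by simp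
  moreover have finD: "finite (B' - B)" using fin(1) by simp
  ultimately have "\<exists>x\<in>L. \<exists>y\<in>L. B' - B \<subseteq> {x, y}"
  proof -
    assume c: "card (B' - B) \<le> 2"
    consider "card (B' - B) = 0" | "card (B' - B) = 1" | "card (B' - B) = 2" using c by linarith
    then show ?thesis
    proof cases
      case 1
      then have "B' - B = {}" using finD by simp
      then show ?thesis using subspace_0[OF L] by (intro bexI[of _ 0]) auto
    next
      case 2
      then obtain x where x: "B' - B = {x}" by (auto simp: card_1_singleton_iff)
      then have "x \<in> L" using B'(2) by auto
      then show ?thesis using x by (intro bexI[of _ x]) auto
    next
      case 3
      then obtain x y where x: "B' - B = {x, y}" by (auto simp: card_2_iff)
      then have "x \<in> L" "y \<in> L" using B'(2) by auto
      then show ?thesis using x by (intro bexI[of _ x] bexI[of _ y]) auto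
    qed
  qed
  then obtain x y where xy: "x \<in> L" "y \<in> L" "B' - B \<subseteq> {x, y}" by auto
  have "B' \<subseteq> insert x (insert y B)" using xy(3) by auto
  then have "span B' \<subseteq> span (insert x (insert y B))" by (rule span_mono)
  then show thesis using that[OF xy(1,2)] B'(4) by auto
qed

section \<open>The Lie algebra of the subgroup inside that of the group\<close>

context lie_grp
begin

text \<open>\<open>Y\<close> is a field on the subgroup. Both groups share one type, so its value at
  the identity applies directly to functions on \<open>G\<close>, and the inclusion map does not
  appear.\<close>

definition extend_field :: "'a vfield \<Rightarrow> 'a vfield"
  where "extend_field Y = (\<lambda>p f. if p \<in> carrier G \<and> smooth_at M p f then Y \<one>\<^bsub>G\<^esub> (\<lambda>q. f (p \<otimes>\<^bsub>G\<^esub> q)) else 0)"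

lemma linear_extend_field: "linear extend_field"
  by (rule linearI; intro ext) (simp_all add: extend_field_def)

end

locale lie_subgrp = lie_grp G M for G :: "('a, 'b) monoid_scheme" and M :: "('a, 'e::euclidean_space) manifold" +
  fixes K :: "'a set" and N :: "('a, 'f::euclidean_space) manifold"
  assumes lie_subgroup: "lie_subgroup K N G M"

sublocale lie_subgrp \<subseteq> K: lie_grp "G\<lparr>carrier := K\<rparr>" N
  using lie_subgroup by unfold_locales (simp add: lie_subgroup_def)

context lie_subgrp
begin

lemma K_sub: "k \<in> K \<Longrightarrow> k \<in> carrier G"
  using lie_subgroup subgroup.mem_carrier by (auto simp: lie_subgroup_def)

lemma K_topspace: "topspace (mtop N) = K"
  using K.topspace_carrier by simp

lemma smooth_at_restrict:
  assumes k: "k \<in> K" and f: "smooth_at M k f"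
  shows "smooth_at N k f"
proof -
  obtain W where W: "openin (mtop M) W" "k \<in> W" "smooth_fun M W f" using f by (auto simp: smooth_at_def)
  have "k \<in> topspace (mtop N)" using k K_topspace by simp
  then obtain U \<phi> where U: "(U, \<phi>) \<in> atlas N" "k \<in> U" by (rule K.obtain_chart)
  have sm: "smooth_map N M (\<lambda>x. x)" using lie_subgroup by (simp add: lie_subgroup_def)
  note r = smooth_map_compose_chart[OF K.subspace_model K.atlas_chart[OF U(1)] U(1) smooth_manifold sm W(1,3)]
  have "smooth_fun N (U \<inter> (\<lambda>x. x) -` W) f"
    by (rule K.smooth_fun_chartI[OF U(1) r(1)]) (use r(2) in \<open>auto simp: comp_def\<close>)
  then show ?thesis using U(2) W(2) by (intro K.smooth_atI[OF r(1)]) auto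
qed

lemma K_tangent_one: "Y \<in> lie_algebra (G\<lparr>carrier := K\<rparr>) N \<Longrightarrow> Y \<one>\<^bsub>G\<^esub> \<in> tangent_space N \<one>\<^bsub>G\<^esub>"
  using K.vector_field_tangent[OF K.lie_algebra_vector_field] by simp

lemma one_K: "\<one>\<^bsub>G\<^esub> \<in> K"
  using lie_subgroup subgroup.one_closed by (auto simp: lie_subgroup_def)

lemma incl_tangent:
  assumes Y: "Y \<in> lie_algebra (G\<lparr>carrier := K\<rparr>) N"
  shows "differential N (\<lambda>x. x) \<one>\<^bsub>G\<^esub> M (Y \<one>\<^bsub>G\<^esub>) \<in> tangent_space M \<one>\<^bsub>G\<^esub>"
  by (rule differential_tangent[OF _ _ K_tangent_one[OF Y]])
    (auto intro: smooth_at_restrict one_K K.smooth_mfd_axioms smooth_mfd_axioms)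

lemma extend_field_eq:
  "extend_field Y = left_inv_field (differential N (\<lambda>x. x) \<one>\<^bsub>G\<^esub> M (Y \<one>\<^bsub>G\<^esub>))"
  by (intro ext) (auto simp: extend_field_def left_inv_field_def differential_def comp_def left_mult_smooth_one)

lemma extend_field_lie_algebra:
  "Y \<in> lie_algebra (G\<lparr>carrier := K\<rparr>) N \<Longrightarrow> extend_field Y \<in> lie_algebra G M"
  unfolding extend_field_eq by (rule left_inv_field_lie_algebra[OF incl_tangent])

text \<open>Says that \<open>Y\<close> and its extension are related by the inclusion, which is what
  the comparison of brackets rests on.\<close>

lemma extend_field_apply:
  assumes Y: "Y \<in> lie_algebra (G\<lparr>carrier := K\<rparr>) N" and k: "k \<in> K" and f: "smooth_at M k f"
  shows "extend_field Y k f = Y k f"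
  using K.lie_algebra_apply[OF Y, of k "\<one>\<^bsub>G\<^esub>" f] k f K_sub[OF k] one_K smooth_at_restrict[OF k f]
  by (simp add: extend_field_def)

text \<open>The inclusion is an immersion at the identity, and a left-invariant field is determined
  by its value there.\<close>

lemma inj_extend_field: "inj_on extend_field (lie_algebra (G\<lparr>carrier := K\<rparr>) N)"
  unfolding linear_inj_on_iff_eq_0[OF linear_extend_field K.subspace_lie_algebra]
proof (intro ballI impI)
  fix Y assume Y: "Y \<in> lie_algebra (G\<lparr>carrier := K\<rparr>) N" and 0: "extend_field Y = 0"
  let ?d = "differential N (\<lambda>x. x) \<one>\<^bsub>G\<^esub> M"
  have "?d (Y \<one>\<^bsub>G\<^esub>) = 0"
    using left_inv_field_one[OF incl_tangent[OF Y]] 0 by (simp add: extend_field_eq)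
  also have "0 = ?d 0" by (simp add: differential_def fun_eq_iff)
  finally have "?d (Y \<one>\<^bsub>G\<^esub>) = ?d 0" .
  then have "Y \<one>\<^bsub>G\<^esub> = 0"
    by (rule inj_onD[OF _ _ K_tangent_one[OF Y] subspace_0[OF K.subspace_tangent], rotated])
      (use lie_subgroup one_K in \<open>simp add: lie_subgroup_def\<close>)
  then show "Y = 0" using K.lie_algebra_eq_0[OF Y, of "\<one>\<^bsub>G\<^esub>"] one_K by simp
qed

lemma lie_subalgebra_eq: "lie_subalgebra K N G M = extend_field ` lie_algebra (G\<lparr>carrier := K\<rparr>) N"
proof
  show "lie_subalgebra K N G M \<subseteq> extend_field ` lie_algebra (G\<lparr>carrier := K\<rparr>) N"
  proof
    fix X assume "X \<in> lie_subalgebra K N G M"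
    then obtain Y where X: "X \<in> lie_algebra G M" and Y: "Y \<in> lie_algebra (G\<lparr>carrier := K\<rparr>) N"
      and XY: "X \<one>\<^bsub>G\<^esub> = differential N (\<lambda>x. x) \<one>\<^bsub>G\<^esub> M (Y \<one>\<^bsub>G\<^esub>)" by (auto simp: lie_subalgebra_def)
    have "X = extend_field Y" using lie_algebra_eq_left_inv_field[OF X] by (simp add: XY extend_field_eq)
    then show "X \<in> extend_field ` lie_algebra (G\<lparr>carrier := K\<rparr>) N" using Y by (rule image_eqI)
  qed
  show "extend_field ` lie_algebra (G\<lparr>carrier := K\<rparr>) N \<subseteq> lie_subalgebra K N G M"
    using extend_field_lie_algebra left_inv_field_one[OF incl_tangent]
    by (auto simp: lie_subalgebra_def extend_field_eq[symmetric] intro!: bexI)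
qed

text \<open>Fields related by the inclusion have related brackets: at the identity both sides are
  computed from derivatives along the subgroup, and left invariance extends the equality to all of
  G.\<close>

lemma extend_field_bracket:
  assumes X: "X \<in> lie_algebra (G\<lparr>carrier := K\<rparr>) N" and Y: "Y \<in> lie_algebra (G\<lparr>carrier := K\<rparr>) N"
  shows "extend_field (lie_bracket N X Y) = lie_bracket M (extend_field X) (extend_field Y)"
proof -
  note XY = K.lie_bracket_lie_algebra[OF X Y]
  let ?X = "extend_field X" and ?Y = "extend_field Y"
  note X' = extend_field_lie_algebra[OF X] and Y' = extend_field_lie_algebra[OF Y]
  have iter: "extend_field A \<one>\<^bsub>G\<^esub> (\<lambda>q. extend_field B q f) = A \<one>\<^bsub>G\<^esub> (\<lambda>q. B q f)"
    if A: "A \<in> lie_algebra (G\<lparr>carrier := K\<rparr>) N" and B: "B \<in> lie_algebra (G\<lparr>carrier := K\<rparr>) N" and f: "smooth_at M \<one>\<^bsub>G\<^esub> f" for A B f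
  proof -
    obtain W where W: "openin (mtop M) W" "\<one>\<^bsub>G\<^esub> \<in> W" "smooth_fun M W f" using f by (auto simp: smooth_at_def)
    have sm: "continuous_map (mtop N) (mtop M) (\<lambda>x. x)" using lie_subgroup by (simp add: lie_subgroup_def smooth_map_def)
    have W': "openin (mtop N) {x \<in> topspace (mtop N). x \<in> W}" by (rule openin_continuous_map_preimage[OF sm W(1)])
    have "extend_field A \<one>\<^bsub>G\<^esub> (\<lambda>q. extend_field B q f) = A \<one>\<^bsub>G\<^esub> (\<lambda>q. extend_field B q f)"
      by (rule extend_field_apply[OF A one_K vector_field_smooth_at[OF lie_algebra_vector_field[OF extend_field_lie_algebra[OF B]] f]])
    also have "\<dots> = A \<one>\<^bsub>G\<^esub> (\<lambda>q. B q f)"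
    proof (rule K.tangent_local[OF K_tangent_one[OF A] W'])
      show "\<one>\<^bsub>G\<^esub> \<in> {x \<in> topspace (mtop N). x \<in> W}" using one_K W(2) by (simp add: K_topspace)
      fix q assume "q \<in> {x \<in> topspace (mtop N). x \<in> W}"
      then have q: "q \<in> K" "q \<in> W" by (auto simp: K_topspace)
      show "extend_field B q f = B q f" by (rule extend_field_apply[OF B q(1) smooth_atI[OF W(1) q(2) W(3)]])
    qed
    finally show ?thesis .
  qed
  have "extend_field (lie_bracket N X Y) \<one>\<^bsub>G\<^esub> = lie_bracket M ?X ?Y \<one>\<^bsub>G\<^esub>"
  proof (rule tangent_eqI[OF vector_field_tangent vector_field_tangent])
    show "extend_field (lie_bracket N X Y) \<in> vector_fields M"
      by (rule lie_algebra_vector_field[OF extend_field_lie_algebra[OF XY]])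
    show "lie_bracket M ?X ?Y \<in> vector_fields M"
      by (rule lie_algebra_vector_field[OF lie_bracket_lie_algebra[OF X' Y']])
    fix f assume f: "smooth_at M \<one>\<^bsub>G\<^esub> f"
    show "extend_field (lie_bracket N X Y) \<one>\<^bsub>G\<^esub> f = lie_bracket M ?X ?Y \<one>\<^bsub>G\<^esub> f"
      using extend_field_apply[OF XY one_K f] iter[OF X Y f] iter[OF Y X f] f smooth_at_restrict[OF one_K f]
      by (simp add: lie_bracket_apply K.lie_bracket_apply)
  qed
  then show ?thesis
    using lie_algebra_eq_left_inv_field[OF extend_field_lie_algebra[OF XY]]
      lie_algebra_eq_left_inv_field[OF lie_bracket_lie_algebra[OF X' Y']] by simp
qed

lemma subspace_lie_subalgebra: "subspace (lie_subalgebra K N G M)"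
  unfolding lie_subalgebra_eq by (rule linear_subspace_image[OF linear_extend_field K.subspace_lie_algebra])

lemma lie_subalgebra_sub: "lie_subalgebra K N G M \<subseteq> lie_algebra G M"
  by (auto simp: lie_subalgebra_def)

lemma lie_alg_lie_subalgebra: "lie_alg (lie_subalgebra K N G M) (lie_bracket M)"
proof (rule lie_alg_subalgebra[OF lie_alg_lie_algebra subspace_lie_subalgebra lie_subalgebra_sub])
  fix X Y assume "X \<in> lie_subalgebra K N G M" "Y \<in> lie_subalgebra K N G M"
  then show "lie_bracket M X Y \<in> lie_subalgebra K N G M"
    unfolding lie_subalgebra_eq using K.lie_bracket_lie_algebra by (auto simp: extend_field_bracket[symmetric])
qed

lemma lie_subalgebra_basis:
  "\<exists>C. finite C \<and> independent C \<and> card C = dim (model N) \<and> span C = lie_subalgebra K N G M"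
proof -
  obtain B where B: "finite B" "independent B" "card B = dim (model N)" "span B = lie_algebra (G\<lparr>carrier := K\<rparr>) N"
    using K.lie_algebra_basis by (elim exE conjE) (rule that)
  have lin: "linear_on (lie_algebra (G\<lparr>carrier := K\<rparr>) N) extend_field"
    using linear_add[OF linear_extend_field] linear_scale[OF linear_extend_field] by (intro linear_onI)
  have 0: "Y = 0" if "Y \<in> lie_algebra (G\<lparr>carrier := K\<rparr>) N" "extend_field Y = 0" for Y
    using inj_extend_field that unfolding linear_inj_on_iff_eq_0[OF linear_extend_field K.subspace_lie_algebra] by simp
  note b = linear_on_injective_basis[OF B(2,4) lin 0]
  show ?thesis using b B by (intro exI[of _ "extend_field ` B"] conjI) (auto simp: lie_subalgebra_eq)
qed

lemma semisimple_lie_subalgebra: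
  assumes "semisimple_lie_group (G\<lparr>carrier := K\<rparr>) N"
  shows "semisimple (lie_bracket M) (lie_subalgebra K N G M)"
  unfolding lie_subalgebra_eq
proof (rule semisimple_linear_image[OF linear_extend_field K.subspace_lie_algebra inj_extend_field])
  show "semisimple (lie_bracket N) (lie_algebra (G\<lparr>carrier := K\<rparr>) N)"
    using assms by (simp add: semisimple_lie_group_def)
qed (auto intro: K.lie_bracket_lie_algebra extend_field_bracket)

lemma generated_foliation_eq:
  assumes p: "p \<in> carrier G"
  shows "generated_foliation K N G M p = (\<lambda>X. X p) ` lie_subalgebra K N G M"
proof -
  have "left_translation G M p \<one>\<^bsub>G\<^esub> (X \<one>\<^bsub>G\<^esub>) = X p" if "X \<in> lie_subalgebra K N G M" for X
  proof -
    have "X \<in> lie_algebra G M" using that lie_subalgebra_sub by auto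
    then have "left_translation G M p \<one>\<^bsub>G\<^esub> (X \<one>\<^bsub>G\<^esub>) = X (p \<otimes>\<^bsub>G\<^esub> \<one>\<^bsub>G\<^esub>)"
      using p grp.one_closed unfolding lie_algebra_def by fast
    then show ?thesis using p by simp
  qed
  then show ?thesis unfolding generated_foliation_def by (intro image_cong) auto
qed

end


section \<open>Conformal foliations generated by semisimple subgroups\<close>

theorem theorem1p4:
  fixes G :: "('a, 'b) monoid_scheme" and M :: "('a, 'e::euclidean_space) manifold"
    and K :: "'a set" and N :: "('a, 'f::euclidean_space) manifold"
    and g :: "'a metric_tensor" and nabla :: "'a connection"
  assumes "lie_group G M"
    and "left_invariant_metric G M g"
    and "levi_civita M g nabla"
    and "lie_subgroup K N G M"
    and "dim (model M) = dim (model N) + 2"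
    and "nondegenerate_on_subalgebra G g (lie_subalgebra K N G M)"
    and "conformal_foliation M g nabla (generated_foliation K N G M)"
    and "semisimple_lie_group (G\<lparr>carrier := K\<rparr>) N"
  shows "minimal_foliation M g nabla (generated_foliation K N G M)"
  unfolding minimal_foliation_def
proof (intro allI impI ballI)
  fix U m \<epsilon> V p
  let ?D = "generated_foliation K N G M" and ?h = "lie_algebra G M" and ?k = "lie_subalgebra K N G M"
    and ?br = "lie_bracket M"
  assume frame: "orthonormal_frame_on M g ?D U m \<epsilon> V" and pU: "p \<in> U"
  interpret lie_subgrp G M K N
    using assms(1,4) by unfold_locales
  interpret VF: lie_alg "vector_fields M" ?br by (rule lie_alg_vector_fields)
  interpret h: lie_alg ?h ?br by (rule lie_alg_lie_algebra)
  interpret k: lie_alg ?k ?br by (rule lie_alg_lie_subalgebra)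
  have op: "openin (mtop M) U" and eps: "\<And>i. i < m \<Longrightarrow> \<epsilon> i = -1 \<or> \<epsilon> i = 1"
    and Vsec: "\<And>i. i < m \<Longrightarrow> V i \<in> sections M ?D"
    and Vspan: "span ((\<lambda>i. V i p) ` {..<m}) = ?D p"
    and Vort: "\<And>i j. i < m \<Longrightarrow> j < m \<Longrightarrow> metric_on g (V i) (V j) p = (if i = j then \<epsilon> i else 0)"
    using frame pU by (auto simp: orthonormal_frame_on_def)
  have p: "p \<in> carrier G" using op pU openin_subset topspace_carrier by auto
  have pM: "p \<in> topspace (mtop M)" using p topspace_carrier by simp
  let ?T = "tangent_space M p"
  have hvf: "X \<in> vector_fields M" if "X \<in> ?h" for X using lie_algebra_vector_field[OF that] .
  have kh: "X \<in> ?h" if "X \<in> ?k" for X using lie_subalgebra_sub that by auto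
  have hT: "X p \<in> ?T" if "X \<in> ?h" for X by (rule vector_field_tangent[OF hvf[OF that]])
  have Deq: "?D q = (\<lambda>X. X q) ` ?k" if "q \<in> carrier G" for q by (rule generated_foliation_eq[OF that])
  have semi: "semi_riemannian_metric M g" using assms(2) by (simp add: left_invariant_metric_def)
  have gcomb: "g q (a *\<^sub>R u + c *\<^sub>R v) w = a * g q u w + c * g q v w"
    if "q \<in> carrier G" "u \<in> tangent_space M q" "v \<in> tangent_space M q" "w \<in> tangent_space M q" for q u v w a c
    using semi that unfolding semi_riemannian_metric_def topspace_carrier by simp
  have gsym: "g q v w = g q w v"
    if "q \<in> carrier G" "v \<in> tangent_space M q" "w \<in> tangent_space M q" for q v w
    using semi that unfolding semi_riemannian_metric_def topspace_carrier by simp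
  have gnondeg: "v = 0"
    if "v \<in> ?T" "\<And>w. w \<in> ?T \<Longrightarrow> g p v w = 0" for v
    using semi that p unfolding semi_riemannian_metric_def topspace_carrier by simp
  have gsmooth: "smooth_fun M (topspace (mtop M)) (metric_on g X Y)"
    if "X \<in> vector_fields M" "Y \<in> vector_fields M" for X Y
    using semi that unfolding semi_riemannian_metric_def by simp
  note Tadd = subspace_add[OF subspace_tangent[of p]] and Tscale = subspace_scale[OF subspace_tangent[of p]]
    and Tdiff = subspace_diff[OF subspace_tangent[of p]] and T0 = subspace_0[OF subspace_tangent[of p]]
  have gadd: "g p (u + v) w = g p u w + g p v w" and gscale: "g p (a *\<^sub>R u) w = a * g p u w"
    and gdiff: "g p (u - v) w = g p u w - g p v w"
    if "u \<in> ?T" "v \<in> ?T" "w \<in> ?T" for u v w a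
    using gcomb[OF p that, of 1 1] gcomb[OF p that(1) that(1) that(3), of a 0] gcomb[OF p that, of 1 "-1"] by simp_all
  have gscale1: "g p (a *\<^sub>R u) w = a * g p u w" if "u \<in> ?T" "w \<in> ?T" for u w a
    by (rule gscale[OF that(1,1,2)])
  have glin: "linear_on ?T (\<lambda>u. g p u w)" if "w \<in> ?T" for w
    by (rule linear_onI) (simp_all add: gadd gscale1 that)
  have gadd2: "g p w (u + v) = g p w u + g p w v" and gscale2: "g p w (a *\<^sub>R u) = a * g p w u"
    if "u \<in> ?T" "v \<in> ?T" "w \<in> ?T" for u v w a
    using gadd[OF that] gscale[OF that(1,1,3)] gsym[OF p _ that(3)] that Tadd Tscale by simp_all

  \<comment> \<open>The metric at p as a form on left-invariant fields; by left invariance every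
    other point gives the same form.\<close>
  define b where "b X Y = g p (X p) (Y p)" for X Y
  have blin: "linear_on ?h (\<lambda>X. b X Y)" if "Y \<in> ?h" for Y
    by (rule linear_onI) (simp_all add: b_def gadd gscale1 hT that)
  have bsym: "b X Y = b Y X" if "X \<in> ?h" "Y \<in> ?h" for X Y
    unfolding b_def by (rule gsym[OF p hT[OF that(1)] hT[OF that(2)]])
  have bnondeg: "X = 0" if X: "X \<in> ?h" and 0: "\<And>Y. Y \<in> ?h \<Longrightarrow> b X Y = 0" for X
  proof (rule lie_algebra_eq_0[OF X p])
    show "X p = 0"
    proof (rule gnondeg[OF hT[OF X]])
      fix w assume "w \<in> ?T"
      then obtain Y where "Y \<in> ?h" "Y p = w" using lie_algebra_eval_surj[OF p] by auto
      then show "g p (X p) w = 0" using 0[of Y] by (simp add: b_def)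
    qed
  qed
  have bconst: "g q (X q) (Y q) = b X Y" if "X \<in> ?h" "Y \<in> ?h" "q \<in> carrier G" for X Y q
    unfolding b_def
    using left_invariant_metric_const[OF assms(2) that] left_invariant_metric_const[OF assms(2) that(1,2) p] by simp

  \<comment> \<open>The frame need not be left-invariant. The left-invariant fields with its values
    at p form an orthonormal basis of \<kk>.\<close>
  have "\<exists>Z\<in>?k. Z p = V i p" if "i < m" for i
  proof -
    have "V i p \<in> ?D p" using Vsec[OF that] pM by (simp add: sections_def)
    then obtain X where "X \<in> ?k" "V i p = X p" unfolding Deq[OF p] by auto
    then show ?thesis by (intro bexI[of _ X]) simp
  qed
  then obtain Z where Zk: "\<And>i. i < m \<Longrightarrow> Z i \<in> ?k" and ZV: "\<And>i. i < m \<Longrightarrow> Z i p = V i p"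
    by metis
  have Zh: "Z i \<in> ?h" if "i < m" for i by (rule kh[OF Zk[OF that]])
  have ortho: "b (Z i) (Z j) = (if i = j then \<epsilon> i else 0)" if "i < m" "j < m" for i j
    using Vort[OF that] by (simp add: b_def metric_on_def ZV that)
  have eps2: "\<epsilon> i * \<epsilon> i = 1" and eps0: "\<epsilon> i \<noteq> 0" if "i < m" for i using eps[OF that] by auto
  note ind = orthonormal_independent[where b = b and Z = Z and \<epsilon> = \<epsilon> and n = m, OF h.subspace_L blin Zh ortho eps0]
  have "?k \<subseteq> span (Z ` {..<m})"
  proof
    fix X assume X: "X \<in> ?k"
    have lin: "linear (\<lambda>Y. Y p)" by (rule linearI) auto
    have "X p \<in> span ((\<lambda>Y. Y p) ` Z ` {..<m})"
    proof -
      have "(\<lambda>Y. Y p) ` Z ` {..<m} = (\<lambda>i. V i p) ` {..<m}" using ZV by (auto simp: image_iff)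
      then show ?thesis using Vspan Deq[OF p] X by auto
    qed
    then have "X p \<in> (\<lambda>Y. Y p) ` span (Z ` {..<m})" by (simp add: linear_span_image[OF lin])
    then obtain Y where Y: "Y \<in> span (Z ` {..<m})" "X p = Y p" by auto
    have "span (Z ` {..<m}) \<subseteq> ?h" by (rule span_minimal[OF _ h.subspace_L]) (use Zh in auto)
    then have "X - Y \<in> ?h" using subspace_diff[OF h.subspace_L kh[OF X]] Y(1) by auto
    then have "X - Y = 0" by (rule lie_algebra_eq_0[OF _ p]) (simp add: Y(2))
    then show "X \<in> span (Z ` {..<m})" using Y(1) by simp
  qed
  moreover have "span (Z ` {..<m}) \<subseteq> ?k" by (rule span_minimal[OF _ k.subspace_L]) (use Zk in auto)
  ultimately have Zspan: "span (Z ` {..<m}) = ?k" by (rule antisym[rotated])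
  interpret k: fin_lie_alg ?k ?br Z m
    using ind Zspan by unfold_locales

  \<comment> \<open>The basis \<open>Z\<close> bounds the dimension of \<kk> by m, so codimension
    two leaves at most two vectors beyond \<open>Z\<close>.\<close>
  obtain x y where xy: "x \<in> ?h" "y \<in> ?h" "?h \<subseteq> span (insert x (insert y (Z ` {..<m})))"
  proof -
    obtain C where C: "finite C" "independent C" "card C = dim (model M)" "span C = ?h"
      using lie_algebra_basis by (elim exE conjE) (rule that)
    obtain C' where C': "finite C'" "independent C'" "card C' = dim (model N)" "span C' = ?k"
      using lie_subalgebra_basis by (elim exE conjE) (rule that)
    have "C' \<subseteq> ?k" using C'(4) span_superset[of C'] by simp
    then have "card C' \<le> m" using k.independent_bound[OF C'(2)] by simp
    moreover have "card (Z ` {..<m}) = m" using card_image[OF ind(1)] by simp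
    ultimately have "card C \<le> card (Z ` {..<m}) + 2" using C(3) C'(3) assms(5) by simp
    moreover have "Z ` {..<m} \<subseteq> ?h" using Zh by auto
    ultimately show thesis using codim_two_extension[OF C(1,4) _ ind(2)] that by blast
  qed

  have bexp: "(\<Sum>i<m. (\<epsilon> i * b X (Z i)) *\<^sub>R Z i) = X" if X: "X \<in> ?k" for X
  proof -
    have "b X (Z j) = k.coef X j * \<epsilon> j" if j: "j < m" for j
    proof -
      have "linear_on ?k (\<lambda>X. b X (Z j))" by (rule linear_on_subset[OF blin[OF Zh[OF j]] lie_subalgebra_sub])
      from k.linear_on_expand[OF this X] have "b X (Z j) = (\<Sum>i<m. k.coef X i * b (Z i) (Z j))" by simp
      also have "\<dots> = (\<Sum>i<m. if i = j then k.coef X i * \<epsilon> i else 0)"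
        by (rule sum.cong) (use ortho j in auto)
      finally show ?thesis using j by simp
    qed
    then have "(\<Sum>i<m. (\<epsilon> i * b X (Z i)) *\<^sub>R Z i) = (\<Sum>i<m. k.coef X i *\<^sub>R Z i)"
      using eps2 by (intro sum.cong refl) (simp add: mult.left_commute)
    then show ?thesis using k.expand[OF X] by simp
  qed

  let ?O = "orth M g ?D p"
  have orthI: "w \<in> ?O" if "w \<in> ?T" "\<And>X. X \<in> ?k \<Longrightarrow> g p (X p) w = 0" for w
    using that Deq[OF p] by (auto simp: orth_def)
  have orthD: "w \<in> ?T" "\<And>X. X \<in> ?k \<Longrightarrow> g p (X p) w = 0" if "w \<in> ?O" for w
    using that Deq[OF p] by (auto simp: orth_def)
  have O_sub: "subspace ?O"
  proof (rule subspaceI)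
    show "0 \<in> ?O"
      by (rule orthI[OF T0]) (use gscale2[OF T0 T0, of _ 0] hT kh in simp)
    fix u v c assume u: "u \<in> ?O"
    note u = orthD[OF u]
    show "c *\<^sub>R u \<in> ?O" by (rule orthI[OF Tscale[OF u(1)]]) (simp add: gscale2[OF u(1) u(1)] hT kh u(2))
    assume v: "v \<in> ?O"
    note v = orthD[OF v]
    show "u + v \<in> ?O" by (rule orthI[OF Tadd[OF u(1) v(1)]]) (simp add: gadd2[OF u(1) v(1)] hT kh u(2) v(2))
  qed
  \<comment> \<open>The field in \<kk> whose value at p is the vertical part of w.\<close>
  define pr where "pr w = (\<Sum>i<m. (\<epsilon> i * g p w (Z i p)) *\<^sub>R Z i)" for w
  have pr: "pr w \<in> ?k" "w - pr w p \<in> ?O" if w: "w \<in> ?T" for w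
  proof -
    show k: "pr w \<in> ?k"
      unfolding pr_def by (intro subspace_sum[OF k.subspace_L] subspace_scale[OF k.subspace_L] Zk) auto
    have prT: "pr w p \<in> ?T" by (rule hT[OF kh[OF k]])
    have e: "g p (pr w p) (Z j p) = g p w (Z j p)" if j: "j < m" for j
    proof -
      have "b (pr w) (Z j) = (\<Sum>i<m. (\<epsilon> i * g p w (Z i p)) *\<^sub>R b (Z i) (Z j))"
        unfolding pr_def by (rule linear_on_sum[OF blin[OF Zh[OF j]] h.subspace_L]) (use Zh in auto)
      also have "\<dots> = (\<Sum>i<m. if i = j then (\<epsilon> i * g p w (Z i p)) * \<epsilon> i else 0)"
        by (rule sum.cong) (use ortho j in auto)
      also have "\<dots> = g p w (Z j p)" using j eps2[OF j] by (simp add: mult.commute mult.left_commute)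
      finally show ?thesis by (simp add: b_def)
    qed
    show "w - pr w p \<in> ?O"
    proof (rule orthI[OF Tdiff[OF w prT]])
      fix X assume X: "X \<in> ?k"
      define \<phi> where "\<phi> Y = g p (Y p) (w - pr w p)" for Y
      have "linear_on ?k \<phi>"
        by (rule linear_onI) (simp_all add: \<phi>_def gadd gscale1 hT kh Tdiff[OF w prT])
      from k.linear_on_expand[OF this X] have "\<phi> X = (\<Sum>i<m. k.coef X i * \<phi> (Z i))" by simp
      also have "\<dots> = 0"
      proof (rule sum.neutral, rule ballI)
        fix i assume "i \<in> {..<m}"
        then have i: "i < m" by simp
        note ZT = hT[OF Zh[OF i]]
        have "\<phi> (Z i) = g p (w - pr w p) (Z i p)"
          unfolding \<phi>_def by (rule gsym[OF p ZT Tdiff[OF w prT]])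
        also have "\<dots> = 0" using gdiff[OF w prT ZT] e[OF i] by simp
        finally show "k.coef X i * \<phi> (Z i) = 0" by simp
      qed
      finally show "g p (X p) (w - pr w p) = 0" by (simp add: \<phi>_def)
    qed
  qed
  \<comment> \<open>Evaluates the definite description in \<open>vert\<close>. Uniqueness holds
    because a field in \<kk> orthogonal to all \<open>Z i\<close> is 0 by the expansion
    \<open>bexp\<close>.\<close>
  have vert: "vert M g ?D A p = pr (A p) p" if A: "A p \<in> ?T" for A
    unfolding vert_def
  proof (rule the_equality)
    show "pr (A p) p \<in> ?D p \<and> A p - pr (A p) p \<in> ?O" using pr[OF A] Deq[OF p] by auto
    fix v assume v: "v \<in> ?D p \<and> A p - v \<in> ?O"
    then obtain Y where Y: "Y \<in> ?k" "v = Y p" using Deq[OF p] by auto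
    have d: "pr (A p) - Y \<in> ?k" by (rule subspace_diff[OF k.subspace_L pr(1)[OF A] Y(1)])
    have "(A p - v) - (A p - pr (A p) p) \<in> ?O" using subspace_diff[OF O_sub] v pr(2)[OF A] by blast
    then have dO: "(pr (A p) - Y) p \<in> ?O" using Y(2) by simp
    have "b (pr (A p) - Y) (Z i) = 0" if "i < m" for i
      unfolding b_def using orthD(2)[OF dO Zk[OF that]] gsym[OF p hT[OF kh[OF d]] hT[OF Zh[OF that]]] by simp
    then have "pr (A p) - Y = 0" using bexp[OF d] by simp
    then show "v = pr (A p) p" using Y(2) by simp
  qed

  note LC = assms(3)[unfolded levi_civita_def]
  have nabla_vf: "nabla X Y \<in> vector_fields M" if "X \<in> vector_fields M" "Y \<in> vector_fields M" for X Y
    using LC that by simp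
  have nabla_add: "nabla (X + Y) W = nabla X W + nabla Y W"
    if "X \<in> vector_fields M" "Y \<in> vector_fields M" "W \<in> vector_fields M" for X Y W
    using LC that by simp
  have nabla_mult: "nabla (vf_mult a X) Y = vf_mult a (nabla X Y)"
    if "X \<in> vector_fields M" "Y \<in> vector_fields M" "smooth_fun M (topspace (mtop M)) a" for X Y a
    using LC that by simp
  have torsion: "nabla X Y - nabla Y X = ?br X Y" if "X \<in> vector_fields M" "Y \<in> vector_fields M" for X Y
    using LC that by simp
  have compat: "X p (metric_on g Y W) = metric_on g (nabla X Y) W p + metric_on g Y (nabla X W) p"
    if "X \<in> vector_fields M" "Y \<in> vector_fields M" "W \<in> vector_fields M" for X Y W
    using LC that pM by simp
  have nT: "nabla X Y p \<in> ?T" if "X \<in> vector_fields M" "Y \<in> vector_fields M" for X Y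
    by (rule vector_field_tangent[OF nabla_vf[OF that]])
  have const0: "X p (metric_on g Y W) = 0"
    if X: "X \<in> vector_fields M" and c: "\<And>q. q \<in> carrier G \<Longrightarrow> metric_on g Y W q = c" for X Y W c
  proof -
    have "X p (metric_on g Y W) = X p (\<lambda>q. c)"
      by (rule tangent_local[OF vector_field_tangent[OF X] open_carrier p]) (rule c)
    then show ?thesis using tangent_const[OF vector_field_tangent[OF X]] by simp
  qed
  \<comment> \<open>Products of left-invariant fields are constant functions, so metric
    compatibility makes \<open>nabla X\<close> skew on them.\<close>
  have skew: "g p (nabla X Y p) (W p) = - g p (Y p) (nabla X W p)"
    if X: "X \<in> ?h" and Y: "Y \<in> ?h" and W: "W \<in> ?h" for X Y W
  proof -
    have "X p (metric_on g Y W) = 0"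
      by (rule const0[OF hvf[OF X], of Y W "b Y W"]) (simp add: metric_on_def bconst Y W)
    then show ?thesis using compat[OF hvf[OF X] hvf[OF Y] hvf[OF W]] by (simp add: metric_on_def)
  qed
  have tor: "nabla X Y p = nabla Y X p + ?br X Y p" if "X \<in> ?h" "Y \<in> ?h" for X Y
    using fun_cong[OF torsion[OF hvf[OF that(1)] hvf[OF that(2)]], of p] by (simp add: algebra_simps)
  have brh: "?br X Y \<in> ?h" if "X \<in> ?h" "Y \<in> ?h" for X Y by (rule h.closed[OF that])

  define \<mm> where "\<mm> = {X\<in>?h. \<forall>W\<in>?k. b W X = 0}"
  have mO: "X p \<in> ?O \<longleftrightarrow> X \<in> \<mm>" if "X \<in> ?h" for X
    using orthI[OF hT[OF that]] orthD(2)[of "X p"] that by (auto simp: \<mm>_def b_def)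
  \<comment> \<open>Orthogonality at p spreads to every point because \<open>b\<close> represents
    the metric everywhere.\<close>
  have msec: "X \<in> sections M (orth M g ?D)" if X: "X \<in> \<mm>" for X
  proof -
    have Xh: "X \<in> ?h" using X by (simp add: \<mm>_def)
    have "X q \<in> orth M g ?D q" if q: "q \<in> carrier G" for q
      using vector_field_tangent[OF hvf[OF Xh]] X bconst[OF kh Xh q] by (auto simp: orth_def Deq[OF q] \<mm>_def)
    then show ?thesis using hvf[OF Xh] by (simp add: sections_def topspace_carrier)
  qed
  obtain H where H: "H \<in> sections M ?D"
    and Hc: "\<forall>X\<in>sections M (orth M g ?D). \<forall>Y\<in>sections M (orth M g ?D). \<forall>p\<in>topspace (mtop M).
      second_form_H M g nabla ?D X Y p = metric_on g X Y p *\<^sub>R H p"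
    using assms(7) unfolding conformal_foliation_def by (elim bexE) (rule that)
  have HT: "H p \<in> ?T" using H vector_field_tangent by (auto simp: sections_def)

  \<comment> \<open>Pair \<nabla>_X Y + \<nabla>_Y X with W. Conformality with the vertical field
    \<open>H\<close> gives 2 g(X, Y) g(W, H), whence the factor; skewness and vanishing torsion turn
    the same pairing into the bracket terms on the left.\<close>
  have conf: "b (?br W X) Y + b X (?br W Y) = (2 * g p (W p) (H p)) * b X Y"
    if W: "W \<in> ?k" and X: "X \<in> \<mm>" and Y: "Y \<in> \<mm>" for W X Y
  proof -
    have h: "W \<in> ?h" "X \<in> ?h" "Y \<in> ?h" using kh[OF W] X Y by (auto simp: \<mm>_def)
    note vf = hvf[OF h(1)] hvf[OF h(2)] hvf[OF h(3)]
    note T = hT[OF h(1)] hT[OF h(2)] hT[OF h(3)]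
    define A where "A = nabla X Y + nabla Y X"
    have AT: "A p \<in> ?T" unfolding A_def using Tadd nT vf by simp
    have "g p (W p) (A p - pr (A p) p) = 0" by (rule orthD(2)[OF pr(2)[OF AT] W])
    then have gA: "g p (W p) (A p) = g p (W p) (pr (A p) p)"
      using gdiff[OF AT hT[OF kh[OF pr(1)[OF AT]]] T(1)] gsym[OF p T(1)] AT hT[OF kh[OF pr(1)[OF AT]]]
        Tdiff[OF AT hT[OF kh[OF pr(1)[OF AT]]]] by simp
    have "second_form_H M g nabla ?D X Y p = (1/2) *\<^sub>R pr (A p) p"
      using vert[of A, OF AT] by (simp only: second_form_H_def A_def[symmetric] scaleR_fun_apply)
    then have "(1/2) *\<^sub>R pr (A p) p = b X Y *\<^sub>R H p"
      using Hc[rule_format, OF msec[OF X] msec[OF Y] pM] by (simp add: metric_on_def b_def)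
    then have "2 *\<^sub>R ((1/2) *\<^sub>R pr (A p) p) = 2 *\<^sub>R (b X Y *\<^sub>R H p)" by simp
    then have "pr (A p) p = (2 * b X Y) *\<^sub>R H p" by simp
    then have 1: "g p (W p) (A p) = (2 * b X Y) * g p (W p) (H p)"
      using gA gscale2[OF HT HT T(1)] by simp
    have "g p (W p) (A p) = g p (nabla X Y p) (W p) + g p (nabla Y X p) (W p)"
      using gsym[OF p T(1) AT] gadd[OF nT[OF vf(2,3)] nT[OF vf(3,2)] T(1)] by (simp add: A_def)
    also have "\<dots> = - g p (Y p) (nabla X W p) - g p (X p) (nabla Y W p)"
      using skew[OF h(2,3,1)] skew[OF h(3,2,1)] by simp
    also have "g p (Y p) (nabla X W p) = g p (Y p) (nabla W X p) - b (?br W X) Y"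
    proof -
      have "?br X W p = - ?br W X p" using h.antisym[OF h(2,1)] by simp
      then have "nabla X W p = nabla W X p + (-1) *\<^sub>R ?br W X p" using tor[OF h(2,1)] by simp
      then show ?thesis
        using gadd2[OF nT[OF vf(1,2)] Tscale[OF hT[OF brh[OF h(1,2)]]] T(3), of "-1"] gscale2[OF hT[OF brh[OF h(1,2)]] T0 T(3), of "-1"]
          gsym[OF p T(3) hT[OF brh[OF h(1,2)]]] by (simp add: b_def)
    qed
    also have "g p (X p) (nabla Y W p) = g p (X p) (nabla W Y p) - b X (?br W Y)"
    proof -
      have "?br Y W p = - ?br W Y p" using h.antisym[OF h(3,1)] by simp
      then have "nabla Y W p = nabla W Y p + (-1) *\<^sub>R ?br W Y p" using tor[OF h(3,1)] by simp
      then show ?thesis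
        using gadd2[OF nT[OF vf(1,3)] Tscale[OF hT[OF brh[OF h(1,3)]]] T(2), of "-1"] gscale2[OF hT[OF brh[OF h(1,3)]] T0 T(2), of "-1"]
        by (simp add: b_def)
    qed
    \<comment> \<open>\<nabla>_W is skew, so the two remaining connection terms cancel.\<close>
    also have "g p (Y p) (nabla W X p) = - g p (X p) (nabla W Y p)"
      using skew[OF h(1,2,3)] gsym[OF p T(3) nT[OF vf(1,2)]] by simp
    finally show ?thesis using 1 by (simp add: mult.commute mult.left_commute)
  qed

  have trace0: "(\<Sum>i<m. \<epsilon> i * b (?br X (Z i)) (Z i)) = 0" if "X \<in> \<mm>" for X
    by (rule k.conformal_complement_trace_eq_0[OF lie_alg_lie_algebra lie_subalgebra_sub
          semisimple_lie_subalgebra[OF assms(8)] blin bsym bnondeg ortho eps2 xy conf \<mm>_def that])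

  have nabla_zero: "nabla 0 X = 0" if "X \<in> vector_fields M" for X
    using nabla_add[OF VF.zero_mem VF.zero_mem that] by simp
  have nabla_sum: "nabla (\<Sum>j\<in>J. W j) X = (\<Sum>j\<in>J. nabla (W j) X)"
    if X: "X \<in> vector_fields M" and W: "\<And>j. j \<in> J \<Longrightarrow> W j \<in> vector_fields M" for J X and W :: "nat \<Rightarrow> 'a vfield"
    using W
  proof (induction J rule: infinite_finite_induct)
    case (insert j J)
    have sW: "(\<Sum>j\<in>J. W j) \<in> vector_fields M" by (intro subspace_sum[OF VF.subspace_L]) (use insert.prems in auto)
    have IH: "nabla (\<Sum>j\<in>J. W j) X = (\<Sum>j\<in>J. nabla (W j) X)" by (rule insert.IH) (use insert.prems in auto)
    show ?case
      unfolding sum.insert[OF insert.hyps(1,2)] IH[symmetric]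
      by (rule nabla_add[OF _ sW X]) (use insert.prems in auto)
  qed (simp_all add: nabla_zero[OF X])
  have Vvf: "V i \<in> vector_fields M" if "i < m" for i using Vsec[OF that] by (simp add: sections_def)
  \<comment> \<open>The \<open>Z j\<close> frame the distribution on all of G, so V i is a
    combination of them with globally smooth coefficients \<open>a j\<close>. Function-linearity in
    the first argument then reduces the claim to the values of \<open>a j\<close> at p, which are 1
    for j = i and 0 otherwise.\<close>
  have tens: "nabla (V i) X p = nabla (Z i) X p" if i: "i < m" and X: "X \<in> vector_fields M" for i X
  proof -
    define a where "a j = (\<lambda>q. \<epsilon> j * metric_on g (V i) (Z j) q)" for j
    have a: "smooth_fun M (topspace (mtop M)) (a j)" if "j < m" for j
      unfolding a_def by (intro smooth_fun_scale gsmooth Vvf[OF i] hvf Zh that)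
    have aZ: "vf_mult (a j) (Z j) \<in> vector_fields M" if "j < m" for j
      by (rule vf_mult_vector_field[OF hvf[OF Zh[OF that]] a[OF that]])
    have "V i = (\<Sum>j<m. vf_mult (a j) (Z j))"
    proof
      fix q
      show "V i q = (\<Sum>j<m. vf_mult (a j) (Z j)) q"
      proof (cases "q \<in> carrier G")
        case True
        then have "V i q \<in> ?D q" using Vsec[OF i] by (simp add: sections_def topspace_carrier)
        then obtain d where d: "d \<in> ?k" "V i q = d q" using Deq[OF True] by auto
        have "a j q = \<epsilon> j * b d (Z j)" if "j < m" for j
          using bconst[OF kh[OF d(1)] Zh[OF that] True] by (simp add: a_def metric_on_def d(2))
        then have "(\<Sum>j<m. vf_mult (a j) (Z j)) q = (\<Sum>j<m. (\<epsilon> j * b d (Z j)) *\<^sub>R Z j) q"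
          by (simp add: sum_fun_apply vf_mult_def)
        then show ?thesis using bexp[OF d(1)] d(2) by simp
      next
        case False
        then have "q \<notin> topspace (mtop M)" by (simp add: topspace_carrier)
        then show ?thesis using vector_fieldD(2)[OF Vvf[OF i]] vector_fieldD(2)[OF hvf[OF Zh]]
          by (simp add: sum_fun_apply vf_mult_def)
      qed
    qed
    then have "nabla (V i) X = (\<Sum>j<m. nabla (vf_mult (a j) (Z j)) X)"
      using nabla_sum[OF X, of "{..<m}" "\<lambda>j. vf_mult (a j) (Z j)"] aZ by simp
    also have "\<dots> = (\<Sum>j<m. vf_mult (a j) (nabla (Z j) X))"
      by (rule sum.cong) (use nabla_mult[OF hvf[OF Zh] X a] in auto)
    finally have "nabla (V i) X p = (\<Sum>j<m. a j p *\<^sub>R nabla (Z j) X p)"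
      by (simp add: sum_fun_apply vf_mult_def)
    also have "\<dots> = (\<Sum>j<m. if j = i then nabla (Z j) X p else 0)"
    proof (rule sum.cong[OF refl])
      fix j assume "j \<in> {..<m}"
      then have j: "j < m" by simp
      have "a j p = (if j = i then 1 else 0)"
        using ortho[OF i j] eps2[OF i] by (cases "j = i") (simp_all add: a_def metric_on_def b_def ZV[OF i, symmetric])
      then show "a j p *\<^sub>R nabla (Z j) X p = (if j = i then nabla (Z j) X p else 0)" by simp
    qed
    finally show ?thesis using i by simp
  qed

  define S where "S = (\<Sum>i<m. \<epsilon> i *\<^sub>R second_form_V M g nabla ?D (V i) (V i) p)"
  define B where "B i = nabla (V i) (V i) p" for i
  have BT: "B i \<in> ?T" if "i < m" for i unfolding B_def by (rule nT[OF Vvf[OF that] Vvf[OF that]])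
  have BB: "(nabla (V i) (V i) + nabla (V i) (V i)) p = 2 *\<^sub>R B i" for i by (simp add: B_def scaleR_2)
  \<comment> \<open>\<open>second_form_V\<close> symmetrises before projecting, so on the diagonal
    its argument is 2 B i, and \<open>h2 i\<close> is the horizontal part of that.\<close>
  define h2 where "h2 i = 2 *\<^sub>R B i - pr (2 *\<^sub>R B i) p" for i
  have h2O: "h2 i \<in> ?O" if "i < m" for i unfolding h2_def by (rule pr(2)[OF Tscale[OF BT[OF that]]])
  have form: "second_form_V M g nabla ?D (V i) (V i) p = (1/2) *\<^sub>R h2 i" if "i < m" for i
  proof -
    have "vert M g ?D (nabla (V i) (V i) + nabla (V i) (V i)) p = pr (2 *\<^sub>R B i) p"
      using vert[of "nabla (V i) (V i) + nabla (V i) (V i)"] Tscale[OF BT[OF that]] unfolding BB by blast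
    then show ?thesis unfolding second_form_V_def hor_def h2_def scaleR_fun_apply minus_apply BB by simp
  qed
  have S: "S = (\<Sum>i<m. \<epsilon> i *\<^sub>R ((1/2) *\<^sub>R h2 i))"
    unfolding S_def by (rule sum.cong) (use form in auto)
  have SO: "S \<in> ?O"
    unfolding S by (intro subspace_sum[OF O_sub] subspace_scale[OF O_sub] h2O) auto
  have SX: "g p S (X p) = 0" if X: "X \<in> \<mm>" for X
  proof -
    have Xh: "X \<in> ?h" using X by (simp add: \<mm>_def)
    note Xv = hvf[OF Xh] and XT = hT[OF Xh]
    have XO: "X p \<in> ?O" using mO[OF Xh] X by simp
    have gh2: "g p (h2 i) (X p) = 2 * g p (B i) (X p)" if i: "i < m" for i
    proof -
      note k = pr(1)[OF Tscale[OF BT[OF i]], of 2]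
      show ?thesis
        unfolding h2_def using gdiff[OF Tscale[OF BT[OF i]] hT[OF kh[OF k]] XT] gscale[OF BT[OF i] BT[OF i] XT]
          orthD(2)[OF XO k] by simp
    qed
    \<comment> \<open>V i is orthogonal to X everywhere, so differentiating along V i gives g(B i,
      X) = - g(Z i, \<nabla> X) with the derivative taken along Z i. The torsion identity replaces
      it by \<nabla>_X Z i minus the bracket, and g(Z i, \<nabla>_X Z i) = 0 by skewness.\<close>
    have gB: "g p (B i) (X p) = b (?br X (Z i)) (Z i)" if i: "i < m" for i
    proof -
      note Zi = Zh[OF i] and ZT = hT[OF Zh[OF i]]
      have "V i p (metric_on g (V i) X) = 0"
      proof (rule const0[OF Vvf[OF i]])
        fix q assume q: "q \<in> carrier G"
        have "V i q \<in> ?D q" using Vsec[OF i] q by (simp add: sections_def topspace_carrier)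
        then obtain d where d: "d \<in> ?k" "V i q = d q" using Deq[OF q] by auto
        show "metric_on g (V i) X q = 0"
          using bconst[OF kh[OF d(1)] Xh q] X d by (simp add: metric_on_def \<mm>_def)
      qed
      then have "g p (B i) (X p) = - g p (Z i p) (nabla (Z i) X p)"
        using compat[OF Vvf[OF i] Vvf[OF i] Xv] tens[OF i Xv] by (simp add: metric_on_def B_def ZV[OF i])
      also have "nabla (Z i) X p = nabla X (Z i) p + (-1) *\<^sub>R ?br X (Z i) p"
        using tor[OF Zi Xh] h.antisym[OF Zi Xh] by simp
      also have "g p (Z i p) (nabla X (Z i) p + (-1) *\<^sub>R ?br X (Z i) p) = g p (Z i p) (nabla X (Z i) p) - b (?br X (Z i)) (Z i)"
        using gadd2[OF nT[OF Xv hvf[OF Zi]] Tscale[OF hT[OF brh[OF Xh Zi]]] ZT, of "-1"] gscale2[OF hT[OF brh[OF Xh Zi]] T0 ZT, of "-1"]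
          gsym[OF p ZT hT[OF brh[OF Xh Zi]]] by (simp add: b_def)
      also have "g p (Z i p) (nabla X (Z i) p) = 0"
        using skew[OF Xh Zi Zi] gsym[OF p ZT nT[OF Xv hvf[OF Zi]]] by simp
      finally show ?thesis by simp
    qed
    have "g p S (X p) = (\<Sum>i<m. \<epsilon> i *\<^sub>R g p ((1/2) *\<^sub>R h2 i) (X p))"
      unfolding S by (rule linear_on_sum[OF glin[OF XT] subspace_tangent]) (use h2O orthD(1) Tscale in auto)
    also have "\<dots> = (\<Sum>i<m. \<epsilon> i * b (?br X (Z i)) (Z i))"
    proof (rule sum.cong[OF refl])
      fix i assume "i \<in> {..<m}"
      then have i: "i < m" by simp
      show "\<epsilon> i *\<^sub>R g p ((1/2) *\<^sub>R h2 i) (X p) = \<epsilon> i * b (?br X (Z i)) (Z i)"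
        using gscale[OF orthD(1)[OF h2O[OF i]] orthD(1)[OF h2O[OF i]] XT, of "1/2"] gh2[OF i] gB[OF i] by simp
    qed
    finally show ?thesis using trace0[OF X] by simp
  qed
  have ST: "S \<in> ?T" by (rule orthD(1)[OF SO])
  \<comment> \<open>S is horizontal, hence orthogonal to vertical vectors, and by \<open>SX\<close>
    it is orthogonal to horizontal ones as well.\<close>
  have "S = 0"
  proof (rule gnondeg[OF ST])
    fix w assume w: "w \<in> ?T"
    note k = pr(1)[OF w] and o = pr(2)[OF w]
    note kT = hT[OF kh[OF k]]
    obtain X where X: "X \<in> ?h" "X p = w - pr w p" using lie_algebra_eval_surj[OF p orthD(1)[OF o]] by auto
    have "X \<in> \<mm>" using mO[OF X(1)] X(2) o by simp
    then have 1: "g p S (w - pr w p) = 0" using SX[of X] X(2) by simp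
    have 2: "g p S (pr w p) = 0" using orthD(2)[OF SO k] gsym[OF p kT ST] by simp
    have "g p S w = g p S ((w - pr w p) + pr w p)" by simp
    also have "\<dots> = g p S (w - pr w p) + g p S (pr w p)" by (rule gadd2[OF orthD(1)[OF o] kT ST])
    finally show "g p S w = 0" using 1 2 by simp
  qed
  then show "(\<Sum>i<m. \<epsilon> i *\<^sub>R second_form_V M g nabla ?D (V i) (V i) p) = 0" by (simp add: S_def)
qed

end
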